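(* Let $G$ be a profinite group, $R$ a unital ring, and $X$ a profinite $G$-space. The infinite product in the category of $G$-sheaves of $R$-modules over $X$ is given by the equivariant sheafification of the underlying product of $G$-presheaves of $R$-modules, and is independent (up to natural isomorphism) of the choice of open-closed basis for the category of presheaves. That is, for any basis $\mathcal{B}$ of the topology of $X$ consisting of open-closed sets, and any set $\{F_i\}_{i\in I}$ of $G$-sheaves of $R$-modules over $X$, $$\ell\,{\prod_{i\in I}}^{P}F_i$$ is the product of the $F_i$ in the category of $G$-sheaves of $R$-modules over $X$, where $\prod^P$ denotes the product of $G$-presheaves of $R$-modules over $\mathcal{B}$.
   Context: A profinite space is a compact, Hausdorff, totally disconnected space; a profinite group is a topological group whose underlying space is profinite. A $G$-sheaf of $R$-modules over $X$ is a $G$-equivariant local homeomorphism $p\colon E\to X$, with $E$ a space with continuous $G$-action, such that each stalk $E_x=p^{-1}(x)$ is an $R$-module, the fibrewise subtraction $E\times_XE\to E$ and each map $e\mapsto re$ ($r\in R$) are continuous, and each map $g\colon E_x\to E_{gx}$ is $R$-linear. Morphisms are continuous $G$-equivariant maps over $X$, $R$-linear on stalks. $E(U)$ denotes all continuous sections over $U$, and $g\ast s=g\circ s\circ g^{-1}\in E(gU)$. $\mathcal{O}_G(\mathcal{B})$ has objects the elements of $\mathcal{B}$ and morphisms $U\to V$ the elements $g\in G$ with $gU\subseteq V$. A $G$-presheaf of $R$-modules over $\mathcal{B}$ is a functor $F\colon\mathcal{O}_G(\mathcal{B})^{op}\to R\text{-mod}$ such that for each $U\in\mathcal{B}$ the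 action of $\mathrm{stab}_G(U)=\{g\mid gU=U\}$ on $F(U)$ is continuous for the discrete topology on $F(U)$. Every $G$-sheaf has an underlying $G$-presheaf $U\mapsto E(U)$. The product of $G$-presheaves $\{F_i\}$ is $$\Big({\prod_{i\in I}}^{P}F_i\Big)(U)=\mathrm{disc}\prod_{i\in I}F_i(U),$$ where for an $R[H]$-module $M$, $H=\mathrm{stab}_G(U)$, $\mathrm{disc}(M)=\bigcup_{L}M^L$ over the open subgroups $L$ of $H$. Equivariant sheafification $\ell F$ of a $G$-presheaf $F$: the sheaf space $\coprod_{x\in X}F_x$ with $F_x=\operatorname{colim}_{x\in U\in\mathcal{B}}F(U)$, topology generated by the sets $\{s_x\mid x\in U\}$ ($U\in\mathcal{B}$, $s\in F(U)$, $s_x$ the germ), and $G$-action as follows: for $s\in F(U)$, $x\in U$, $g\in G$, choose $V\in\mathcal{B}$ with $gx\in V\subseteq gU$ and let $g(s_x)$ be the germ at $gx$ of the image of $s$ under $F(g^{-1}\colon V\to U)$ (when $gU\in\mathcal{B}$ one may take $V=gU$). *)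

theory Defs
  imports
    "HOL-Analysis.Abstract_Topological_Spaces"
    "HOL-Algebra.Group_Action"
    "HOL-Algebra.Module"
begin

section \<open>Profinite groups and spaces\<close>

definition totally_disconnected_space :: "'a topology \<Rightarrow> bool" where
  "totally_disconnected_space X \<longleftrightarrow> (\<forall>S. connectedin X S \<longrightarrow> (\<exists>a. S \<subseteq> {a}))"

definition profinite_space :: "'a topology \<Rightarrow> bool" where
  "profinite_space X \<longleftrightarrow>
     compact_space X \<and> Hausdorff_space X \<and> totally_disconnected_space X"

definition topological_group :: "('g, 'z) monoid_scheme \<Rightarrow> 'g topology \<Rightarrow> bool" where
  "topological_group G T \<longleftrightarrow>
     group G \<and> topspace T = carrier G \<and>
     continuous_map (prod_topology T T) T (\<lambda>(g, h). g \<otimes>\<^bsub>G\<^esub> h) \<and>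
     continuous_map T T (\<lambda>g. inv\<^bsub>G\<^esub> g)"

definition profinite_group :: "('g, 'z) monoid_scheme \<Rightarrow> 'g topology \<Rightarrow> bool" where
  "profinite_group G T \<longleftrightarrow> topological_group G T \<and> profinite_space T"

definition continuous_action ::
  "('g, 'z) monoid_scheme \<Rightarrow> 'g topology \<Rightarrow> 'x topology \<Rightarrow> ('g \<Rightarrow> 'x \<Rightarrow> 'x) \<Rightarrow> bool" where
  "continuous_action G T X act \<longleftrightarrow>
     group_action G (topspace X) act \<and>
     continuous_map (prod_topology T X) X (\<lambda>(g, x). act g x)"

definition clopen_basis :: "'x topology \<Rightarrow> 'x set set \<Rightarrow> bool" where
  "clopen_basis X B \<longleftrightarrow>
     (\<forall>U\<in>B. openin X U \<and> closedin X U) \<and> openin X = arbitrary union_of (\<lambda>U. U \<in> B)"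

abbreviation set_stabilizer ::
  "('g, 'z) monoid_scheme \<Rightarrow> ('g \<Rightarrow> 'x \<Rightarrow> 'x) \<Rightarrow> 'x set \<Rightarrow> 'g set" where
  "set_stabilizer G act U \<equiv> stabilizer G (\<lambda>g V. act g ` V) U"


section \<open>Modules over a not necessarily commutative ring\<close>

text \<open>The library locale for modules requires a commutative ring of scalars. Here we only reuse its
  record type; the fields \<open>mult\<close> and \<open>one\<close>, which it inherits from rings, play no role.\<close>

locale left_module = R?: ring R + M?: abelian_group M
  for R :: "('r, 'w) ring_scheme" (structure)
    and M :: "('r, 'm, 'v) module_scheme" (structure) +
  assumes smult_closed: "\<lbrakk>a \<in> carrier R; x \<in> carrier M\<rbrakk> \<Longrightarrow> a \<odot>\<^bsub>M\<^esub> x \<in> carrier M"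
    and smult_l_distr: "\<lbrakk>a \<in> carrier R; b \<in> carrier R; x \<in> carrier M\<rbrakk> \<Longrightarrow>
          (a \<oplus>\<^bsub>R\<^esub> b) \<odot>\<^bsub>M\<^esub> x = a \<odot>\<^bsub>M\<^esub> x \<oplus>\<^bsub>M\<^esub> b \<odot>\<^bsub>M\<^esub> x"
    and smult_r_distr: "\<lbrakk>a \<in> carrier R; x \<in> carrier M; y \<in> carrier M\<rbrakk> \<Longrightarrow>
          a \<odot>\<^bsub>M\<^esub> (x \<oplus>\<^bsub>M\<^esub> y) = a \<odot>\<^bsub>M\<^esub> x \<oplus>\<^bsub>M\<^esub> a \<odot>\<^bsub>M\<^esub> y"
    and smult_assoc: "\<lbrakk>a \<in> carrier R; b \<in> carrier R; x \<in> carrier M\<rbrakk> \<Longrightarrow>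
          (a \<otimes>\<^bsub>R\<^esub> b) \<odot>\<^bsub>M\<^esub> x = a \<odot>\<^bsub>M\<^esub> (b \<odot>\<^bsub>M\<^esub> x)"
    and smult_one: "x \<in> carrier M \<Longrightarrow> \<one>\<^bsub>R\<^esub> \<odot>\<^bsub>M\<^esub> x = x"

definition linear_hom ::
  "('r, 'w) ring_scheme \<Rightarrow> ('r, 'm) module \<Rightarrow> ('r, 'n) module \<Rightarrow> ('m \<Rightarrow> 'n) \<Rightarrow> bool" where
  "linear_hom R M N f \<longleftrightarrow>
     f \<in> carrier M \<rightarrow> carrier N \<and>
     (\<forall>x\<in>carrier M. \<forall>y\<in>carrier M. f (x \<oplus>\<^bsub>M\<^esub> y) = f x \<oplus>\<^bsub>N\<^esub> f y) \<and>
     (\<forall>a\<in>carrier R. \<forall>x\<in>carrier M. f (a \<odot>\<^bsub>M\<^esub> x) = a \<odot>\<^bsub>N\<^esub> f x)"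

definition module_product :: "'i set \<Rightarrow> ('i \<Rightarrow> ('r, 'm) module) \<Rightarrow> ('r, 'i \<Rightarrow> 'm) module" where
  "module_product I M =
     \<lparr>carrier = (\<Pi>\<^sub>E i\<in>I. carrier (M i)), mult = undefined, one = undefined,
      zero = (\<lambda>i\<in>I. \<zero>\<^bsub>M i\<^esub>), add = (\<lambda>s t. \<lambda>i\<in>I. s i \<oplus>\<^bsub>M i\<^esub> t i),
      smult = (\<lambda>a s. \<lambda>i\<in>I. a \<odot>\<^bsub>M i\<^esub> s i)\<rparr>"

text \<open>The discrete part of a module \<open>M\<close> on which the subgroup \<open>H\<close> of \<open>G\<close> acts by \<open>\<rho>\<close>.\<close>

definition discrete_part ::
  "('g, 'z) monoid_scheme \<Rightarrow> 'g topology \<Rightarrow> 'g set \<Rightarrow> ('g \<Rightarrow> 'm \<Rightarrow> 'm)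
    \<Rightarrow> ('r, 'm) module \<Rightarrow> ('r, 'm) module" where
  "discrete_part G T H \<rho> M =
     M\<lparr>carrier := {m \<in> carrier M.
        \<exists>L. subgroup L (G\<lparr>carrier := H\<rparr>) \<and> openin (subtopology T H) L \<and> (\<forall>h\<in>L. \<rho> h m = m)}\<rparr>"


section \<open>Equivariant sheaves\<close>

record ('g, 'x, 'r, 'e) gsheaf =
  sh_space :: "'e topology"
  sh_proj :: "'e \<Rightarrow> 'x"
  sh_act :: "'g \<Rightarrow> 'e \<Rightarrow> 'e"
  sh_stalk :: "'x \<Rightarrow> ('r, 'e) module"

definition local_homeomorphism :: "'e topology \<Rightarrow> 'x topology \<Rightarrow> ('e \<Rightarrow> 'x) \<Rightarrow> bool" where
  "local_homeomorphism E X p \<longleftrightarrow>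
     continuous_map E X p \<and>
     (\<forall>e\<in>topspace E. \<exists>W V. openin E W \<and> e \<in> W \<and> openin X V \<and>
        homeomorphic_map (subtopology E W) (subtopology X V) p)"

definition is_gsheaf ::
  "('g, 'z) monoid_scheme \<Rightarrow> 'g topology \<Rightarrow> ('r, 'w) ring_scheme \<Rightarrow> 'x topology
    \<Rightarrow> ('g \<Rightarrow> 'x \<Rightarrow> 'x) \<Rightarrow> ('g, 'x, 'r, 'e) gsheaf \<Rightarrow> bool" where
  "is_gsheaf G T R X act E \<longleftrightarrow>
     continuous_action G T (sh_space E) (sh_act E) \<and>
     local_homeomorphism (sh_space E) X (sh_proj E) \<and>
     (\<forall>g\<in>carrier G. \<forall>e\<in>topspace (sh_space E). sh_proj E (sh_act E g e) = act g (sh_proj E e)) \<and>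
     (\<forall>x\<in>topspace X. left_module R (sh_stalk E x) \<and>
        carrier (sh_stalk E x) = {e \<in> topspace (sh_space E). sh_proj E e = x}) \<and>
     continuous_map
       (subtopology (prod_topology (sh_space E) (sh_space E)) {(a, b). sh_proj E a = sh_proj E b})
       (sh_space E) (\<lambda>(a, b). a \<ominus>\<^bsub>sh_stalk E (sh_proj E a)\<^esub> b) \<and>
     (\<forall>r\<in>carrier R. continuous_map (sh_space E) (sh_space E)
        (\<lambda>e. r \<odot>\<^bsub>sh_stalk E (sh_proj E e)\<^esub> e)) \<and>
     (\<forall>g\<in>carrier G. \<forall>x\<in>topspace X.
        linear_hom R (sh_stalk E x) (sh_stalk E (act g x)) (sh_act E g))"

definition gsheaf_morphism ::
  "('g, 'z) monoid_scheme \<Rightarrow> ('r, 'w) ring_scheme \<Rightarrow> 'x topology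
    \<Rightarrow> ('g, 'x, 'r, 'd) gsheaf \<Rightarrow> ('g, 'x, 'r, 'e) gsheaf \<Rightarrow> ('d \<Rightarrow> 'e) \<Rightarrow> bool" where
  "gsheaf_morphism G R X D E f \<longleftrightarrow>
     continuous_map (sh_space D) (sh_space E) f \<and>
     (\<forall>d\<in>topspace (sh_space D). sh_proj E (f d) = sh_proj D d) \<and>
     (\<forall>g\<in>carrier G. \<forall>d\<in>topspace (sh_space D). f (sh_act D g d) = sh_act E g (f d)) \<and>
     (\<forall>x\<in>topspace X. linear_hom R (sh_stalk D x) (sh_stalk E x) f)"

definition gsheaf_isomorphism ::
  "('g, 'z) monoid_scheme \<Rightarrow> ('r, 'w) ring_scheme \<Rightarrow> 'x topology
    \<Rightarrow> ('g, 'x, 'r, 'd) gsheaf \<Rightarrow> ('g, 'x, 'r, 'e) gsheaf \<Rightarrow> ('d \<Rightarrow> 'e) \<Rightarrow> bool" where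
  "gsheaf_isomorphism G R X D E f \<longleftrightarrow>
     gsheaf_morphism G R X D E f \<and>
     (\<exists>k. gsheaf_morphism G R X E D k \<and>
        (\<forall>d\<in>topspace (sh_space D). k (f d) = d) \<and> (\<forall>e\<in>topspace (sh_space E). f (k e) = e))"

definition sections ::
  "'x topology \<Rightarrow> ('g, 'x, 'r, 'e) gsheaf \<Rightarrow> 'x set \<Rightarrow> ('r, 'x \<Rightarrow> 'e) module" where
  "sections X E U =
     \<lparr>carrier = {s \<in> extensional U.
        continuous_map (subtopology X U) (sh_space E) s \<and> (\<forall>x\<in>U. sh_proj E (s x) = x)},
      mult = undefined, one = undefined,
      zero = (\<lambda>x\<in>U. \<zero>\<^bsub>sh_stalk E x\<^esub>), add = (\<lambda>s t. \<lambda>x\<in>U. s x \<oplus>\<^bsub>sh_stalk E x\<^esub> t x),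
      smult = (\<lambda>a s. \<lambda>x\<in>U. a \<odot>\<^bsub>sh_stalk E x\<^esub> s x)\<rparr>"


section \<open>Equivariant presheaves\<close>

text \<open>\<open>ps_map F U V g\<close> is \<open>F(g) : F(V) \<rightarrow> F(U)\<close> for the arrow \<open>g : U \<rightarrow> V\<close>, that is, \<open>g U \<subseteq> V\<close>.
  The group element alone does not determine source and target of the arrow.\<close>

record ('g, 'x, 'r, 'm) gpresheaf =
  ps_sect :: "'x set \<Rightarrow> ('r, 'm) module"
  ps_map :: "'x set \<Rightarrow> 'x set \<Rightarrow> 'g \<Rightarrow> 'm \<Rightarrow> 'm"

text \<open>Presheaves are contravariant, so the left action of \<open>h\<close> in the stabilizer of \<open>U\<close> on \<open>F(U)\<close>
  is \<open>F(h\<^sup>-\<^sup>1)\<close>.\<close>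

definition ps_act ::
  "('g, 'z) monoid_scheme \<Rightarrow> ('g, 'x, 'r, 'm) gpresheaf \<Rightarrow> 'x set \<Rightarrow> 'g \<Rightarrow> 'm \<Rightarrow> 'm" where
  "ps_act G F U h = ps_map F U U (inv\<^bsub>G\<^esub> h)"

definition is_gpresheaf ::
  "('g, 'z) monoid_scheme \<Rightarrow> 'g topology \<Rightarrow> ('r, 'w) ring_scheme
    \<Rightarrow> ('g \<Rightarrow> 'x \<Rightarrow> 'x) \<Rightarrow> 'x set set \<Rightarrow> ('g, 'x, 'r, 'm) gpresheaf \<Rightarrow> bool" where
  "is_gpresheaf G T R act B F \<longleftrightarrow>
     (\<forall>U\<in>B. left_module R (ps_sect F U)) \<and>
     (\<forall>U\<in>B. \<forall>V\<in>B. \<forall>g\<in>carrier G. act g ` U \<subseteq> V \<longrightarrow>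
        linear_hom R (ps_sect F V) (ps_sect F U) (ps_map F U V g)) \<and>
     (\<forall>U\<in>B. \<forall>s\<in>carrier (ps_sect F U). ps_map F U U \<one>\<^bsub>G\<^esub> s = s) \<and>
     (\<forall>U\<in>B. \<forall>V\<in>B. \<forall>W\<in>B. \<forall>g\<in>carrier G. \<forall>h\<in>carrier G.
        act g ` U \<subseteq> V \<and> act h ` V \<subseteq> W \<longrightarrow>
        (\<forall>s\<in>carrier (ps_sect F W).
           ps_map F U W (h \<otimes>\<^bsub>G\<^esub> g) s = ps_map F U V g (ps_map F V W h s))) \<and>
     (\<forall>U\<in>B. continuous_map
        (prod_topology (subtopology T (set_stabilizer G act U))
                       (discrete_topology (carrier (ps_sect F U))))
        (discrete_topology (carrier (ps_sect F U)))
        (\<lambda>(h, s). ps_act G F U h s))"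

text \<open>For an arrow \<open>g : U \<rightarrow> V\<close>, a section \<open>s\<close> over \<open>V\<close> is restricted to \<open>g U\<close> and translated by
  \<open>g\<^sup>-\<^sup>1\<close>, which gives \<open>g\<^sup>-\<^sup>1 \<circ> s \<circ> g\<close> on \<open>U\<close>.\<close>

definition underlying_presheaf ::
  "('g, 'z) monoid_scheme \<Rightarrow> 'x topology \<Rightarrow> ('g \<Rightarrow> 'x \<Rightarrow> 'x)
    \<Rightarrow> ('g, 'x, 'r, 'e) gsheaf \<Rightarrow> ('g, 'x, 'r, 'x \<Rightarrow> 'e) gpresheaf" where
  "underlying_presheaf G X act E =
     \<lparr>ps_sect = sections X E,
      ps_map = (\<lambda>U V g s. \<lambda>x\<in>U. sh_act E (inv\<^bsub>G\<^esub> g) (s (act g x)))\<rparr>"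

definition presheaf_product ::
  "('g, 'z) monoid_scheme \<Rightarrow> 'g topology \<Rightarrow> ('g \<Rightarrow> 'x \<Rightarrow> 'x) \<Rightarrow> 'i set
    \<Rightarrow> ('i \<Rightarrow> ('g, 'x, 'r, 'm) gpresheaf) \<Rightarrow> ('g, 'x, 'r, 'i \<Rightarrow> 'm) gpresheaf" where
  "presheaf_product G T act I F =
     \<lparr>ps_sect = (\<lambda>U. discrete_part G T (set_stabilizer G act U)
                        (\<lambda>h s. \<lambda>i\<in>I. ps_act G (F i) U h (s i))
                        (module_product I (\<lambda>i. ps_sect (F i) U))),
      ps_map = (\<lambda>U V g s. \<lambda>i\<in>I. ps_map (F i) U V g (s i))\<rparr>"


section \<open>Equivariant sheafification\<close>

text \<open>The germ at \<open>x\<close> of \<open>s \<in> F(U)\<close>: its class in the filtered colimit of the \<open>F(V)\<close> over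
  \<open>x \<in> V \<in> B\<close>, tagged with \<open>x\<close> so that germs at different points differ.\<close>

type_synonym ('x, 'm) germ = "'x \<times> ('x set \<times> 'm) set"

definition germ ::
  "('g, 'z) monoid_scheme \<Rightarrow> 'x set set \<Rightarrow> ('g, 'x, 'r, 'm) gpresheaf
    \<Rightarrow> 'x \<Rightarrow> 'x set \<Rightarrow> 'm \<Rightarrow> ('x, 'm) germ" where
  "germ G B F x U s =
     (x, {(V, t). V \<in> B \<and> x \<in> V \<and> t \<in> carrier (ps_sect F V) \<and>
            (\<exists>W\<in>B. x \<in> W \<and> W \<subseteq> U \<and> W \<subseteq> V \<and>
               ps_map F W U \<one>\<^bsub>G\<^esub> s = ps_map F W V \<one>\<^bsub>G\<^esub> t)})"

definition germ_stalk ::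
  "('g, 'z) monoid_scheme \<Rightarrow> 'x set set \<Rightarrow> ('g, 'x, 'r, 'm) gpresheaf
    \<Rightarrow> 'x \<Rightarrow> ('r, ('x, 'm) germ) module" where
  "germ_stalk G B F x =
     \<lparr>carrier = {germ G B F x U s |U s. U \<in> B \<and> x \<in> U \<and> s \<in> carrier (ps_sect F U)},
      mult = undefined, one = undefined,
      zero = (THE c. \<exists>U\<in>B. x \<in> U \<and> c = germ G B F x U \<zero>\<^bsub>ps_sect F U\<^esub>),
      add = (\<lambda>a b. THE c. \<exists>U\<in>B. \<exists>s\<in>carrier (ps_sect F U). \<exists>t\<in>carrier (ps_sect F U). x \<in> U \<and>
               a = germ G B F x U s \<and> b = germ G B F x U t \<and>
               c = germ G B F x U (s \<oplus>\<^bsub>ps_sect F U\<^esub> t)),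
      smult = (\<lambda>r a. THE c. \<exists>U\<in>B. \<exists>s\<in>carrier (ps_sect F U). x \<in> U \<and>
               a = germ G B F x U s \<and> c = germ G B F x U (r \<odot>\<^bsub>ps_sect F U\<^esub> s))\<rparr>"

definition germ_topology ::
  "('g, 'z) monoid_scheme \<Rightarrow> 'x set set \<Rightarrow> ('g, 'x, 'r, 'm) gpresheaf
    \<Rightarrow> ('x, 'm) germ topology" where
  "germ_topology G B F =
     topology_generated_by
       {(\<lambda>x. germ G B F x U s) ` U |U s. U \<in> B \<and> s \<in> carrier (ps_sect F U)}"

definition germ_act ::
  "('g, 'z) monoid_scheme \<Rightarrow> ('g \<Rightarrow> 'x \<Rightarrow> 'x) \<Rightarrow> 'x set set \<Rightarrow> ('g, 'x, 'r, 'm) gpresheaf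
    \<Rightarrow> 'g \<Rightarrow> ('x, 'm) germ \<Rightarrow> ('x, 'm) germ" where
  "germ_act G act B F g = (\<lambda>e\<in>topspace (germ_topology G B F).
     THE e'. \<exists>U\<in>B. \<exists>s\<in>carrier (ps_sect F U). \<exists>x\<in>U. \<exists>V\<in>B.
       e = germ G B F x U s \<and> act g x \<in> V \<and> V \<subseteq> act g ` U \<and>
       e' = germ G B F (act g x) V (ps_map F V U (inv\<^bsub>G\<^esub> g) s))"

definition sheafify ::
  "('g, 'z) monoid_scheme \<Rightarrow> ('g \<Rightarrow> 'x \<Rightarrow> 'x) \<Rightarrow> 'x set set \<Rightarrow> ('g, 'x, 'r, 'm) gpresheaf
    \<Rightarrow> ('g, 'x, 'r, ('x, 'm) germ) gsheaf" where
  "sheafify G act B F =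
     \<lparr>sh_space = germ_topology G B F, sh_proj = fst,
      sh_act = germ_act G act B F, sh_stalk = germ_stalk G B F\<rparr>"

text \<open>The map of sheafifications induced by a presheaf map with components \<open>\<alpha> U : F(U) \<rightarrow> F'(U)\<close>.\<close>

definition sheafify_map ::
  "('g, 'z) monoid_scheme \<Rightarrow> 'x set set \<Rightarrow> ('g, 'x, 'r, 'm) gpresheaf
    \<Rightarrow> ('g, 'x, 'r, 'n) gpresheaf \<Rightarrow> ('x set \<Rightarrow> 'm \<Rightarrow> 'n) \<Rightarrow> ('x, 'm) germ \<Rightarrow> ('x, 'n) germ" where
  "sheafify_map G B F F' \<alpha> e =
     (THE e'. \<exists>U\<in>B. \<exists>s\<in>carrier (ps_sect F U). \<exists>x\<in>U.
        e = germ G B F x U s \<and> e' = germ G B F' x U (\<alpha> U s))"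

text \<open>The canonical map to \<open>E\<close> from the sheafification of its underlying presheaf:
  the germ of \<open>s\<close> at \<open>x\<close> goes to \<open>s(x)\<close>.\<close>

definition germ_eval ::
  "('g, 'z) monoid_scheme \<Rightarrow> 'x topology \<Rightarrow> ('g \<Rightarrow> 'x \<Rightarrow> 'x) \<Rightarrow> 'x set set
    \<Rightarrow> ('g, 'x, 'r, 'e) gsheaf \<Rightarrow> ('x, 'x \<Rightarrow> 'e) germ \<Rightarrow> 'e" where
  "germ_eval G X act B E e =
     (THE v. \<exists>U\<in>B. \<exists>s\<in>carrier (sections X E U). \<exists>x\<in>U.
        e = germ G B (underlying_presheaf G X act E) x U s \<and> v = s x)"


section \<open>The sheafified product\<close>

definition underlying_product ::
  "('g, 'z) monoid_scheme \<Rightarrow> 'g topology \<Rightarrow> 'x topology \<Rightarrow> ('g \<Rightarrow> 'x \<Rightarrow> 'x) \<Rightarrow> 'i set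
    \<Rightarrow> ('i \<Rightarrow> ('g, 'x, 'r, 'e) gsheaf) \<Rightarrow> ('g, 'x, 'r, 'i \<Rightarrow> 'x \<Rightarrow> 'e) gpresheaf" where
  "underlying_product G T X act I F =
     presheaf_product G T act I (\<lambda>i. underlying_presheaf G X act (F i))"

definition sheafified_product ::
  "('g, 'z) monoid_scheme \<Rightarrow> 'g topology \<Rightarrow> 'x topology \<Rightarrow> ('g \<Rightarrow> 'x \<Rightarrow> 'x) \<Rightarrow> 'x set set
    \<Rightarrow> 'i set \<Rightarrow> ('i \<Rightarrow> ('g, 'x, 'r, 'e) gsheaf)
    \<Rightarrow> ('g, 'x, 'r, ('x, 'i \<Rightarrow> 'x \<Rightarrow> 'e) germ) gsheaf" where
  "sheafified_product G T X act B I F = sheafify G act B (underlying_product G T X act I F)"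

text \<open>The projection to the factor \<open>F j\<close>: sheafify the presheaf projection \<open>(s\<^sub>i)\<^sub>i \<mapsto> s\<^sub>j\<close>,
  then evaluate germs.\<close>

definition product_projection ::
  "('g, 'z) monoid_scheme \<Rightarrow> 'g topology \<Rightarrow> 'x topology \<Rightarrow> ('g \<Rightarrow> 'x \<Rightarrow> 'x) \<Rightarrow> 'x set set
    \<Rightarrow> 'i set \<Rightarrow> ('i \<Rightarrow> ('g, 'x, 'r, 'e) gsheaf) \<Rightarrow> 'i \<Rightarrow> ('x, 'i \<Rightarrow> 'x \<Rightarrow> 'e) germ \<Rightarrow> 'e" where
  "product_projection G T X act B I F j =
     germ_eval G X act B (F j) \<circ>
     sheafify_map G B (underlying_product G T X act I F) (underlying_presheaf G X act (F j))
       (\<lambda>U s. s j)"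

text \<open>The functorial action of the construction on a family of sheaf maps \<open>a i : F i \<rightarrow> F' i\<close>.\<close>

definition sheafified_product_map ::
  "('g, 'z) monoid_scheme \<Rightarrow> 'g topology \<Rightarrow> 'x topology \<Rightarrow> ('g \<Rightarrow> 'x \<Rightarrow> 'x) \<Rightarrow> 'x set set
    \<Rightarrow> 'i set \<Rightarrow> ('i \<Rightarrow> ('g, 'x, 'r, 'e) gsheaf) \<Rightarrow> ('i \<Rightarrow> ('g, 'x, 'r, 'f) gsheaf)
    \<Rightarrow> ('i \<Rightarrow> 'e \<Rightarrow> 'f) \<Rightarrow> ('x, 'i \<Rightarrow> 'x \<Rightarrow> 'e) germ \<Rightarrow> ('x, 'i \<Rightarrow> 'x \<Rightarrow> 'f) germ" where
  "sheafified_product_map G T X act B I F F' a =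
     sheafify_map G B (underlying_product G T X act I F) (underlying_product G T X act I F')
       (\<lambda>U s. \<lambda>i\<in>I. \<lambda>x\<in>U. a i (s i x))"

end

theory Submission
  imports Defs
begin

text \<open>
  A section of a \<open>G\<close>-sheaf over a compact open set is fixed by an open subgroup of the stabilizer of
  that set, by the tube lemma. Hence a family of morphisms \<open>f i : D \<rightarrow> F i\<close> sends a section \<open>s\<close> of \<open>D\<close>
  over \<open>U \<in> B\<close> to a point \<open>(f i \<circ> s)\<^sub>i\<close> of the discrete part of the product of the \<open>F i (U)\<close>, and the
  induced morphism sends \<open>s x\<close> to the germ of this point at \<open>x\<close>. It is the only one: along a local
  section of \<open>D\<close>, any morphism into the sheafified product is locally given by one family of sections,
  and the projections recover that family. Independence of the basis, with its naturality, follows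
  from the universal property alone.
\<close>

section \<open>Modules, group actions and clopen bases\<close>

text \<open>The discrete part is forced by infinite index sets: each component of a family is fixed
  by an open subgroup, but the intersection of infinitely many of these need not be open. Lifting
  morphisms survives this cut, because by equivariance an element that fixes \<open>s\<close> fixes
  all the \<open>f i \<circ> s\<close> at once, so one open subgroup serves every index.

  The obstacle to uniqueness is that a point of the sheafified product is not determined by its
  projections: the components of a family can vanish on neighbourhoods of \<open>x\<close> that
  shrink with the index, and then all projections of the germ at \<open>x\<close> are zero although
  the germ need not be. Values on a whole open set do determine a family, and one open set can be
  chosen for all indices, since two local sections of the sheafified product that meet in a point
  agree on a neighbourhood of it.

  The continuity clause in the definition of a presheaf is what makes the action on germs jointly
  continuous: the translate of a section by \<open>g\<close> does not change when \<open>g\<close>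
  is multiplied from the left by elements near the identity.\<close>

lemma left_moduleI:
  fixes R :: "('r, 'w) ring_scheme" and M :: "('r, 'm, 'v) module_scheme"
  assumes "ring R"
    and "\<And>x y. \<lbrakk>x \<in> carrier M; y \<in> carrier M\<rbrakk> \<Longrightarrow> x \<oplus>\<^bsub>M\<^esub> y \<in> carrier M"
    and "\<zero>\<^bsub>M\<^esub> \<in> carrier M"
    and "\<And>x y z. \<lbrakk>x \<in> carrier M; y \<in> carrier M; z \<in> carrier M\<rbrakk> \<Longrightarrow>
           (x \<oplus>\<^bsub>M\<^esub> y) \<oplus>\<^bsub>M\<^esub> z = x \<oplus>\<^bsub>M\<^esub> (y \<oplus>\<^bsub>M\<^esub> z)"
    and "\<And>x y. \<lbrakk>x \<in> carrier M; y \<in> carrier M\<rbrakk> \<Longrightarrow> x \<oplus>\<^bsub>M\<^esub> y = y \<oplus>\<^bsub>M\<^esub> x"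
    and "\<And>x. x \<in> carrier M \<Longrightarrow> \<zero>\<^bsub>M\<^esub> \<oplus>\<^bsub>M\<^esub> x = x"
    and "\<And>x. x \<in> carrier M \<Longrightarrow> \<exists>y\<in>carrier M. y \<oplus>\<^bsub>M\<^esub> x = \<zero>\<^bsub>M\<^esub>"
    and "\<And>a x. \<lbrakk>a \<in> carrier R; x \<in> carrier M\<rbrakk> \<Longrightarrow> a \<odot>\<^bsub>M\<^esub> x \<in> carrier M"
    and "\<And>a b x. \<lbrakk>a \<in> carrier R; b \<in> carrier R; x \<in> carrier M\<rbrakk> \<Longrightarrow>
           (a \<oplus>\<^bsub>R\<^esub> b) \<odot>\<^bsub>M\<^esub> x = a \<odot>\<^bsub>M\<^esub> x \<oplus>\<^bsub>M\<^esub> b \<odot>\<^bsub>M\<^esub> x"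
    and "\<And>a x y. \<lbrakk>a \<in> carrier R; x \<in> carrier M; y \<in> carrier M\<rbrakk> \<Longrightarrow>
           a \<odot>\<^bsub>M\<^esub> (x \<oplus>\<^bsub>M\<^esub> y) = a \<odot>\<^bsub>M\<^esub> x \<oplus>\<^bsub>M\<^esub> a \<odot>\<^bsub>M\<^esub> y"
    and "\<And>a b x. \<lbrakk>a \<in> carrier R; b \<in> carrier R; x \<in> carrier M\<rbrakk> \<Longrightarrow>
           (a \<otimes>\<^bsub>R\<^esub> b) \<odot>\<^bsub>M\<^esub> x = a \<odot>\<^bsub>M\<^esub> (b \<odot>\<^bsub>M\<^esub> x)"
    and "\<And>x. x \<in> carrier M \<Longrightarrow> \<one>\<^bsub>R\<^esub> \<odot>\<^bsub>M\<^esub> x = x"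
  shows "left_module R M"
  by (intro left_module.intro left_module_axioms.intro abelian_groupI assms)

lemma left_module_submodule:
  fixes R :: "('r, 'w) ring_scheme" and M :: "('r, 'm, 'v) module_scheme"
  assumes M: "left_module R M" and sub: "S \<subseteq> carrier M" and zero: "\<zero>\<^bsub>M\<^esub> \<in> S"
    and add: "\<And>x y. \<lbrakk>x \<in> S; y \<in> S\<rbrakk> \<Longrightarrow> x \<oplus>\<^bsub>M\<^esub> y \<in> S"
    and neg: "\<And>x. x \<in> S \<Longrightarrow> \<ominus>\<^bsub>M\<^esub> x \<in> S"
    and smult: "\<And>a x. \<lbrakk>a \<in> carrier R; x \<in> S\<rbrakk> \<Longrightarrow> a \<odot>\<^bsub>M\<^esub> x \<in> S"
  shows "left_module R (M\<lparr>carrier := S\<rparr>)"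
proof -
  interpret left_module R M by (fact M)
  show ?thesis
  proof (rule left_moduleI, simp_all add: R.ring_axioms zero add smult)
    fix x assume "x \<in> S"
    then show "\<exists>y\<in>S. y \<oplus>\<^bsub>M\<^esub> x = \<zero>\<^bsub>M\<^esub>"
      using M.l_neg neg sub by blast
  next
    fix x y z assume "x \<in> S" "y \<in> S" "z \<in> S"
    then show "x \<oplus>\<^bsub>M\<^esub> y \<oplus>\<^bsub>M\<^esub> z = x \<oplus>\<^bsub>M\<^esub> (y \<oplus>\<^bsub>M\<^esub> z)"
      using sub by (intro M.a_assoc) auto
  qed (use sub in \<open>auto simp: M.a_comm smult_l_distr smult_r_distr smult_assoc smult_one subset_iff\<close>)
qed

lemma module_product_simps:
  "carrier (module_product I M) = (\<Pi>\<^sub>E i\<in>I. carrier (M i))"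
  "\<zero>\<^bsub>module_product I M\<^esub> = (\<lambda>i\<in>I. \<zero>\<^bsub>M i\<^esub>)"
  "x \<oplus>\<^bsub>module_product I M\<^esub> y = (\<lambda>i\<in>I. x i \<oplus>\<^bsub>M i\<^esub> y i)"
  "a \<odot>\<^bsub>module_product I M\<^esub> x = (\<lambda>i\<in>I. a \<odot>\<^bsub>M i\<^esub> x i)"
  by (simp_all add: module_product_def)

lemma left_module_product:
  assumes "ring R" and M: "\<And>i. i \<in> I \<Longrightarrow> left_module R (M i)"
  shows "left_module R (module_product I M)"
proof -
  have ab: "abelian_group (M i)" if "i \<in> I" for i
    using M[OF that] by (simp add: left_module_def)
  have mem: "x i \<in> carrier (M i)" if "x \<in> (\<Pi>\<^sub>E i\<in>I. carrier (M i))" "i \<in> I" for x i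
    using that by auto
  have ext: "x = restrict x I" if "x \<in> (\<Pi>\<^sub>E i\<in>I. carrier (M i))" for x
    using that by (metis PiE_restrict)
  note group = abelian_groupE[OF ab]
  note module = left_module.smult_closed[OF M] left_module.smult_l_distr[OF M]
    left_module.smult_r_distr[OF M] left_module.smult_assoc[OF M] left_module.smult_one[OF M]
  show ?thesis
  proof (rule left_moduleI, unfold module_product_simps)
    fix x assume x: "x \<in> (\<Pi>\<^sub>E i\<in>I. carrier (M i))"
    show "\<exists>y\<in>\<Pi>\<^sub>E i\<in>I. carrier (M i). (\<lambda>i\<in>I. y i \<oplus>\<^bsub>M i\<^esub> x i) = (\<lambda>i\<in>I. \<zero>\<^bsub>M i\<^esub>)"
      using mem[OF x] by (intro bexI[of _ "\<lambda>i\<in>I. \<ominus>\<^bsub>M i\<^esub> x i"])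
        (auto simp: fun_eq_iff abelian_group.l_neg[OF ab] abelian_group.a_inv_closed[OF ab])
    show "(\<lambda>i\<in>I. (\<lambda>i\<in>I. \<zero>\<^bsub>M i\<^esub>) i \<oplus>\<^bsub>M i\<^esub> x i) = x"
      using mem[OF x] by (subst (2) ext[OF x]) (auto intro!: restrict_ext simp: group(5))
    show "(\<lambda>i\<in>I. \<one>\<^bsub>R\<^esub> \<odot>\<^bsub>M i\<^esub> x i) = x"
      using mem[OF x] by (subst (2) ext[OF x]) (auto intro!: restrict_ext simp: module)
    fix y assume y: "y \<in> (\<Pi>\<^sub>E i\<in>I. carrier (M i))"
    show "(\<lambda>i\<in>I. x i \<oplus>\<^bsub>M i\<^esub> y i) = (\<lambda>i\<in>I. y i \<oplus>\<^bsub>M i\<^esub> x i)"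
      using mem[OF x] mem[OF y] by (intro restrict_ext group(4))
    fix z assume z: "z \<in> (\<Pi>\<^sub>E i\<in>I. carrier (M i))"
    show "(\<lambda>i\<in>I. (\<lambda>i\<in>I. x i \<oplus>\<^bsub>M i\<^esub> y i) i \<oplus>\<^bsub>M i\<^esub> z i) = (\<lambda>i\<in>I. x i \<oplus>\<^bsub>M i\<^esub> (\<lambda>i\<in>I. y i \<oplus>\<^bsub>M i\<^esub> z i) i)"
      using mem[OF x] mem[OF y] mem[OF z] by (intro restrict_ext) (simp add: group(3))
  qed (auto intro!: restrict_ext simp: assms(1) mem group(1,2) module)
qed

lemma linear_hom_closed: "linear_hom R M N f \<Longrightarrow> x \<in> carrier M \<Longrightarrow> f x \<in> carrier N"
  and linear_hom_add: "linear_hom R M N f \<Longrightarrow> x \<in> carrier M \<Longrightarrow> y \<in> carrier M \<Longrightarrow>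
    f (x \<oplus>\<^bsub>M\<^esub> y) = f x \<oplus>\<^bsub>N\<^esub> f y"
  and linear_hom_smult: "linear_hom R M N f \<Longrightarrow> a \<in> carrier R \<Longrightarrow> x \<in> carrier M \<Longrightarrow>
    f (a \<odot>\<^bsub>M\<^esub> x) = a \<odot>\<^bsub>N\<^esub> f x"
  by (auto simp: linear_hom_def)

lemma linear_hom_zero:
  assumes f: "linear_hom R M N f" and "left_module R M" "left_module R N"
  shows "f \<zero>\<^bsub>M\<^esub> = \<zero>\<^bsub>N\<^esub>"
proof -
  interpret M: left_module R M by fact
  interpret N: left_module R N by fact
  have "f \<zero>\<^bsub>M\<^esub> \<oplus>\<^bsub>N\<^esub> f \<zero>\<^bsub>M\<^esub> = f \<zero>\<^bsub>M\<^esub>"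
    by (simp flip: linear_hom_add[OF f])
  then show ?thesis
    using linear_hom_closed[OF f M.zero_closed] N.add.l_cancel_one by blast
qed

lemma linear_hom_neg:
  assumes f: "linear_hom R M N f" and "left_module R M" "left_module R N" and x: "x \<in> carrier M"
  shows "f (\<ominus>\<^bsub>M\<^esub> x) = \<ominus>\<^bsub>N\<^esub> f x"
proof -
  interpret M: left_module R M by fact
  interpret N: left_module R N by fact
  have "f (\<ominus>\<^bsub>M\<^esub> x) \<oplus>\<^bsub>N\<^esub> f x = f (\<ominus>\<^bsub>M\<^esub> x \<oplus>\<^bsub>M\<^esub> x)"
    using x by (simp add: linear_hom_add[OF f])
  then have "f (\<ominus>\<^bsub>M\<^esub> x) \<oplus>\<^bsub>N\<^esub> f x = \<zero>\<^bsub>N\<^esub>"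
    using x by (simp add: M.l_neg linear_hom_zero[OF assms(1-3)])
  then show ?thesis
    using N.minus_equality linear_hom_closed[OF f] x by fastforce
qed

lemma linear_hom_minus:
  assumes "linear_hom R M N f" "left_module R M" "left_module R N" "x \<in> carrier M" "y \<in> carrier M"
  shows "f (x \<ominus>\<^bsub>M\<^esub> y) = f x \<ominus>\<^bsub>N\<^esub> f y"
proof -
  interpret M: left_module R M by fact
  show ?thesis
    by (simp add: a_minus_def linear_hom_add[OF assms(1)] linear_hom_neg[OF assms(1-3)] assms(4,5))
qed

text \<open>The locale asks for a homomorphism into \<open>BijGroup S\<close>, whose elements are
  bijections extensional on \<open>S\<close>. Bijectivity of \<open>\<phi> g\<close> comes from
  \<open>\<phi> (inv g)\<close> as two-sided inverse, and \<open>ext\<close> turns pointwise laws on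
  \<open>S\<close> into equality of functions.\<close>

lemma group_actionI:
  assumes G: "group G"
    and closed: "\<And>g x. \<lbrakk>g \<in> carrier G; x \<in> S\<rbrakk> \<Longrightarrow> \<phi> g x \<in> S"
    and ext: "\<And>g. g \<in> carrier G \<Longrightarrow> \<phi> g \<in> extensional S"
    and one: "\<And>x. x \<in> S \<Longrightarrow> \<phi> \<one>\<^bsub>G\<^esub> x = x"
    and mult: "\<And>g h x. \<lbrakk>g \<in> carrier G; h \<in> carrier G; x \<in> S\<rbrakk> \<Longrightarrow> \<phi> (g \<otimes>\<^bsub>G\<^esub> h) x = \<phi> g (\<phi> h x)"
  shows "group_action G S \<phi>"
proof -
  interpret group G by (fact G)
  have Bij: "\<phi> g \<in> Bij S" if g: "g \<in> carrier G" for g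
  proof -
    have "bij_betw (\<phi> g) S S"
      by (rule bij_betw_byWitness[where f' = "\<phi> (inv\<^bsub>G\<^esub> g)"])
        (auto simp: closed g one simp flip: mult)
    then show ?thesis
      by (simp add: Bij_def ext g)
  qed
  have "\<phi> \<in> hom G (BijGroup S)"
    using Bij by (auto simp: hom_def BijGroup_def compose_def fun_eq_iff mult
        intro: extensional_arb[OF ext])
  then show ?thesis
    by (simp add: group_action_def group_hom_def group_hom_axioms_def G group_BijGroup)
qed

lemma continuous_map_pointwiseI:
  assumes "\<And>x. x \<in> topspace X \<Longrightarrow> f x \<in> topspace Y"
    and "\<And>x V. \<lbrakk>x \<in> topspace X; openin Y V; f x \<in> V\<rbrakk> \<Longrightarrow>
           \<exists>U. openin X U \<and> x \<in> U \<and> (\<forall>y\<in>U. f y \<in> V)"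
  shows "continuous_map X Y f"
  unfolding continuous_map_eq_topcontinuous_at topcontinuous_at_def using assms by blast

lemma continuous_map_pointwiseD:
  assumes "continuous_map X Y f" "x \<in> topspace X" "openin Y V" "f x \<in> V"
  shows "\<exists>U. openin X U \<and> x \<in> U \<and> (\<forall>y\<in>U. f y \<in> V)"
  using assms unfolding continuous_map_eq_topcontinuous_at topcontinuous_at_def by blast

text \<open>Continuity is local on the source. This serves the zero section, which is only locally
  available as a difference of sections.\<close>

lemma continuous_map_subtopology_openI:
  assumes f: "\<And>x. x \<in> U \<Longrightarrow> \<exists>W. openin X W \<and> x \<in> W \<and> W \<subseteq> U \<and> continuous_map (subtopology X W) Y f"
    and U: "U \<subseteq> topspace X"
  shows "continuous_map (subtopology X U) Y f"
proof (rule continuous_map_pointwiseI)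
  fix x assume "x \<in> topspace (subtopology X U)"
  then have x: "x \<in> U" by simp
  then obtain W where W: "openin X W" "x \<in> W" "W \<subseteq> U" "continuous_map (subtopology X W) Y f"
    using f by blast
  then have xW: "x \<in> topspace (subtopology X W)"
    using U by auto
  then show "f x \<in> topspace Y"
    using W(4) by (auto simp: continuous_map_def)
  fix V assume V: "openin Y V" "f x \<in> V"
  obtain A where "openin (subtopology X W) A" "x \<in> A" "\<forall>y\<in>A. f y \<in> V"
    using continuous_map_pointwiseD[OF W(4) xW V] by blast
  moreover from this have "openin (subtopology X U) A"
    using W(1,3) by (auto simp: openin_open_subtopology openin_subtopology_alt intro: rev_image_eqI)
  ultimately show "\<exists>A. openin (subtopology X U) A \<and> x \<in> A \<and> (\<forall>y\<in>A. f y \<in> V)"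
    by blast
qed

section \<open>Compact spaces with a continuous group action and a clopen basis\<close>

locale clopen_gspace =
  fixes G :: "('g, 'z) monoid_scheme" (structure) and T :: "'g topology"
    and R :: "('r, 'w) ring_scheme"
    and X :: "'x topology" and act :: "'g \<Rightarrow> 'x \<Rightarrow> 'x" and B :: "'x set set"
  assumes topological_group: "topological_group G T"
    and R_ring: "ring R"
    and compact_X: "compact_space X"
    and action: "continuous_action G T X act"
    and basis: "clopen_basis X B"
begin

sublocale group G
  using topological_group by (simp add: topological_group_def)

lemma topspace_T [simp]: "topspace T = carrier G"
  using topological_group by (simp add: topological_group_def)

lemma continuous_mult: "continuous_map (prod_topology T T) T (\<lambda>(g, h). g \<otimes> h)"
  and continuous_inv: "continuous_map T T (\<lambda>g. inv g)"
  using topological_group by (auto simp: topological_group_def)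

lemma continuous_act: "continuous_map (prod_topology T X) X (\<lambda>(g, x). act g x)"
  using action by (simp add: continuous_action_def)

interpretation act: group_action G "topspace X" act
  using action by (simp add: continuous_action_def)

lemma act_closed [simp, intro]: "g \<in> carrier G \<Longrightarrow> x \<in> topspace X \<Longrightarrow> act g x \<in> topspace X"
  using act.element_image by blast

lemma act_one [simp]: "x \<in> topspace X \<Longrightarrow> act \<one> x = x"
  by (metis act.id_eq_one restrict_apply')

lemma act_mult: "g \<in> carrier G \<Longrightarrow> h \<in> carrier G \<Longrightarrow> x \<in> topspace X \<Longrightarrow> act (g \<otimes> h) x = act g (act h x)"
  using act.composition_rule by blast

lemma act_inv_act [simp]: "g \<in> carrier G \<Longrightarrow> x \<in> topspace X \<Longrightarrow> act (inv g) (act g x) = x"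
  and act_act_inv [simp]: "g \<in> carrier G \<Longrightarrow> x \<in> topspace X \<Longrightarrow> act g (act (inv g) x) = x"
  by (simp_all flip: act_mult)

text \<open>The third fact combines compactness of \<open>X\<close> with closedness of the basis
  sets; the tube lemma arguments below rest on it.\<close>

lemma basis_subset: "U \<in> B \<Longrightarrow> U \<subseteq> topspace X"
  and basis_openin: "U \<in> B \<Longrightarrow> openin X U"
  and basis_compactin: "U \<in> B \<Longrightarrow> compactin X U"
  using basis compact_X by (auto simp: clopen_basis_def dest: openin_subset closedin_compact_space)

lemma basis_mem [simp, intro]: "U \<in> B \<Longrightarrow> x \<in> U \<Longrightarrow> x \<in> topspace X"
  using basis_subset by blast

lemma basis_nbhd:
  assumes "openin X W" "x \<in> W"
  obtains U where "U \<in> B" "x \<in> U" "U \<subseteq> W"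
  using assms basis unfolding clopen_basis_def union_of_def arbitrary_def by auto

lemma basis_nbhd2:
  assumes "U \<in> B" "V \<in> B" "x \<in> U" "x \<in> V"
  obtains W where "W \<in> B" "x \<in> W" "W \<subseteq> U" "W \<subseteq> V"
  using basis_nbhd[of "U \<inter> V" x] assms basis_openin by (metis IntI le_inf_iff openin_Int)

text \<open>The image under \<open>g\<close> is the preimage under \<open>inv g\<close>, and the
  latter acts continuously because the joint action does.\<close>

lemma openin_act_image:
  assumes "openin X U" "g \<in> carrier G"
  shows "openin X (act g ` U)"
proof -
  have "continuous_map X X (act (inv g))"
    using continuous_map_compose[of X "prod_topology T X" "\<lambda>x. (inv g, x)" X "\<lambda>(g, x). act g x"]
        continuous_act assms(2)
    by (simp add: o_def continuous_map_pairedI)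
  then have "openin X {x \<in> topspace X. act (inv g) x \<in> U}"
    using assms(1) by (rule openin_continuous_map_preimage)
  also have "{x \<in> topspace X. act (inv g) x \<in> U} = act g ` U"
    using assms openin_subset[OF assms(1)] by (force simp: image_iff)
  finally show ?thesis .
qed

text \<open>Translates between the condition on \<open>V\<close> in \<open>germ_act\<close> and the
  condition for \<open>inv g\<close> to be an arrow from \<open>V\<close> to
  \<open>U\<close>.\<close>

lemma act_image_subset_iff:
  assumes "g \<in> carrier G" "U \<subseteq> topspace X" "V \<subseteq> topspace X"
  shows "act (inv g) ` V \<subseteq> U \<longleftrightarrow> V \<subseteq> act g ` U"
proof
  assume "act (inv g) ` V \<subseteq> U"
  then show "V \<subseteq> act g ` U"
    using assms by (smt (verit, best) act_act_inv image_eqI image_subset_iff subset_iff)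
next
  assume "V \<subseteq> act g ` U"
  then show "act (inv g) ` V \<subseteq> U"
    using assms by (smt (verit) act_inv_act image_iff image_subset_iff subset_iff)
qed

lemma set_stabilizer_iff: "g \<in> set_stabilizer G act U \<longleftrightarrow> g \<in> carrier G \<and> act g ` U = U"
  by (simp add: stabilizer_def)

text \<open>The preimage of \<open>V\<close> under the joint action is open and contains
  \<open>{g} \<times> U\<close>. As \<open>U\<close> is compact, it contains a product of
  neighbourhoods of \<open>g\<close> and of \<open>U\<close>.\<close>

lemma openin_transporter:
  assumes "compactin X U" "openin X V"
  shows "openin T {g \<in> carrier G. act g ` U \<subseteq> V}"
proof (subst openin_subopen, safe)
  fix g assume g: "g \<in> carrier G" "act g ` U \<subseteq> V"
  define O' where "O' = {z \<in> topspace (prod_topology T X). (\<lambda>(g, x). act g x) z \<in> V}"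
  have "openin (prod_topology T X) O'"
    unfolding O'_def using continuous_act assms(2) by (rule openin_continuous_map_preimage)
  moreover have "{g} \<times> U \<subseteq> O'"
    using g compactin_subset_topspace[OF assms(1)] by (auto simp: O'_def)
  ultimately obtain A C where "openin T A" "g \<in> A" "U \<subseteq> C" "A \<times> C \<subseteq> O'"
    using tube_lemma_right[of T X O' U g] assms(1) g(1) by auto
  then have "openin T A \<and> g \<in> A \<and> A \<subseteq> {g \<in> carrier G. act g ` U \<subseteq> V}"
    using openin_subset[of T A] by (fastforce simp: O'_def)
  then show "\<exists>A. openin T A \<and> g \<in> A \<and> A \<subseteq> {g \<in> carrier G. act g ` U \<subseteq> V}" ..
qed

text \<open>Equality of \<open>U\<close> with its translate is two inclusions, one for
  \<open>g\<close> and one for \<open>inv g\<close>. Each is an open condition, the second as a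
  preimage under inversion.\<close>

lemma openin_set_stabilizer:
  assumes "U \<in> B"
  shows "openin T (set_stabilizer G act U)"
proof -
  let ?N = "{g \<in> carrier G. act g ` U \<subseteq> U}"
  have N: "openin T ?N"
    using assms openin_transporter basis_openin basis_compactin by blast
  have "g \<in> set_stabilizer G act U \<longleftrightarrow> g \<in> ?N \<and> inv g \<in> ?N" for g
    using act_image_subset_iff[of g U U] basis_subset[OF assms]
    unfolding set_stabilizer_iff by (metis (no_types, lifting) inv_closed mem_Collect_eq order_refl
        subset_antisym)
  then have "set_stabilizer G act U = ?N \<inter> {g \<in> topspace T. inv g \<in> ?N}"
    by auto
  then show ?thesis
    using N openin_continuous_map_preimage[OF continuous_inv N] by auto
qed

lemma subgroup_set_stabilizer:
  assumes "U \<in> B"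
  shows "subgroup (set_stabilizer G act U) G"
proof
  show "\<one> \<in> set_stabilizer G act U"
    using basis_subset[OF assms] by (force simp: set_stabilizer_iff image_iff)
  fix g h assume "g \<in> set_stabilizer G act U" "h \<in> set_stabilizer G act U"
  moreover from this have "act (g \<otimes> h) ` U = act g ` act h ` U"
    unfolding image_image using basis_subset[OF assms]
    by (intro image_cong) (auto simp: set_stabilizer_iff act_mult)
  ultimately show "g \<otimes> h \<in> set_stabilizer G act U"
    by (simp add: set_stabilizer_iff)
next
  fix g assume "g \<in> set_stabilizer G act U"
  then have g: "g \<in> carrier G" "act g ` U = U"
    by (auto simp: set_stabilizer_iff)
  have "act (inv g) ` act g ` U = U"
    using basis_subset[OF assms] g(1) by (auto simp: image_image subset_iff)
  then show "inv g \<in> set_stabilizer G act U"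
    using g by (simp add: set_stabilizer_iff)
qed (auto simp: set_stabilizer_iff)

end

section \<open>Sections of an equivariant sheaf\<close>

locale equivariant_sheaf = clopen_gspace G T R X act B
  for G :: "('g, 'z) monoid_scheme" (structure) and T :: "'g topology"
    and R :: "('r, 'w) ring_scheme"
    and X :: "'x topology" and act :: "'g \<Rightarrow> 'x \<Rightarrow> 'x" and B :: "'x set set" +
  fixes E :: "('g, 'x, 'r, 'e) gsheaf"
  assumes sheaf: "is_gsheaf G T R X act E"
begin

abbreviation S :: "'e topology" where "S \<equiv> sh_space E"
abbreviation p :: "'e \<Rightarrow> 'x" where "p \<equiv> sh_proj E"
abbreviation M :: "'x \<Rightarrow> ('r, 'e) module" where "M \<equiv> sh_stalk E"
abbreviation sec :: "'x set \<Rightarrow> ('x \<Rightarrow> 'e) set" where "sec U \<equiv> carrier (sections X E U)"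

lemma continuous_proj: "continuous_map S X p"
  using sheaf by (simp add: is_gsheaf_def local_homeomorphism_def)

lemma proj_closed [simp, intro]: "e \<in> topspace S \<Longrightarrow> p e \<in> topspace X"
  using continuous_proj by (auto simp: continuous_map_def)

interpretation sact: group_action G "topspace S" "sh_act E"
  using sheaf by (simp add: is_gsheaf_def continuous_action_def)

lemma continuous_sh_act: "continuous_map (prod_topology T S) S (\<lambda>(g, e). sh_act E g e)"
  using sheaf by (simp add: is_gsheaf_def continuous_action_def)

lemma sh_act_closed [simp, intro]: "g \<in> carrier G \<Longrightarrow> e \<in> topspace S \<Longrightarrow> sh_act E g e \<in> topspace S"
  using sact.element_image by blast

lemma sh_act_one [simp]: "e \<in> topspace S \<Longrightarrow> sh_act E \<one> e = e"
  by (metis sact.id_eq_one restrict_apply')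

lemma sh_act_mult:
  "g \<in> carrier G \<Longrightarrow> h \<in> carrier G \<Longrightarrow> e \<in> topspace S \<Longrightarrow> sh_act E (g \<otimes> h) e = sh_act E g (sh_act E h e)"
  using sact.composition_rule by blast

lemma sh_act_inv [simp]:
  "g \<in> carrier G \<Longrightarrow> e \<in> topspace S \<Longrightarrow> sh_act E (inv g) (sh_act E g e) = e"
  "g \<in> carrier G \<Longrightarrow> e \<in> topspace S \<Longrightarrow> sh_act E g (sh_act E (inv g) e) = e"
  by (simp_all flip: sh_act_mult)

lemma proj_sh_act [simp]: "g \<in> carrier G \<Longrightarrow> e \<in> topspace S \<Longrightarrow> p (sh_act E g e) = act g (p e)"
  using sheaf by (simp add: is_gsheaf_def)

lemma stalk_module: "x \<in> topspace X \<Longrightarrow> left_module R (M x)"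
  and stalk_carrier: "x \<in> topspace X \<Longrightarrow> carrier (M x) = {e \<in> topspace S. p e = x}"
  and sh_act_linear: "g \<in> carrier G \<Longrightarrow> x \<in> topspace X \<Longrightarrow> linear_hom R (M x) (M (act g x)) (sh_act E g)"
  using sheaf by (simp_all add: is_gsheaf_def)

lemma stalk_group: "x \<in> topspace X \<Longrightarrow> abelian_group (M x)"
  using stalk_module by (simp add: left_module_def)

lemma sections_simps:
  "\<zero>\<^bsub>sections X E U\<^esub> = (\<lambda>x\<in>U. \<zero>\<^bsub>M x\<^esub>)"
  "s \<oplus>\<^bsub>sections X E U\<^esub> t = (\<lambda>x\<in>U. s x \<oplus>\<^bsub>M x\<^esub> t x)"
  "a \<odot>\<^bsub>sections X E U\<^esub> s = (\<lambda>x\<in>U. a \<odot>\<^bsub>M x\<^esub> s x)"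
  by (simp_all add: sections_def)

lemma sec_iff:
  "s \<in> sec U \<longleftrightarrow> s \<in> extensional U \<and> continuous_map (subtopology X U) S s \<and> (\<forall>x\<in>U. p (s x) = x)"
  by (simp add: sections_def)

lemma sec_continuous: "s \<in> sec U \<Longrightarrow> continuous_map (subtopology X U) S s"
  by (simp add: sec_iff)

lemma sec_proj [simp]: "s \<in> sec U \<Longrightarrow> x \<in> U \<Longrightarrow> p (s x) = x"
  by (simp add: sec_iff)

lemma sec_mem: "s \<in> sec U \<Longrightarrow> x \<in> topspace X \<Longrightarrow> x \<in> U \<Longrightarrow> s x \<in> topspace S"
  by (auto simp: sec_iff continuous_map_def)

lemma sec_stalk: "s \<in> sec U \<Longrightarrow> x \<in> topspace X \<Longrightarrow> x \<in> U \<Longrightarrow> s x \<in> carrier (M x)"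
  by (simp add: stalk_carrier sec_mem)

lemma sec_restrict_eq: "s \<in> sec U \<Longrightarrow> restrict s U = s"
  by (simp add: sec_iff extensional_restrict)

lemma secI:
  assumes "continuous_map (subtopology X U) S f" "\<And>x. x \<in> U \<Longrightarrow> p (f x) = x"
  shows "(\<lambda>x\<in>U. f x) \<in> sec U"
  using assms(2) continuous_map_eq[OF assms(1), of "restrict f U"] by (auto simp: sec_iff)

lemma sec_restrict: "s \<in> sec U \<Longrightarrow> W \<subseteq> U \<Longrightarrow> restrict s W \<in> sec W"
  by (rule secI) (auto simp: sec_iff intro: continuous_map_from_subtopology_mono)

text \<open>Near \<open>s x\<close> the projection is injective on some open \<open>W\<close>. A
  point of \<open>W\<close> lying over the open set where \<open>s\<close> takes values in
  \<open>W\<close> must be the value of \<open>s\<close> at its projection, so these points form an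
  open neighbourhood of \<open>s x\<close> inside the image.\<close>

lemma openin_section_image:
  assumes U: "openin X U" and s: "s \<in> sec U"
  shows "openin S (s ` U)"
proof (subst openin_subopen, safe)
  fix x assume x: "x \<in> U"
  note UX = openin_subset[OF U]
  have sx: "s x \<in> topspace S"
    using s UX x by (auto intro: sec_mem)
  then obtain W V where W: "openin S W" "s x \<in> W" "homeomorphic_map (subtopology S W) (subtopology X
      V) p"
    using sheaf by (fastforce simp: is_gsheaf_def local_homeomorphism_def)
  have inj: "inj_on p W"
    using W(3) openin_subset[OF W(1)] by (simp add: homeomorphic_eq_everything_map inf.absorb2)
  define U' where "U' = {y \<in> topspace (subtopology X U). s y \<in> W}"
  have "openin (subtopology X U) U'"
    unfolding U'_def by (rule openin_continuous_map_preimage[OF sec_continuous[OF s] W(1)])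
  then have U': "openin X U'"
    using U by (simp add: openin_open_subtopology)
  have "openin S (W \<inter> {e \<in> topspace S. p e \<in> U'})"
    by (intro openin_Int W(1) openin_continuous_map_preimage[OF continuous_proj U'])
  moreover have "s x \<in> W \<inter> {e \<in> topspace S. p e \<in> U'}"
    using W sx s x UX by (auto simp: U'_def)
  moreover have "W \<inter> {e \<in> topspace S. p e \<in> U'} \<subseteq> s ` U"
  proof
    fix e assume e: "e \<in> W \<inter> {e \<in> topspace S. p e \<in> U'}"
    then have "s (p e) = e"
      using s by (intro inj_onD[OF inj]) (auto simp: U'_def)
    then show "e \<in> s ` U"
      using e by (metis (no_types, lifting) IntD2 Int_iff U'_def image_eqI mem_Collect_eq
          topspace_subtopology)
  qed
  ultimately show "\<exists>A. openin S A \<and> s x \<in> A \<and> A \<subseteq> s ` U"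
    by blast
qed

text \<open>The section is a local inverse of the projection. The freedom to stay inside
  \<open>N\<close> allows two points of one stalk to be reached over a common basis set.\<close>

lemma section_through:
  assumes e: "e \<in> topspace S" and N: "openin X N" "p e \<in> N"
  obtains U s where "U \<in> B" "U \<subseteq> N" "s \<in> sec U" "p e \<in> U" "s (p e) = e"
proof -
  obtain W V where W: "openin S W" "e \<in> W" "openin X V"
      and hom: "homeomorphic_map (subtopology S W) (subtopology X V) p"
    using sheaf e by (fastforce simp: is_gsheaf_def local_homeomorphism_def)
  obtain q where q: "homeomorphic_maps (subtopology S W) (subtopology X V) p q"
    using hom by (auto simp: homeomorphic_map_maps)
  have WS: "W \<subseteq> topspace S" and VX: "V \<subseteq> topspace X"
    using W openin_subset by auto
  have "p e \<in> V"
    using q W(2) WS VX by (auto simp: homeomorphic_maps_def continuous_map_def)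
  then obtain U where U: "U \<in> B" "p e \<in> U" "U \<subseteq> V \<inter> N"
    using W(3) N by (meson IntI basis_nbhd openin_Int)
  have "(\<lambda>x\<in>U. q x) \<in> sec U"
  proof (rule secI)
    have "continuous_map (subtopology X V) S q"
      using q by (auto simp: homeomorphic_maps_def continuous_map_in_subtopology)
    then show "continuous_map (subtopology X U) S q"
      by (rule continuous_map_from_subtopology_mono) (use U in auto)
    show "\<And>x. x \<in> U \<Longrightarrow> p (q x) = x"
      using q U VX by (auto simp: homeomorphic_maps_def)
  qed
  moreover have "(\<lambda>x\<in>U. q x) (p e) = e"
    using q U W(2) WS by (auto simp: homeomorphic_maps_def)
  ultimately show thesis
    using U that by simp
qed

text \<open>The image of \<open>t\<close> is open, so \<open>s\<close> takes values in it on an open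
  set. There the projection identifies the argument, and \<open>s y\<close> can only be
  \<open>t y\<close>.\<close>

lemma sections_agree:
  assumes U: "openin X U" and V: "openin X V" and s: "s \<in> sec U" and t: "t \<in> sec V"
    and x: "x \<in> U" "x \<in> V" and eq: "s x = t x"
  obtains W where "W \<in> B" "x \<in> W" "W \<subseteq> U" "W \<subseteq> V" "\<And>y. y \<in> W \<Longrightarrow> s y = t y"
proof -
  define A where "A = {y \<in> topspace (subtopology X U). s y \<in> t ` V}"
  have "openin (subtopology X U) A"
    unfolding A_def
    by (rule openin_continuous_map_preimage[OF sec_continuous[OF s] openin_section_image[OF V t]])
  then have A: "openin X A"
    using U by (simp add: openin_open_subtopology)
  have eqA: "y \<in> U \<and> y \<in> V \<and> s y = t y" if "y \<in> A" for y
    using that sec_proj[OF s, of y] sec_proj[OF t] by (auto simp: A_def)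
  have "x \<in> A"
    using x eq openin_subset[OF U] by (auto simp: A_def)
  then obtain W where "W \<in> B" "x \<in> W" "W \<subseteq> A"
    using A basis_nbhd by blast
  then show thesis
    using eqA by (intro that[of W]) auto
qed

text \<open>Local sections have open images and reach every point, so the sheaf space carries the
  final topology with respect to them.\<close>

lemma continuous_map_from_sections:
  assumes "\<And>U s. U \<in> B \<Longrightarrow> s \<in> sec U \<Longrightarrow> continuous_map (subtopology X U) Y (\<lambda>x. f (s x))"
  shows "continuous_map S Y f"
proof (rule continuous_map_pointwiseI)
  fix e assume e: "e \<in> topspace S"
  then obtain U s where U: "U \<in> B" "s \<in> sec U" "p e \<in> U" "s (p e) = e"
    using section_through[OF e openin_topspace proj_closed[OF e]] by metis
  have pe: "p e \<in> topspace (subtopology X U)"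
    using e U by simp
  show "f e \<in> topspace Y"
    using continuous_map_image_subset_topspace[OF assms[OF U(1,2)]] pe U(4) by force
  fix V assume "openin Y V" "f e \<in> V"
  then obtain A where "openin (subtopology X U) A" "p e \<in> A" "\<forall>y\<in>A. f (s y) \<in> V"
    using continuous_map_pointwiseD[OF assms[OF U(1,2)] pe] U(4) by auto
  then have A: "openin X A" "A \<subseteq> U" "p e \<in> A" "\<forall>y\<in>A. f (s y) \<in> V"
    using basis_openin[OF U(1)] by (auto simp: openin_open_subtopology)
  have "openin S (restrict s A ` A)"
    using openin_section_image[OF A(1) sec_restrict[OF U(2) A(2)]] .
  moreover have "e \<in> restrict s A ` A"
    using A(3) U(4) by force
  moreover have "\<forall>e\<in>restrict s A ` A. f e \<in> V"
    using A(4) by auto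
  ultimately show "\<exists>A. openin S A \<and> e \<in> A \<and> (\<forall>e\<in>A. f e \<in> V)"
    by blast
qed

section \<open>The module operations on sections\<close>

lemma sec_minus:
  assumes U: "U \<subseteq> topspace X" and s: "s \<in> sec U" and t: "t \<in> sec U"
  shows "(\<lambda>x\<in>U. s x \<ominus>\<^bsub>M x\<^esub> t x) \<in> sec U"
proof (rule secI)
  let ?D = "subtopology (prod_topology S S) {(a, b). p a = p b}"
  have "continuous_map (subtopology X U) ?D (\<lambda>x. (s x, t x))"
    using s t by (auto simp: sec_iff intro!: continuous_map_into_subtopology continuous_map_pairedI)
  moreover have "continuous_map ?D S (\<lambda>(a, b). a \<ominus>\<^bsub>M (p a)\<^esub> b)"
    using sheaf by (simp add: is_gsheaf_def)
  ultimately have "continuous_map (subtopology X U) S ((\<lambda>(a, b). a \<ominus>\<^bsub>M (p a)\<^esub> b) \<circ> (\<lambda>x. (s x, t x)))"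
    by (rule continuous_map_compose)
  then show "continuous_map (subtopology X U) S (\<lambda>x. s x \<ominus>\<^bsub>M x\<^esub> t x)"
    by (rule continuous_map_eq) (use s in auto)
  fix x assume x: "x \<in> U"
  then have "s x \<ominus>\<^bsub>M x\<^esub> t x \<in> carrier (M x)"
    using U s t by (intro abelian_group.minus_closed stalk_group sec_stalk) auto
  then show "p (s x \<ominus>\<^bsub>M x\<^esub> t x) = x"
    using x U by (auto simp: stalk_carrier)
qed

text \<open>Continuity is assumed for fibrewise subtraction and for scalars alone. Zero is therefore
  obtained locally as \<open>s\<close> minus \<open>s\<close>, negation as zero minus
  \<open>s\<close>, and addition as \<open>s\<close> minus the negative of \<open>t\<close>, in this
  order.\<close>

lemma sec_zero:
  assumes U: "openin X U"
  shows "(\<lambda>x\<in>U. \<zero>\<^bsub>M x\<^esub>) \<in> sec U"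
proof (rule secI)
  have UX: "U \<subseteq> topspace X"
    using U openin_subset by blast
  have zero: "\<zero>\<^bsub>M x\<^esub> \<in> topspace S" "p \<zero>\<^bsub>M x\<^esub> = x" if "x \<in> topspace X" for x
    using abelian_groupE(2)[OF stalk_group[OF that]] stalk_carrier[OF that] by auto
  then show "p \<zero>\<^bsub>M x\<^esub> = x" if "x \<in> U" for x
    using UX that by blast
  show "continuous_map (subtopology X U) S (\<lambda>x. \<zero>\<^bsub>M x\<^esub>)"
  proof (rule continuous_map_subtopology_openI[OF _ UX])
    fix x assume "x \<in> U"
    then have x: "x \<in> topspace X" "x \<in> U"
      using UX by auto
    obtain V s where V: "V \<in> B" "V \<subseteq> U" "s \<in> sec V" "x \<in> V"
      using section_through[OF zero(1)[OF x(1)] U] zero(2)[OF x(1)] x by metis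
    have "continuous_map (subtopology X V) S (\<lambda>y\<in>V. s y \<ominus>\<^bsub>M y\<^esub> s y)"
      using sec_minus[OF basis_subset V(3) V(3)] V(1) by (simp add: sec_iff)
    then have "continuous_map (subtopology X V) S (\<lambda>x. \<zero>\<^bsub>M x\<^esub>)"
      by (rule continuous_map_eq)
        (use V(1,3) in \<open>auto simp: a_minus_def abelian_group.r_neg[OF stalk_group] sec_stalk\<close>)
    then show "\<exists>W. openin X W \<and> x \<in> W \<and> W \<subseteq> U \<and> continuous_map (subtopology X W) S (\<lambda>x. \<zero>\<^bsub>M x\<^esub>)"
      using V basis_openin by blast
  qed
qed

lemma sec_uminus:
  assumes U: "openin X U" and s: "s \<in> sec U"
  shows "(\<lambda>x\<in>U. \<ominus>\<^bsub>M x\<^esub> s x) \<in> sec U"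
proof -
  have UX: "U \<subseteq> topspace X"
    using U openin_subset by blast
  have "(\<lambda>x\<in>U. (\<lambda>x\<in>U. \<zero>\<^bsub>M x\<^esub>) x \<ominus>\<^bsub>M x\<^esub> s x) = (\<lambda>x\<in>U. \<ominus>\<^bsub>M x\<^esub> s x)"
    using UX s by (intro restrict_ext)
      (auto simp: a_minus_def abelian_group.a_inv_closed[OF stalk_group] sec_stalk subset_iff
        intro!: abelian_groupE(5)[OF stalk_group])
  then show ?thesis
    using sec_minus[OF UX sec_zero[OF U] s] by simp
qed

lemma sec_add:
  assumes U: "openin X U" and s: "s \<in> sec U" and t: "t \<in> sec U"
  shows "(\<lambda>x\<in>U. s x \<oplus>\<^bsub>M x\<^esub> t x) \<in> sec U"
proof -
  have UX: "U \<subseteq> topspace X"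
    using U openin_subset by blast
  have "\<ominus>\<^bsub>M x\<^esub> (\<ominus>\<^bsub>M x\<^esub> t x) = t x" if "x \<in> U" for x
    using UX that t by (intro abelian_group.minus_minus[OF stalk_group] sec_stalk) auto
  then have "(\<lambda>x\<in>U. s x \<ominus>\<^bsub>M x\<^esub> (\<lambda>x\<in>U. \<ominus>\<^bsub>M x\<^esub> t x) x) = (\<lambda>x\<in>U. s x \<oplus>\<^bsub>M x\<^esub> t x)"
    by (intro restrict_ext) (simp add: a_minus_def)
  then show ?thesis
    using sec_minus[OF UX s sec_uminus[OF U t]] by simp
qed

lemma sec_smult:
  assumes U: "U \<subseteq> topspace X" and s: "s \<in> sec U" and a: "a \<in> carrier R"
  shows "(\<lambda>x\<in>U. a \<odot>\<^bsub>M x\<^esub> s x) \<in> sec U"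
proof (rule secI)
  have "continuous_map S S (\<lambda>e. a \<odot>\<^bsub>M (p e)\<^esub> e)"
    using sheaf a by (simp add: is_gsheaf_def)
  then have "continuous_map (subtopology X U) S ((\<lambda>e. a \<odot>\<^bsub>M (p e)\<^esub> e) \<circ> s)"
    using s by (intro continuous_map_compose[of _ S]) (auto simp: sec_iff)
  then show "continuous_map (subtopology X U) S (\<lambda>x. a \<odot>\<^bsub>M x\<^esub> s x)"
    by (rule continuous_map_eq) (use s in auto)
  fix x assume x: "x \<in> U"
  then have "a \<odot>\<^bsub>M x\<^esub> s x \<in> carrier (M x)"
    using U s a by (intro left_module.smult_closed[OF stalk_module] sec_stalk) auto
  then show "p (a \<odot>\<^bsub>M x\<^esub> s x) = x"
    using x U by (auto simp: stalk_carrier)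
qed

lemma left_module_sections:
  assumes U: "openin X U"
  shows "left_module R (sections X E U)"
proof -
  have UX: "x \<in> topspace X" if "x \<in> U" for x
    using U openin_subset that by blast
  note mem = sec_stalk[OF _ UX]
  note group = abelian_groupE[OF stalk_group[OF UX]]
  note module = left_module.smult_closed[OF stalk_module[OF UX]]
    left_module.smult_l_distr[OF stalk_module[OF UX]]
    left_module.smult_r_distr[OF stalk_module[OF UX]] left_module.smult_assoc[OF stalk_module[OF UX]]
    left_module.smult_one[OF stalk_module[OF UX]]
  show ?thesis
  proof (rule left_moduleI, unfold sections_simps)
    fix s assume s: "s \<in> sec U"
    have "(\<lambda>x\<in>U. (\<lambda>x\<in>U. \<ominus>\<^bsub>M x\<^esub> s x) x \<oplus>\<^bsub>M x\<^esub> s x) = (\<lambda>x\<in>U. \<zero>\<^bsub>M x\<^esub>)"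
      using mem[OF s] by (intro restrict_ext) (simp add: abelian_group.l_neg[OF stalk_group[OF UX]])
    then show "\<exists>t\<in>sec U. (\<lambda>x\<in>U. t x \<oplus>\<^bsub>M x\<^esub> s x) = (\<lambda>x\<in>U. \<zero>\<^bsub>M x\<^esub>)"
      using sec_uminus[OF U s] by blast
    show "(\<lambda>x\<in>U. (\<lambda>x\<in>U. \<zero>\<^bsub>M x\<^esub>) x \<oplus>\<^bsub>M x\<^esub> s x) = s"
      using mem[OF s] by (subst (2) sec_restrict_eq[OF s, symmetric]) (auto intro!: restrict_ext
          simp: group(5))
    show "(\<lambda>x\<in>U. \<one>\<^bsub>R\<^esub> \<odot>\<^bsub>M x\<^esub> s x) = s"
      using mem[OF s] by (subst (2) sec_restrict_eq[OF s, symmetric]) (auto intro!: restrict_ext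
          simp: module)
    fix t assume t: "t \<in> sec U"
    show "(\<lambda>x\<in>U. s x \<oplus>\<^bsub>M x\<^esub> t x) \<in> sec U"
      using sec_add U s t .
    show "(\<lambda>x\<in>U. s x \<oplus>\<^bsub>M x\<^esub> t x) = (\<lambda>x\<in>U. t x \<oplus>\<^bsub>M x\<^esub> s x)"
      using mem[OF s] mem[OF t] by (intro restrict_ext group(4))
    fix u assume u: "u \<in> sec U"
    show "(\<lambda>x\<in>U. (\<lambda>x\<in>U. s x \<oplus>\<^bsub>M x\<^esub> t x) x \<oplus>\<^bsub>M x\<^esub> u x) = (\<lambda>x\<in>U. s x \<oplus>\<^bsub>M x\<^esub> (\<lambda>x\<in>U. t x \<oplus>\<^bsub>M x\<^esub> u x) x)"
      using mem[OF s] mem[OF t] mem[OF u] by (intro restrict_ext) (simp add: group(3))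
  qed (auto intro!: restrict_ext R_ring sec_zero U sec_smult simp: mem module UX)
qed

lemma sec_translate:
  assumes g: "g \<in> carrier G" and UV: "act g ` U \<subseteq> V" and V: "V \<subseteq> topspace X" and U: "U \<subseteq> topspace X"
    and s: "s \<in> sec V"
  shows "(\<lambda>x\<in>U. sh_act E (inv g) (s (act g x))) \<in> sec U"
proof (rule secI)
  have "continuous_map (subtopology X U) X ((\<lambda>(g, x). act g x) \<circ> (\<lambda>x. (g, x)))"
    using continuous_act g
    by (intro continuous_map_compose[of _ "prod_topology T X"]) (auto intro!: continuous_map_pairedI
        continuous_map_from_subtopology)
  then have "continuous_map (subtopology X U) (subtopology X V) (act g)"
    using UV U by (auto simp: o_def continuous_map_in_subtopology)
  then have "continuous_map (subtopology X U) S (s \<circ> act g)"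
    using s by (intro continuous_map_compose[of _ "subtopology X V"]) (auto simp: sec_iff)
  then have "continuous_map (subtopology X U) S ((\<lambda>(g, e). sh_act E g e) \<circ> (\<lambda>x. (inv g, (s \<circ> act g)
      x)))"
    using continuous_sh_act g
    by (intro continuous_map_compose[of _ "prod_topology T S"]) (auto intro!: continuous_map_pairedI
        simp del: o_apply)
  then show "continuous_map (subtopology X U) S (\<lambda>x. sh_act E (inv g) (s (act g x)))"
    by (simp add: o_def)
  fix x assume x: "x \<in> U"
  then have gx: "act g x \<in> V" "act g x \<in> topspace X" "x \<in> topspace X"
    using UV V U by auto
  then show "p (sh_act E (inv g) (s (act g x))) = x"
    using g s by (simp add: sec_mem)
qed

text \<open>The compactness of \<open>U\<close> is what makes the stabilizer of a section open.\<close>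

lemma openin_section_stabilizer:
  assumes U: "U \<in> B" and s: "s \<in> sec U"
  obtains N where "openin T N" "\<one> \<in> N" "N \<subseteq> set_stabilizer G act U"
    "\<And>h. h \<in> N \<Longrightarrow> (\<lambda>x\<in>U. sh_act E h (s (act (inv h) x))) = s"
proof -
  let ?H = "set_stabilizer G act U"
  let ?Y = "prod_topology (subtopology T ?H) (subtopology X U)"
  let ?f = "\<lambda>(h, x). sh_act E h (s (act (inv h) x))"
  have H: "inv h \<in> carrier G" "h \<in> carrier G" "act (inv h) ` U = U" if "h \<in> ?H" for h
    using subgroup.m_inv_closed[OF subgroup_set_stabilizer[OF U] that] that by (auto simp:
        set_stabilizer_iff)
  have fst: "continuous_map ?Y T fst" and snd: "continuous_map ?Y X snd"
    by (auto simp: prod_topology_subtopology intro: continuous_map_from_subtopology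
        continuous_map_fst continuous_map_snd)
  have "continuous_map ?Y X ((\<lambda>(g, x). act g x) \<circ> (\<lambda>z. (inv (fst z), snd z)))"
    using continuous_map_compose[OF fst continuous_inv] snd
    by (intro continuous_map_compose[OF _ continuous_act] continuous_map_pairedI) (auto simp: o_def)
  then have "continuous_map ?Y (subtopology X U) (\<lambda>z. act (inv (fst z)) (snd z))"
    using H by (fastforce simp: o_def continuous_map_in_subtopology)
  then have "continuous_map ?Y S (s \<circ> (\<lambda>z. act (inv (fst z)) (snd z)))"
    using s by (intro continuous_map_compose[of _ "subtopology X U"]) (auto simp: sec_iff)
  then have "continuous_map ?Y S ((\<lambda>(g, e). sh_act E g e) \<circ> (\<lambda>z. (fst z, s (act (inv (fst z)) (snd
      z)))))"
    using fst by (intro continuous_map_compose[OF _ continuous_sh_act] continuous_map_pairedI) (auto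
        simp: o_def)
  then have "continuous_map ?Y S ?f"
    by (simp add: o_def case_prod_unfold)
  \<comment> \<open>Lying in the image of \<open>s\<close> is an open condition, unlike equality
    with \<open>s x\<close>. The projection upgrades it to that equality further down.\<close>
  then have O: "openin ?Y {z \<in> topspace ?Y. ?f z \<in> s ` U}" (is "openin _ ?O")
    using openin_section_image[OF basis_openin[OF U] s] by (rule openin_continuous_map_preimage)
  have one: "\<one> \<in> topspace (subtopology T ?H)"
    using subgroup.one_closed[OF subgroup_set_stabilizer[OF U]] by simp
  have "{\<one>} \<times> U \<subseteq> ?O"
  proof
    fix z assume "z \<in> {\<one>} \<times> U"
    then show "z \<in> ?O"
      using one s U by (auto simp: sec_mem)
  qed
  moreover have "compactin (subtopology X U) U"
    using basis_compactin[OF U] by (simp add: compactin_subtopology)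
  ultimately obtain N V where N: "openin (subtopology T ?H) N" "\<one> \<in> N" "U \<subseteq> V" "N \<times> V \<subseteq> ?O"
    using tube_lemma_right[OF O _ one] by meson
  have NT: "openin T N" "N \<subseteq> ?H"
    using N(1) openin_set_stabilizer[OF U] by (auto simp: openin_open_subtopology)
  have "(\<lambda>x\<in>U. sh_act E h (s (act (inv h) x))) = s" if h: "h \<in> N" for h
  proof -
    have hG: "h \<in> carrier G" "act (inv h) ` U = U"
      using H NT(2) h by blast+
    have "sh_act E h (s (act (inv h) x)) = s x" if x: "x \<in> U" for x
    proof -
      have "(h, x) \<in> ?O"
        using N h x by blast
      then obtain y where y: "y \<in> U" "sh_act E h (s (act (inv h) x)) = s y"
        by auto
      have z: "act (inv h) x \<in> U"
        using hG(2) x by blast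
      then have "p (sh_act E h (s (act (inv h) x))) = act h (act (inv h) x)"
        using hG(1) s U by (simp add: sec_mem)
      then have "x = y"
        using y s hG(1) x U by simp
      then show ?thesis
        using y by simp
    qed
    then have "(\<lambda>x\<in>U. sh_act E h (s (act (inv h) x))) = restrict s U"
      by (rule restrict_ext)
    then show ?thesis
      using sec_restrict_eq[OF s] by simp
  qed
  then show thesis
    using that NT N(2) by blast
qed

end

section \<open>Presheaves and their products\<close>

context clopen_gspace
begin

lemma openin_left_translate:
  assumes N: "openin T N" and g: "g \<in> carrier G"
  shows "openin T {h \<in> carrier G. g \<otimes> h \<in> N}"
proof -
  have "continuous_map T T ((\<lambda>(g, h). g \<otimes> h) \<circ> (\<lambda>h. (g, h)))"
    using g by (intro continuous_map_compose[OF _ continuous_mult] continuous_map_pairedI) auto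
  then show ?thesis
    using openin_continuous_map_preimage[OF _ N] by (fastforce simp: o_def)
qed

lemma openin_right_translate:
  assumes N: "openin T N" and g: "g \<in> carrier G"
  shows "openin T {h \<in> carrier G. h \<otimes> g \<in> N}"
proof -
  have "continuous_map T T ((\<lambda>(g, h). g \<otimes> h) \<circ> (\<lambda>h. (h, g)))"
    using g by (intro continuous_map_compose[OF _ continuous_mult] continuous_map_pairedI) auto
  then show ?thesis
    using openin_continuous_map_preimage[OF _ N] by (fastforce simp: o_def)
qed

lemma set_stabilizer_mem:
  assumes "U \<in> B" "h \<in> set_stabilizer G act U"
  shows "h \<in> carrier G" "inv h \<in> set_stabilizer G act U" "act h ` U = U" "act (inv h) ` U = U"
  using subgroup.m_inv_closed[OF subgroup_set_stabilizer[OF assms(1)] assms(2)] assms(2)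
  by (auto simp: set_stabilizer_iff)

text \<open>An open neighbourhood \<open>N\<close> of the identity that fixes \<open>m\<close> is as
  good as an open subgroup: all elements of \<open>H\<close> fixing \<open>m\<close> form a
  subgroup, which together with \<open>h\<close> contains the left translate of \<open>N\<close> by
  \<open>h\<close> and so is open. Neighbourhoods are easier to intersect and to conjugate.\<close>

lemma discrete_part_carrier:
  assumes U: "U \<in> B" and H: "H = set_stabilizer G act U"
    and one: "\<And>m. m \<in> carrier M \<Longrightarrow> \<rho> \<one> m = m"
    and mult: "\<And>h k m. \<lbrakk>h \<in> H; k \<in> H; m \<in> carrier M\<rbrakk> \<Longrightarrow> \<rho> (h \<otimes> k) m = \<rho> h (\<rho> k m)"
  shows "carrier (discrete_part G T H \<rho> M) =
    {m \<in> carrier M. \<exists>N. openin T N \<and> \<one> \<in> N \<and> N \<subseteq> H \<and> (\<forall>h\<in>N. \<rho> h m = m)}"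
proof -
  have sub: "subgroup H G" and op: "openin T H"
    using subgroup_set_stabilizer[OF U] openin_set_stabilizer[OF U] by (simp_all add: H)
  have "(\<exists>L. subgroup L (G\<lparr>carrier := H\<rparr>) \<and> openin (subtopology T H) L \<and> (\<forall>h\<in>L. \<rho> h m = m)) \<longleftrightarrow>
      (\<exists>N. openin T N \<and> \<one> \<in> N \<and> N \<subseteq> H \<and> (\<forall>h\<in>N. \<rho> h m = m))" (is "?L \<longleftrightarrow> ?R")
    if m: "m \<in> carrier M" for m
  proof
    assume ?L
    then obtain L where L: "subgroup L (G\<lparr>carrier := H\<rparr>)" "openin (subtopology T H) L" "\<forall>h\<in>L. \<rho> h m = m"
      by blast
    then show ?R
      using op subgroup.one_closed[OF L(1)] by (auto simp: openin_open_subtopology)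
  next
    assume ?R
    then obtain N where N: "openin T N" "\<one> \<in> N" "N \<subseteq> H" "\<forall>h\<in>N. \<rho> h m = m"
      by blast
    let ?K = "{h \<in> H. \<rho> h m = m}"
    have inv: "\<rho> (inv h) m = m" if "h \<in> H" "\<rho> h m = m" for h
    proof -
      have "\<rho> (inv h) m = \<rho> (inv h) (\<rho> h m)"
        using that by simp
      also have "\<dots> = \<rho> (inv h \<otimes> h) m"
        using that m sub by (simp add: mult subgroup.m_inv_closed)
      finally show ?thesis
        using that m sub by (simp add: one subgroup.mem_carrier)
    qed
    have "subgroup ?K (G\<lparr>carrier := H\<rparr>)"
      using sub m inv
      by (auto simp: subgroup_def[of ?K] m_inv_consistent one mult subgroup.one_closed
          subgroup.m_closed subgroup.m_inv_closed)
    moreover have "openin T ?K"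
    proof (subst openin_subopen, safe)
      fix h assume h: "h \<in> H" "\<rho> h m = m"
      from h(1) have hG: "h \<in> carrier G"
        by (rule subgroup.mem_carrier[OF sub])
      let ?A = "{k \<in> carrier G. inv h \<otimes> k \<in> N}"
      have "openin T ?A"
        using N(1) hG by (intro openin_left_translate) auto
      moreover have "h \<in> ?A"
        using hG N by simp
      moreover have "?A \<subseteq> ?K"
      proof clarify
        fix k assume k: "k \<in> carrier G" "inv h \<otimes> k \<in> N"
        then have k': "inv h \<otimes> k \<in> H"
          using N by blast
        have eq: "k = h \<otimes> (inv h \<otimes> k)"
          using k hG by (simp add: m_assoc[symmetric])
        show "k \<in> H \<and> \<rho> k m = m"
          using mult[OF h(1) k' m] k(2) N(4) h k' subgroup.m_closed[OF sub h(1) k'] by (simp flip: eq)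
      qed
      ultimately show "\<exists>A. openin T A \<and> h \<in> A \<and> A \<subseteq> ?K"
        by blast
    qed
    then have "openin (subtopology T H) ?K"
      using op by (simp add: openin_open_subtopology)
    ultimately show ?L
      by blast
  qed
  then show ?thesis
    by (auto simp: discrete_part_def)
qed

text \<open>The module is discrete, so continuity at \<open>(h, s)\<close> asks only that every
  \<open>k\<close> near \<open>h\<close> act on \<open>s\<close> as \<open>h\<close> does. Such a
  \<open>k\<close> is \<open>h\<close> times an element of \<open>N\<close>, and the latter acts
  first and fixes \<open>s\<close>.\<close>

lemma is_gpresheafI:
  assumes module: "\<And>U. U \<in> B \<Longrightarrow> left_module R (ps_sect F U)"
    and linear: "\<And>U V g. \<lbrakk>U \<in> B; V \<in> B; g \<in> carrier G; act g ` U \<subseteq> V\<rbrakk> \<Longrightarrow>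
      linear_hom R (ps_sect F V) (ps_sect F U) (ps_map F U V g)"
    and id: "\<And>U s. \<lbrakk>U \<in> B; s \<in> carrier (ps_sect F U)\<rbrakk> \<Longrightarrow> ps_map F U U \<one> s = s"
    and comp: "\<And>U V W g h s. \<lbrakk>U \<in> B; V \<in> B; W \<in> B; g \<in> carrier G; h \<in> carrier G;
        act g ` U \<subseteq> V; act h ` V \<subseteq> W; s \<in> carrier (ps_sect F W)\<rbrakk> \<Longrightarrow>
      ps_map F U W (h \<otimes> g) s = ps_map F U V g (ps_map F V W h s)"
    and discrete: "\<And>U s. \<lbrakk>U \<in> B; s \<in> carrier (ps_sect F U)\<rbrakk> \<Longrightarrow>
      \<exists>N. openin T N \<and> \<one> \<in> N \<and> N \<subseteq> set_stabilizer G act U \<and> (\<forall>h\<in>N. ps_map F U U (inv h) s = s)"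
  shows "is_gpresheaf G T R act B F"
proof -
  have "continuous_map
      (prod_topology (subtopology T (set_stabilizer G act U)) (discrete_topology (carrier (ps_sect F
          U))))
      (discrete_topology (carrier (ps_sect F U))) (\<lambda>(h, s). ps_act G F U h s)"
    (is "continuous_map ?Y _ _") if U: "U \<in> B" for U
  proof (rule continuous_map_pointwiseI)
    fix z assume "z \<in> topspace ?Y"
    then obtain h s where z: "z = (h, s)" and h: "h \<in> set_stabilizer G act U" and s: "s \<in> carrier
        (ps_sect F U)"
      by (cases z) auto
    note h' = set_stabilizer_mem[OF U h]
    show "(\<lambda>(h, s). ps_act G F U h s) z \<in> topspace (discrete_topology (carrier (ps_sect F U)))"
      using linear_hom_closed[OF linear[OF U U] s] set_stabilizer_mem(1)[OF U h'(2)] h' by (simp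
          add: ps_act_def z)
    fix V assume "(\<lambda>(h, s). ps_act G F U h s) z \<in> V"
    then have V: "ps_act G F U h s \<in> V"
      by (simp add: z)
    obtain N where N: "openin T N" "\<one> \<in> N" "N \<subseteq> set_stabilizer G act U" "\<forall>h\<in>N. ps_map F U U (inv h)
        s = s"
      using discrete[OF U s] by blast
    let ?A = "{k \<in> carrier G. inv h \<otimes> k \<in> N} \<inter> set_stabilizer G act U"
    have "openin (subtopology T (set_stabilizer G act U)) ?A"
      using N(1) h' openin_set_stabilizer[OF U] by (auto simp: openin_open_subtopology intro!:
          openin_left_translate)
    then have "openin ?Y (?A \<times> {s})"
      using s by (simp add: openin_prod_Times_iff)
    moreover have "z \<in> ?A \<times> {s}"
      using h h' N(2) by (simp add: z)
    moreover have "\<forall>y\<in>?A \<times> {s}. (\<lambda>(h, s). ps_act G F U h s) y \<in> V"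
    proof
      fix y assume "y \<in> ?A \<times> {s}"
      then obtain k where y: "y = (k, s)" and k: "k \<in> carrier G" "inv h \<otimes> k \<in> N"
        by blast
      let ?n = "inv h \<otimes> k"
      have n: "inv ?n \<in> carrier G" "act (inv ?n) ` U = U"
        using set_stabilizer_mem[OF U, of "?n"] set_stabilizer_mem(1)[OF U, of "inv ?n"] N(3) k(2)
            by auto
      have "inv k = inv ?n \<otimes> inv h"
        using k(1) h' by (simp add: inv_mult_group m_assoc)
      then have "ps_map F U U (inv k) s = ps_map F U U (inv h) (ps_map F U U (inv ?n) s)"
        using comp[OF U U U, of "inv h" "inv ?n" s] n h' s by simp
      then show "(\<lambda>(h, s). ps_act G F U h s) y \<in> V"
        using V N(4) k(2) by (simp add: ps_act_def y)
    qed
    ultimately show "\<exists>W. openin ?Y W \<and> z \<in> W \<and> (\<forall>y\<in>W. (\<lambda>(h, s). ps_act G F U h s) y \<in> V)"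
      by blast
  qed
  then show ?thesis
    unfolding is_gpresheaf_def using module linear id comp by (intro conjI ballI impI) auto
qed

end

locale equivariant_presheaf = clopen_gspace G T R X act B
  for G :: "('g, 'z) monoid_scheme" (structure) and T :: "'g topology"
    and R :: "('r, 'w) ring_scheme"
    and X :: "'x topology" and act :: "'g \<Rightarrow> 'x \<Rightarrow> 'x" and B :: "'x set set" +
  fixes F :: "('g, 'x, 'r, 'm) gpresheaf"
  assumes presheaf: "is_gpresheaf G T R act B F"
begin

abbreviation Sec :: "'x set \<Rightarrow> 'm set" where "Sec U \<equiv> carrier (ps_sect F U)"

lemma sect_module: "U \<in> B \<Longrightarrow> left_module R (ps_sect F U)"
  and map_linear: "\<lbrakk>U \<in> B; V \<in> B; g \<in> carrier G; act g ` U \<subseteq> V\<rbrakk> \<Longrightarrow>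
    linear_hom R (ps_sect F V) (ps_sect F U) (ps_map F U V g)"
  and map_id: "\<lbrakk>U \<in> B; s \<in> Sec U\<rbrakk> \<Longrightarrow> ps_map F U U \<one> s = s"
  and map_comp: "\<lbrakk>U \<in> B; V \<in> B; W \<in> B; g \<in> carrier G; h \<in> carrier G;
        act g ` U \<subseteq> V; act h ` V \<subseteq> W; s \<in> Sec W\<rbrakk> \<Longrightarrow>
      ps_map F U W (h \<otimes> g) s = ps_map F U V g (ps_map F V W h s)"
  using presheaf by (simp_all add: is_gpresheaf_def)

lemma map_closed: "\<lbrakk>U \<in> B; V \<in> B; g \<in> carrier G; act g ` U \<subseteq> V; s \<in> Sec V\<rbrakk> \<Longrightarrow> ps_map F U V g s \<in> Sec U"
  by (rule linear_hom_closed[OF map_linear])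

text \<open>Converse to the last premise of \<open>is_gpresheafI\<close>: continuity at the identity
  and \<open>s\<close>, with the singleton of \<open>s\<close> as open target.\<close>

lemma stabilizer_nbhd:
  assumes U: "U \<in> B" and s: "s \<in> Sec U"
  obtains N where "openin T N" "\<one> \<in> N" "N \<subseteq> set_stabilizer G act U"
    "\<And>h. h \<in> N \<Longrightarrow> ps_map F U U (inv h) s = s"
proof -
  let ?H = "set_stabilizer G act U"
  let ?Y = "prod_topology (subtopology T ?H) (discrete_topology (Sec U))"
  have cont: "continuous_map ?Y (discrete_topology (Sec U)) (\<lambda>(h, s). ps_act G F U h s)"
    using presheaf U by (simp add: is_gpresheaf_def)
  have one: "(\<one>, s) \<in> topspace ?Y"
    using subgroup.one_closed[OF subgroup_set_stabilizer[OF U]] s by simp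
  obtain W where W: "openin ?Y W" "(\<one>, s) \<in> W" "\<forall>z\<in>W. (\<lambda>(h, s). ps_act G F U h s) z \<in> {s}"
    using continuous_map_pointwiseD[OF cont one, of "{s}"] s U by (auto simp: ps_act_def map_id)
  then obtain N A where "openin (subtopology T ?H) N" "\<one> \<in> N" "s \<in> A" "N \<times> A \<subseteq> W"
    unfolding openin_prod_topology_alt by meson
  then show thesis
    using W(3) openin_set_stabilizer[OF U]
    by (intro that[of N]) (auto simp: openin_open_subtopology ps_act_def)
qed

end

context equivariant_sheaf
begin

lemma underlying_presheaf_simps:
  "ps_sect (underlying_presheaf G X act E) = sections X E"
  "ps_map (underlying_presheaf G X act E) U V g s = (\<lambda>x\<in>U. sh_act E (inv g) (s (act g x)))"
  by (simp_all add: underlying_presheaf_def)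

lemma sections_translate_linear:
  assumes g: "g \<in> carrier G" "act g ` U \<subseteq> V" and U: "U \<in> B" and V: "V \<in> B"
  shows "linear_hom R (sections X E V) (sections X E U) (\<lambda>s. \<lambda>x\<in>U. sh_act E (inv g) (s (act g x)))"
proof -
  have lin: "linear_hom R (M (act g x)) (M x) (sh_act E (inv g))" if "x \<in> U" for x
    using sh_act_linear[of "inv g" "act g x"] g(1) U that by simp
  show ?thesis
    unfolding linear_hom_def sections_simps
  proof (intro conjI ballI funcsetI)
    fix s assume s: "s \<in> sec V"
    show "(\<lambda>x\<in>U. sh_act E (inv g) (s (act g x))) \<in> sec U"
      using sec_translate[OF g basis_subset basis_subset s] U V by blast
    have s': "s (act g x) \<in> carrier (M (act g x))" if "x \<in> U" for x
      using s that g U by (intro sec_stalk) auto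
    show "(\<lambda>x\<in>U. sh_act E (inv g) ((\<lambda>x\<in>V. a \<odot>\<^bsub>M x\<^esub> s x) (act g x))) =
        (\<lambda>x\<in>U. a \<odot>\<^bsub>M x\<^esub> (\<lambda>x\<in>U. sh_act E (inv g) (s (act g x))) x)" if "a \<in> carrier R" for a
      using that g(2) s' by (intro restrict_ext) (auto simp: linear_hom_smult[OF lin])
    fix t assume t: "t \<in> sec V"
    have t': "t (act g x) \<in> carrier (M (act g x))" if "x \<in> U" for x
      using t that g U by (intro sec_stalk) auto
    show "(\<lambda>x\<in>U. sh_act E (inv g) ((\<lambda>x\<in>V. s x \<oplus>\<^bsub>M x\<^esub> t x) (act g x))) =
        (\<lambda>x\<in>U. (\<lambda>x\<in>U. sh_act E (inv g) (s (act g x))) x \<oplus>\<^bsub>M x\<^esub> (\<lambda>x\<in>U. sh_act E (inv g) (t (act g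
            x))) x)"
      using g(2) s' t' by (intro restrict_ext) (auto simp: linear_hom_add[OF lin])
  qed
qed

lemma is_gpresheaf_underlying: "is_gpresheaf G T R act B (underlying_presheaf G X act E)"
proof (rule is_gpresheafI, unfold underlying_presheaf_simps)
  show "\<And>U. U \<in> B \<Longrightarrow> left_module R (sections X E U)"
    using left_module_sections basis_openin by blast
  fix U assume U: "U \<in> B"
  show "(\<lambda>x\<in>U. sh_act E (inv \<one>) (s (act \<one> x))) = s" if s: "s \<in> sec U" for s
  proof -
    have "(\<lambda>x\<in>U. sh_act E (inv \<one>) (s (act \<one> x))) = restrict s U"
      using s U by (intro restrict_ext) (simp add: sec_mem)
    then show ?thesis
      using sec_restrict_eq[OF s] by simp
  qed
  show "\<exists>N. openin T N \<and> \<one> \<in> N \<and> N \<subseteq> set_stabilizer G act U \<and>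
      (\<forall>h\<in>N. (\<lambda>x\<in>U. sh_act E (inv (inv h)) (s (act (inv h) x))) = s)" if s: "s \<in> sec U" for s
  proof -
    obtain N where N: "openin T N" "\<one> \<in> N" "N \<subseteq> set_stabilizer G act U"
        "\<And>h. h \<in> N \<Longrightarrow> (\<lambda>x\<in>U. sh_act E h (s (act (inv h) x))) = s"
      using openin_section_stabilizer[OF U s] by metis
    \<comment> \<open>The action of \<open>h\<close> is the presheaf map at \<open>inv h\<close>,
      which translates values by \<open>inv (inv h)\<close>, whereas
      \<open>openin_section_stabilizer\<close> speaks of \<open>h\<close> itself.\<close>
    moreover have "inv (inv h) = h" if "h \<in> N" for h
      using N(3) that by (auto simp: set_stabilizer_iff)
    ultimately show ?thesis
      by (intro exI[of _ N]) auto
  qed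
  fix V W g h s
  assume V: "V \<in> B" and W: "W \<in> B" and g: "g \<in> carrier G" "act g ` U \<subseteq> V"
    and h: "h \<in> carrier G" "act h ` V \<subseteq> W" and s: "s \<in> sec W"
  show "(\<lambda>x\<in>U. sh_act E (inv (h \<otimes> g)) (s (act (h \<otimes> g) x))) =
      (\<lambda>x\<in>U. sh_act E (inv g) ((\<lambda>x\<in>V. sh_act E (inv h) (s (act h x))) (act g x)))"
  proof (intro restrict_ext)
    fix x assume x: "x \<in> U"
    then have x': "act g x \<in> V" "act h (act g x) \<in> W" "x \<in> topspace X"
      using g h U by auto
    have "s (act h (act g x)) \<in> topspace S"
      using s x' g h by (intro sec_mem) auto
    then show "sh_act E (inv (h \<otimes> g)) (s (act (h \<otimes> g) x)) =
        sh_act E (inv g) ((\<lambda>x\<in>V. sh_act E (inv h) (s (act h x))) (act g x))"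
      using g h x' by (simp add: act_mult inv_mult_group sh_act_mult)
  qed
qed (simp add: sections_translate_linear)

sublocale underlying: equivariant_presheaf G T R X act B "underlying_presheaf G X act E"
  by unfold_locales (rule is_gpresheaf_underlying)

end

section \<open>The discrete product of a family of presheaves\<close>

locale presheaf_family = clopen_gspace G T R X act B
  for G :: "('g, 'z) monoid_scheme" (structure) and T :: "'g topology"
    and R :: "('r, 'w) ring_scheme"
    and X :: "'x topology" and act :: "'g \<Rightarrow> 'x \<Rightarrow> 'x" and B :: "'x set set" +
  fixes I :: "'i set" and F :: "'i \<Rightarrow> ('g, 'x, 'r, 'm) gpresheaf"
  assumes family: "i \<in> I \<Longrightarrow> is_gpresheaf G T R act B (F i)"
begin

abbreviation Q :: "('g, 'x, 'r, 'i \<Rightarrow> 'm) gpresheaf" where "Q \<equiv> presheaf_product G T act I F"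
abbreviation prod_sect :: "'x set \<Rightarrow> ('r, 'i \<Rightarrow> 'm) module" where
  "prod_sect U \<equiv> module_product I (\<lambda>i. ps_sect (F i) U)"
abbreviation prod_map :: "'x set \<Rightarrow> 'x set \<Rightarrow> 'g \<Rightarrow> ('i \<Rightarrow> 'm) \<Rightarrow> 'i \<Rightarrow> 'm" where
  "prod_map U V g s \<equiv> \<lambda>i\<in>I. ps_map (F i) U V g (s i)"

lemma factor: "i \<in> I \<Longrightarrow> equivariant_presheaf G T R X act B (F i)"
  by (simp add: equivariant_presheaf_def equivariant_presheaf_axioms_def family clopen_gspace_axioms)

lemma prod_sect_mem: "s \<in> carrier (prod_sect U) \<Longrightarrow> i \<in> I \<Longrightarrow> s i \<in> carrier (ps_sect (F i) U)"
  by (auto simp: module_product_simps)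

lemma prod_map_linear:
  assumes "U \<in> B" "V \<in> B" "g \<in> carrier G" "act g ` U \<subseteq> V"
  shows "linear_hom R (prod_sect V) (prod_sect U) (prod_map U V g)"
proof -
  have lin: "linear_hom R (ps_sect (F i) V) (ps_sect (F i) U) (ps_map (F i) U V g)" if "i \<in> I" for i
    by (intro equivariant_presheaf.map_linear[OF factor[OF that]] assms)
  show ?thesis
    unfolding linear_hom_def[of R "prod_sect V"] module_product_simps(3,4)
    using linear_hom_closed[OF lin] linear_hom_add[OF lin] linear_hom_smult[OF lin]
    by (auto intro!: restrict_ext simp: module_product_simps(1) prod_sect_mem[of _ V, unfolded
        module_product_simps])
qed

lemma prod_map_id:
  assumes "U \<in> B" "s \<in> carrier (prod_sect U)"
  shows "prod_map U U \<one> s = s"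
proof -
  have "prod_map U U \<one> s = restrict s I"
    using assms equivariant_presheaf.map_id[OF factor]
    by (intro restrict_ext) (simp add: prod_sect_mem)
  then show ?thesis
    using assms(2) by (simp add: module_product_simps PiE_restrict)
qed

lemma prod_map_comp:
  assumes "U \<in> B" "V \<in> B" "W \<in> B" "g \<in> carrier G" "h \<in> carrier G"
    and "act g ` U \<subseteq> V" "act h ` V \<subseteq> W" "s \<in> carrier (prod_sect W)"
  shows "prod_map U W (h \<otimes> g) s = prod_map U V g (prod_map V W h s)"
  using assms equivariant_presheaf.map_comp[OF factor, of _ U V W g h]
  by (intro restrict_ext) (simp add: prod_sect_mem)

lemma product_carrier:
  assumes U: "U \<in> B"
  shows "carrier (ps_sect Q U) = {s \<in> carrier (prod_sect U).
    \<exists>N. openin T N \<and> \<one> \<in> N \<and> N \<subseteq> set_stabilizer G act U \<and> (\<forall>h\<in>N. prod_map U U (inv h) s = s)}"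
proof -
  have "carrier (discrete_part G T (set_stabilizer G act U) (\<lambda>h. prod_map U U (inv h)) (prod_sect U)) =
    {s \<in> carrier (prod_sect U).
    \<exists>N. openin T N \<and> \<one> \<in> N \<and> N \<subseteq> set_stabilizer G act U \<and> (\<forall>h\<in>N. prod_map U U (inv h) s = s)}"
  proof (rule discrete_part_carrier[OF U refl])
    show "prod_map U U (inv \<one>) m = m" if "m \<in> carrier (prod_sect U)" for m
      using prod_map_id[OF U that] by simp
    fix h k m
    assume hk: "h \<in> set_stabilizer G act U" "k \<in> set_stabilizer G act U" and m: "m \<in> carrier
        (prod_sect U)"
    show "prod_map U U (inv (h \<otimes> k)) m = prod_map U U (inv h) (prod_map U U (inv k) m)"
      using prod_map_comp[OF U U U, of "inv h" "inv k" m] set_stabilizer_mem[OF U hk(1)]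
          set_stabilizer_mem[OF U hk(2)] m
      by (simp add: inv_mult_group)
  qed
  then show ?thesis
    by (simp add: presheaf_product_def ps_act_def)
qed

lemma product_simps:
  "\<zero>\<^bsub>ps_sect Q U\<^esub> = \<zero>\<^bsub>prod_sect U\<^esub>"
  "s \<oplus>\<^bsub>ps_sect Q U\<^esub> t = s \<oplus>\<^bsub>prod_sect U\<^esub> t"
  "a \<odot>\<^bsub>ps_sect Q U\<^esub> s = a \<odot>\<^bsub>prod_sect U\<^esub> s"
  "ps_map Q U V g s = prod_map U V g s"
  by (simp_all add: presheaf_product_def discrete_part_def)

lemma product_sect_module:
  assumes U: "U \<in> B"
  shows "left_module R (ps_sect Q U)"
proof -
  have mod: "left_module R (prod_sect U)"
    by (intro left_module_product[OF R_ring] equivariant_presheaf.sect_module[OF factor U])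
  interpret left_module R "prod_sect U" by (fact mod)
  have lin: "linear_hom R (prod_sect U) (prod_sect U) (prod_map U U (inv h))" if "h \<in> set_stabilizer
      G act U" for h
    using prod_map_linear[OF U U] set_stabilizer_mem[OF U that] by simp
  \<comment> \<open>Only two elements are ever combined by an operation, so a finite intersection of
    fixing neighbourhoods suffices.\<close>
  have Int: "\<exists>N. openin T N \<and> \<one> \<in> N \<and> N \<subseteq> set_stabilizer G act U \<and> (\<forall>h\<in>N. P h \<and> P' h)"
    if "\<exists>N. openin T N \<and> \<one> \<in> N \<and> N \<subseteq> set_stabilizer G act U \<and> (\<forall>h\<in>N. P h)"
      and "\<exists>N. openin T N \<and> \<one> \<in> N \<and> N \<subseteq> set_stabilizer G act U \<and> (\<forall>h\<in>N. P' h)" for P P'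
  proof -
    from that obtain N N' where "openin T N" "\<one> \<in> N" "N \<subseteq> set_stabilizer G act U" "\<forall>h\<in>N. P h"
      "openin T N'" "\<one> \<in> N'" "\<forall>h\<in>N'. P' h" by blast
    then show ?thesis
      by (intro exI[of _ "N \<inter> N'"]) auto
  qed
  \<comment> \<open>\<open>discrete_part\<close> replaces the carrier and nothing else, so the
    submodule criterion applies to the full product module.\<close>
  have eq: "ps_sect Q U = prod_sect U\<lparr>carrier := carrier (ps_sect Q U)\<rparr>"
    by (simp add: presheaf_product_def discrete_part_def)
  have "left_module R (prod_sect U\<lparr>carrier := carrier (ps_sect Q U)\<rparr>)"
  proof (rule left_module_submodule[OF mod]; unfold product_carrier[OF U])
    show "\<zero>\<^bsub>prod_sect U\<^esub> \<in> {s \<in> carrier (prod_sect U). \<exists>N. openin T N \<and> \<one> \<in> N \<and>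
        N \<subseteq> set_stabilizer G act U \<and> (\<forall>h\<in>N. prod_map U U (inv h) s = s)}"
      using openin_set_stabilizer[OF U] subgroup.one_closed[OF subgroup_set_stabilizer[OF U]]
        linear_hom_zero[OF lin mod mod] by blast
  next
    fix x y
    assume "x \<in> {s \<in> carrier (prod_sect U). \<exists>N. openin T N \<and> \<one> \<in> N \<and>
        N \<subseteq> set_stabilizer G act U \<and> (\<forall>h\<in>N. prod_map U U (inv h) s = s)}"
      "y \<in> {s \<in> carrier (prod_sect U). \<exists>N. openin T N \<and> \<one> \<in> N \<and>
        N \<subseteq> set_stabilizer G act U \<and> (\<forall>h\<in>N. prod_map U U (inv h) s = s)}"
    then have xy: "x \<in> carrier (prod_sect U)" "y \<in> carrier (prod_sect U)"
      and "\<exists>N. openin T N \<and> \<one> \<in> N \<and> N \<subseteq> set_stabilizer G act U \<and>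
        (\<forall>h\<in>N. prod_map U U (inv h) x = x \<and> prod_map U U (inv h) y = y)"
      using Int by auto
    then obtain N where "openin T N" "\<one> \<in> N" "N \<subseteq> set_stabilizer G act U"
      and N: "\<And>h. h \<in> N \<Longrightarrow> prod_map U U (inv h) x = x" "\<And>h. h \<in> N \<Longrightarrow> prod_map U U (inv h) y = y"
      by blast
    moreover have "prod_map U U (inv h) (x \<oplus>\<^bsub>prod_sect U\<^esub> y) = x \<oplus>\<^bsub>prod_sect U\<^esub> y" if "h \<in> N" for h
      using linear_hom_add[OF lin xy, of h] N[OF that] \<open>N \<subseteq> _\<close> that by auto
    ultimately show "x \<oplus>\<^bsub>prod_sect U\<^esub> y \<in> {s \<in> carrier (prod_sect U). \<exists>N. openin T N \<and> \<one> \<in> N \<and>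
        N \<subseteq> set_stabilizer G act U \<and> (\<forall>h\<in>N. prod_map U U (inv h) s = s)}"
      using xy by auto
  next
    fix x
    assume "x \<in> {s \<in> carrier (prod_sect U). \<exists>N. openin T N \<and> \<one> \<in> N \<and>
        N \<subseteq> set_stabilizer G act U \<and> (\<forall>h\<in>N. prod_map U U (inv h) s = s)}"
    then obtain N where x: "x \<in> carrier (prod_sect U)" and "openin T N" "\<one> \<in> N" "N \<subseteq> set_stabilizer
        G act U"
      and N: "\<And>h. h \<in> N \<Longrightarrow> prod_map U U (inv h) x = x"
      by blast
    moreover have "prod_map U U (inv h) (\<ominus>\<^bsub>prod_sect U\<^esub> x) = \<ominus>\<^bsub>prod_sect U\<^esub> x"
      and "\<And>a. a \<in> carrier R \<Longrightarrow> prod_map U U (inv h) (a \<odot>\<^bsub>prod_sect U\<^esub> x) = a \<odot>\<^bsub>prod_sect U\<^esub> x" if "h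
          \<in> N" for h
      using linear_hom_neg[OF lin mod mod x, of h] linear_hom_smult[OF lin _ x, of h] N[OF that] \<open>N
          \<subseteq> _\<close> that by auto
    ultimately show "\<ominus>\<^bsub>prod_sect U\<^esub> x \<in> {s \<in> carrier (prod_sect U). \<exists>N. openin T N \<and> \<one> \<in> N \<and>
        N \<subseteq> set_stabilizer G act U \<and> (\<forall>h\<in>N. prod_map U U (inv h) s = s)}"
      and "\<And>a. a \<in> carrier R \<Longrightarrow> a \<odot>\<^bsub>prod_sect U\<^esub> x \<in> {s \<in> carrier (prod_sect U). \<exists>N. openin T N \<and> \<one> \<in> N \<and>
        N \<subseteq> set_stabilizer G act U \<and> (\<forall>h\<in>N. prod_map U U (inv h) s = s)}"
      using smult_closed by auto
  qed auto
  then show ?thesis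
    using eq by simp
qed

text \<open>If \<open>N\<close> fixes \<open>s\<close>, the conjugate of \<open>N\<close> by
  \<open>inv g\<close> fixes the image of \<open>s\<close>: an element \<open>h\<close> on the side
  of \<open>U\<close> passes through the map as \<open>g \<otimes> h \<otimes> inv g\<close> on the
  side of \<open>V\<close>. Since \<open>g\<close> may carry \<open>U\<close> to a smaller set than
  \<open>V\<close>, the conjugate must also be intersected with the stabilizer of
  \<open>U\<close>.\<close>

lemma prod_map_closed:
  assumes U: "U \<in> B" and V: "V \<in> B" and g: "g \<in> carrier G" "act g ` U \<subseteq> V" and s: "s \<in> carrier
      (ps_sect Q V)"
  shows "prod_map U V g s \<in> carrier (ps_sect Q U)"
proof -
  obtain N where sV: "s \<in> carrier (prod_sect V)" and N: "openin T N" "\<one> \<in> N" "N \<subseteq> set_stabilizer G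
      act V"
      "\<And>h. h \<in> N \<Longrightarrow> prod_map V V (inv h) s = s"
    using s unfolding product_carrier[OF V] by blast
  let ?N = "set_stabilizer G act U \<inter> {h \<in> carrier G. g \<otimes> h \<in> {k \<in> carrier G. k \<otimes> inv g \<in> N}}"
  have "openin T ?N"
    using N(1) g openin_set_stabilizer[OF U] by (intro openin_Int openin_left_translate
        openin_right_translate) auto
  moreover have "\<one> \<in> ?N"
    using N(2) g subgroup.one_closed[OF subgroup_set_stabilizer[OF U]] by simp
  moreover have "prod_map U U (inv h) (prod_map U V g s) = prod_map U V g s" if h: "h \<in> ?N" for h
  proof -
    let ?k = "g \<otimes> h \<otimes> inv g"
    have k: "?k \<in> N" and hU: "h \<in> carrier G" "act (inv h) ` U = U"
      using h set_stabilizer_mem[OF U, of h] by auto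
    have kV: "?k \<in> carrier G" "inv ?k \<in> carrier G" "act (inv ?k) ` V = V"
      using N(3) k set_stabilizer_mem[OF V, of "?k"] by auto
    have "prod_map U U (inv h) (prod_map U V g s) = prod_map U V (g \<otimes> inv h) s"
      using prod_map_comp[OF U U V, of "inv h" g s] hU g sV by simp
    also have "g \<otimes> inv h = inv ?k \<otimes> g"
      using g(1) hU(1) by (simp add: inv_mult_group m_assoc)
    also have "prod_map U V (inv ?k \<otimes> g) s = prod_map U V g (prod_map V V (inv ?k) s)"
      using prod_map_comp[OF U V V, of g "inv ?k" s] kV g sV by simp
    also have "prod_map V V (inv ?k) s = s"
      using N(4) k by blast
    finally show ?thesis .
  qed
  ultimately have "\<exists>N. openin T N \<and> \<one> \<in> N \<and> N \<subseteq> set_stabilizer G act U \<and>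
      (\<forall>h\<in>N. prod_map U U (inv h) (prod_map U V g s) = prod_map U V g s)"
    by (intro exI[of _ ?N]) blast
  then show ?thesis
    unfolding product_carrier[OF U] using linear_hom_closed[OF prod_map_linear[OF U V g] sV] by blast
qed

lemma is_gpresheaf_product: "is_gpresheaf G T R act B Q"
proof (rule is_gpresheafI)
  show "\<And>U. U \<in> B \<Longrightarrow> left_module R (ps_sect Q U)"
    by (rule product_sect_module)
  have sub: "s \<in> carrier (prod_sect U)" if "U \<in> B" "s \<in> carrier (ps_sect Q U)" for U s
    using that product_carrier by blast
  fix U assume U: "U \<in> B"
  show "ps_map Q U U \<one> s = s" if "s \<in> carrier (ps_sect Q U)" for s
    unfolding product_simps using that sub U prod_map_id by blast
  show "\<exists>N. openin T N \<and> \<one> \<in> N \<and> N \<subseteq> set_stabilizer G act U \<and> (\<forall>h\<in>N. ps_map Q U U (inv h) s = s)"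
    if "s \<in> carrier (ps_sect Q U)" for s
    unfolding product_simps using that product_carrier[OF U] by blast
  fix V g assume V: "V \<in> B" and g: "g \<in> carrier G" "act g ` U \<subseteq> V"
  show "linear_hom R (ps_sect Q V) (ps_sect Q U) (ps_map Q U V g)"
    using prod_map_closed[OF U V g] prod_map_linear[OF U V g] sub[OF V]
    by (auto simp: linear_hom_def product_simps)
  fix W h s assume W: "W \<in> B" and h: "h \<in> carrier G" "act h ` V \<subseteq> W" and s: "s \<in> carrier (ps_sect Q W)"
  show "ps_map Q U W (h \<otimes> g) s = ps_map Q U V g (ps_map Q V W h s)"
    unfolding product_simps by (rule prod_map_comp[OF U V W g(1) h(1) g(2) h(2) sub[OF W s]])
qed

sublocale product: equivariant_presheaf G T R X act B Q
  by unfold_locales (rule is_gpresheaf_product)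

end

section \<open>Germs\<close>

context equivariant_presheaf
begin

abbreviation gm :: "'x \<Rightarrow> 'x set \<Rightarrow> 'm \<Rightarrow> ('x, 'm) germ" where "gm \<equiv> germ G B F"
abbreviation res :: "'x set \<Rightarrow> 'x set \<Rightarrow> 'm \<Rightarrow> 'm" where "res U W s \<equiv> ps_map F W U \<one> s"
abbreviation GT :: "('x, 'm) germ topology" where "GT \<equiv> germ_topology G B F"
abbreviation GS :: "'x \<Rightarrow> ('r, ('x, 'm) germ) module" where "GS \<equiv> germ_stalk G B F"

lemma act_one_image: "U \<in> B \<Longrightarrow> act \<one> ` U = U"
  by (force simp: image_iff)

lemma res_linear: "\<lbrakk>U \<in> B; W \<in> B; W \<subseteq> U\<rbrakk> \<Longrightarrow> linear_hom R (ps_sect F U) (ps_sect F W) (res U W)"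
  by (intro map_linear) (simp_all add: act_one_image)

lemma res_closed: "\<lbrakk>U \<in> B; W \<in> B; W \<subseteq> U; s \<in> Sec U\<rbrakk> \<Longrightarrow> res U W s \<in> Sec W"
  using linear_hom_closed[OF res_linear] .

lemma res_map:
  assumes "U \<in> B" "V \<in> B" "W \<in> B" "W \<subseteq> V" "g \<in> carrier G" "act g ` V \<subseteq> U" "s \<in> Sec U"
  shows "res V W (ps_map F V U g s) = ps_map F W U g s"
  using map_comp[of W V U \<one> g s] assms by (simp add: act_one_image)

lemma map_res:
  assumes "U \<in> B" "V \<in> B" "W \<in> B" "W \<subseteq> U" "g \<in> carrier G" "act g ` V \<subseteq> W" "s \<in> Sec U"
  shows "ps_map F V W g (res U W s) = ps_map F V U g s"
  using map_comp[of V W U g \<one> s] assms by (simp add: act_one_image)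

lemma res_res:
  assumes "U \<in> B" "V \<in> B" "W \<in> B" "W \<subseteq> V" "V \<subseteq> U" "s \<in> Sec U"
  shows "res V W (res U V s) = res U W s"
  using res_map[of U V W \<one> s] assms by (simp add: act_one_image)

lemma fst_germ [simp]: "fst (gm x U s) = x"
  by (simp add: germ_def)

text \<open>\<open>germ\<close> stores a whole class of the filtered colimit. The pair
  \<open>(V, t)\<close> belongs to its own class, which gives one direction; the other is
  transitivity, by restriction to a basis set inside both witnesses.\<close>

lemma germ_eq_iff:
  assumes U: "U \<in> B" "x \<in> U" "s \<in> Sec U" and V: "V \<in> B" "y \<in> V" "t \<in> Sec V"
  shows "gm x U s = gm y V t \<longleftrightarrow>
    x = y \<and> (\<exists>W\<in>B. x \<in> W \<and> W \<subseteq> U \<and> W \<subseteq> V \<and> res U W s = res V W t)"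
proof
  assume eq: "gm x U s = gm y V t"
  then have "x = y"
    by (metis fst_germ)
  moreover have "(V, t) \<in> snd (gm y V t)"
    using V by (auto simp: germ_def)
  ultimately show "x = y \<and> (\<exists>W\<in>B. x \<in> W \<and> W \<subseteq> U \<and> W \<subseteq> V \<and> res U W s = res V W t)"
    unfolding eq[symmetric] by (auto simp: germ_def)
next
  have sub: "snd (gm x U s) \<subseteq> snd (gm x V t)"
    if U: "U \<in> B" "s \<in> Sec U" and V: "V \<in> B" "t \<in> Sec V"
      and W: "W \<in> B" "x \<in> W" "W \<subseteq> U" "W \<subseteq> V" "res U W s = res V W t" for U s V t W
  proof
    fix z assume "z \<in> snd (gm x U s)"
    then obtain V' t' W' where z: "z = (V', t')" and V': "V' \<in> B" "x \<in> V'" "t' \<in> Sec V'"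
        and W': "W' \<in> B" "x \<in> W'" "W' \<subseteq> U" "W' \<subseteq> V'" "res U W' s = res V' W' t'"
      by (auto simp: germ_def)
    obtain A where A: "A \<in> B" "x \<in> A" "A \<subseteq> W" "A \<subseteq> W'"
      using basis_nbhd2 W W' by metis
    have "res V A t = res W A (res V W t)"
      using res_res[of V W A t] V W A by simp
    also have "\<dots> = res U A s"
      using res_res[of U W A s] U W A by simp
    also have "\<dots> = res W' A (res U W' s)"
      using res_res[of U W' A s] U W' A by simp
    also have "\<dots> = res V' A t'"
      using res_res[of V' W' A t'] V' W' A by simp
    finally show "z \<in> snd (gm x V t)"
      using V' W' W A z by (auto simp: germ_def intro!: bexI[of _ A])
  qed
  assume *: "x = y \<and> (\<exists>W\<in>B. x \<in> W \<and> W \<subseteq> U \<and> W \<subseteq> V \<and> res U W s = res V W t)"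
  then obtain W where W: "W \<in> B" "x \<in> W" "W \<subseteq> U" "W \<subseteq> V" "res U W s = res V W t"
    by blast
  have "snd (gm x U s) = snd (gm x V t)"
    using sub[OF U(1,3) V(1,3) W] sub[OF V(1,3) U(1,3) W(1,2,4,3) W(5)[symmetric]] by (rule equalityI)
  then show "gm x U s = gm y V t"
    using * by (simp add: germ_def)
qed

lemma germ_res:
  assumes "U \<in> B" "W \<in> B" "W \<subseteq> U" "x \<in> W" "s \<in> Sec U"
  shows "gm x W (res U W s) = gm x U s"
proof -
  have "res W W (res U W s) = res U W s"
    using assms by (simp add: map_id res_closed)
  then show ?thesis
    using assms by (subst germ_eq_iff) (auto simp: res_closed intro!: bexI[of _ W])
qed

lemma topspace_germ: "topspace GT = {gm x U s |x U s. U \<in> B \<and> x \<in> U \<and> s \<in> Sec U}"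
  by (auto simp: germ_topology_def topology_generated_by_topspace)

lemma germ_stalk_carrier: "carrier (GS x) = {e \<in> topspace GT. fst e = x}"
proof -
  have "e \<in> carrier (GS x) \<longleftrightarrow> e \<in> topspace GT \<and> fst e = x" for e
    unfolding germ_stalk_def topspace_germ by simp (metis fst_germ)
  then show ?thesis
    by blast
qed

lemma germ_in_topspace [intro]: "U \<in> B \<Longrightarrow> x \<in> U \<Longrightarrow> s \<in> Sec U \<Longrightarrow> gm x U s \<in> topspace GT"
  by (auto simp: topspace_germ)

lemma germ_rep:
  assumes "e \<in> topspace GT"
  obtains U s where "U \<in> B" "fst e \<in> U" "s \<in> Sec U" "e = gm (fst e) U s"
  using assms by (auto simp: topspace_germ)

lemma germ_rep_subset:
  assumes e: "e \<in> topspace GT" and W: "W \<in> B" "fst e \<in> W"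
  obtains U s where "U \<in> B" "U \<subseteq> W" "fst e \<in> U" "s \<in> Sec U" "e = gm (fst e) U s"
proof -
  obtain U s where U: "U \<in> B" "fst e \<in> U" "s \<in> Sec U" "e = gm (fst e) U s"
    using germ_rep[OF e] .
  obtain V where V: "V \<in> B" "fst e \<in> V" "V \<subseteq> U" "V \<subseteq> W"
    using basis_nbhd2 U W by metis
  show thesis
    using that[of V "res U V s"] U V germ_res[of U V "fst e" s] by (simp add: res_closed)
qed

text \<open>The description of addition in \<open>germ_stalk\<close> expects two sections over one
  basis set.\<close>

lemma germ_rep2:
  assumes "e \<in> topspace GT" "e' \<in> topspace GT" "fst e = x" "fst e' = x"
  obtains U s s' where "U \<in> B" "x \<in> U" "s \<in> Sec U" "s' \<in> Sec U" "e = gm x U s" "e' = gm x U s'"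
proof -
  obtain U s where U: "U \<in> B" "x \<in> U" "s \<in> Sec U" "e = gm x U s"
    using germ_rep[OF assms(1)] assms(3) by metis
  obtain V t where V: "V \<in> B" "V \<subseteq> U" "x \<in> V" "t \<in> Sec V" "e' = gm x V t"
    using germ_rep_subset[OF assms(2) U(1)] assms(4) U(2) by metis
  show thesis
    using that[of V "res U V s" t] U V germ_res[of U V x s] by (simp add: res_closed)
qed

text \<open>A single witness for two equalities of germs, as needed when both arguments of a sum
  change their representatives.\<close>

lemma germ_eq_common:
  assumes U: "U \<in> B" "x \<in> U" "s \<in> Sec U" "t \<in> Sec U" and V: "V \<in> B" "x \<in> V" "s' \<in> Sec V" "t' \<in> Sec V"
    and eq: "gm x U s = gm x V s'" "gm x U t = gm x V t'"
  obtains W where "W \<in> B" "x \<in> W" "W \<subseteq> U" "W \<subseteq> V" "res U W s = res V W s'" "res U W t = res V W t'"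
proof -
  obtain W where W: "W \<in> B" "x \<in> W" "W \<subseteq> U" "W \<subseteq> V" "res U W s = res V W s'"
    using eq(1) U V by (auto simp: germ_eq_iff)
  obtain W' where W': "W' \<in> B" "x \<in> W'" "W' \<subseteq> U" "W' \<subseteq> V" "res U W' t = res V W' t'"
    using eq(2) U V by (auto simp: germ_eq_iff)
  obtain A where A: "A \<in> B" "x \<in> A" "A \<subseteq> W" "A \<subseteq> W'"
    using basis_nbhd2 W W' by metis
  have "res U A s = res V A s'"
    using res_res[of U W A s] res_res[of V W A s'] U V W A by simp
  moreover have "res U A t = res V A t'"
    using res_res[of U W' A t] res_res[of V W' A t'] U V W' A by simp
  ultimately show thesis
    using that[of A] A W by blast
qed

section \<open>The module structure on the germs at a point\<close>

lemma germ_add: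
  assumes U: "U \<in> B" "x \<in> U" "s \<in> Sec U" "t \<in> Sec U"
  shows "gm x U s \<oplus>\<^bsub>GS x\<^esub> gm x U t = gm x U (s \<oplus>\<^bsub>ps_sect F U\<^esub> t)"
proof -
  \<comment> \<open>Uniqueness for the \<open>THE\<close> in the stalk addition: any other
    representing pair agrees with the given one on a common basis set, and restriction is
    additive.\<close>
  have "c = gm x U (s \<oplus>\<^bsub>ps_sect F U\<^esub> t)"
    if V: "V \<in> B" "s' \<in> Sec V" "t' \<in> Sec V" "x \<in> V" and eq: "gm x U s = gm x V s'" "gm x U t = gm x
        V t'"
      and c: "c = gm x V (s' \<oplus>\<^bsub>ps_sect F V\<^esub> t')" for c V s' t'
  proof -
    obtain W where W: "W \<in> B" "x \<in> W" "W \<subseteq> U" "W \<subseteq> V" "res U W s = res V W s'" "res U W t = res V W t'"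
      using germ_eq_common[OF U V(1,4,2,3) eq] .
    have add: "s \<oplus>\<^bsub>ps_sect F U\<^esub> t \<in> Sec U" "s' \<oplus>\<^bsub>ps_sect F V\<^esub> t' \<in> Sec V"
      using U V sect_module by (auto simp: left_module_def intro: abelian_groupE(1))
    have "res U W (s \<oplus>\<^bsub>ps_sect F U\<^esub> t) = res V W (s' \<oplus>\<^bsub>ps_sect F V\<^esub> t')"
      using linear_hom_add[OF res_linear[OF U(1) W(1,3)] U(3,4)]
        linear_hom_add[OF res_linear[OF V(1) W(1,4)] V(2,3)] W(5,6) by simp
    then show ?thesis
      using germ_res[OF U(1) W(1,3,2) add(1)] germ_res[OF V(1) W(1,4,2) add(2)] c by simp
  qed
  then show ?thesis
    unfolding germ_stalk_def ring_record_simps using U by (intro the_equality) blast+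
qed

lemma germ_smult:
  assumes U: "U \<in> B" "x \<in> U" "s \<in> Sec U" and a: "a \<in> carrier R"
  shows "a \<odot>\<^bsub>GS x\<^esub> gm x U s = gm x U (a \<odot>\<^bsub>ps_sect F U\<^esub> s)"
proof -
  have "c = gm x U (a \<odot>\<^bsub>ps_sect F U\<^esub> s)"
    if V: "V \<in> B" "s' \<in> Sec V" "x \<in> V" and eq: "gm x U s = gm x V s'"
      and c: "c = gm x V (a \<odot>\<^bsub>ps_sect F V\<^esub> s')" for c V s'
  proof -
    obtain W where W: "W \<in> B" "x \<in> W" "W \<subseteq> U" "W \<subseteq> V" "res U W s = res V W s'"
      using germ_eq_common[OF U(1,2,3,3) V(1,3,2,2) eq eq] .
    have smult: "a \<odot>\<^bsub>ps_sect F U\<^esub> s \<in> Sec U" "a \<odot>\<^bsub>ps_sect F V\<^esub> s' \<in> Sec V"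
      using U V a by (auto intro!: left_module.smult_closed sect_module)
    have "res U W (a \<odot>\<^bsub>ps_sect F U\<^esub> s) = res V W (a \<odot>\<^bsub>ps_sect F V\<^esub> s')"
      using linear_hom_smult[OF res_linear[OF U(1) W(1,3)] a U(3)]
        linear_hom_smult[OF res_linear[OF V(1) W(1,4)] a V(2)] W(5) by simp
    then show ?thesis
      using germ_res[OF U(1) W(1,3,2) smult(1)] germ_res[OF V(1) W(1,4,2) smult(2)] c by simp
  qed
  then show ?thesis
    unfolding germ_stalk_def module.simps using U by (intro the_equality) blast+
qed

lemma sect_zero: "U \<in> B \<Longrightarrow> \<zero>\<^bsub>ps_sect F U\<^esub> \<in> Sec U"
  using sect_module by (auto simp: left_module_def intro: abelian_groupE(2))

lemma germ_zero:
  assumes U: "U \<in> B" "x \<in> U"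
  shows "\<zero>\<^bsub>GS x\<^esub> = gm x U \<zero>\<^bsub>ps_sect F U\<^esub>"
proof -
  have "c = gm x U \<zero>\<^bsub>ps_sect F U\<^esub>" if V: "V \<in> B" "x \<in> V" and c: "c = gm x V \<zero>\<^bsub>ps_sect F V\<^esub>" for c V
  proof -
    obtain W where W: "W \<in> B" "x \<in> W" "W \<subseteq> U" "W \<subseteq> V"
      using basis_nbhd2 U V by metis
    have "res U W \<zero>\<^bsub>ps_sect F U\<^esub> = res V W \<zero>\<^bsub>ps_sect F V\<^esub>"
      using linear_hom_zero[OF res_linear[OF U(1) W(1,3)]] linear_hom_zero[OF res_linear[OF V(1)
          W(1,4)]]
        sect_module U V W by simp
    then show ?thesis
      using germ_res[OF U(1) W(1,3,2) sect_zero[OF U(1)]] germ_res[OF V(1) W(1,4,2) sect_zero[OF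
          V(1)]] c by simp
  qed
  then show ?thesis
    unfolding germ_stalk_def ring_record_simps using U by (intro the_equality) blast+
qed

text \<open>No axiom involves more than three germs. Represented over one basis set, they satisfy it
  because the sections over that set do.\<close>

lemma left_module_germ_stalk:
  assumes x: "x \<in> topspace X"
  shows "left_module R (GS x)"
proof -
  have closed: "gm x U s \<in> carrier (GS x)" if "U \<in> B" "x \<in> U" "s \<in> Sec U" for U s
    using that by (auto simp: germ_stalk_carrier)
  have rep: "\<exists>U s. U \<in> B \<and> x \<in> U \<and> s \<in> Sec U \<and> e = gm x U s" if "e \<in> carrier (GS x)" for e
    using that germ_rep[of e] unfolding germ_stalk_carrier by (metis (mono_tags, lifting)
        mem_Collect_eq)
  have rep2: "\<exists>U s t. U \<in> B \<and> x \<in> U \<and> s \<in> Sec U \<and> t \<in> Sec U \<and> e = gm x U s \<and> e' = gm x U t"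
    if "e \<in> carrier (GS x)" "e' \<in> carrier (GS x)" for e e'
    using germ_rep2[of e e' x] that unfolding germ_stalk_carrier by (metis (mono_tags, lifting)
        mem_Collect_eq)
  have rep3: "\<exists>U s t u. U \<in> B \<and> x \<in> U \<and> s \<in> Sec U \<and> t \<in> Sec U \<and> u \<in> Sec U \<and>
      e = gm x U s \<and> e' = gm x U t \<and> e'' = gm x U u"
    if e: "e \<in> carrier (GS x)" "e' \<in> carrier (GS x)" "e'' \<in> carrier (GS x)" for e e' e''
  proof -
    obtain U s t where U: "U \<in> B" "x \<in> U" "s \<in> Sec U" "t \<in> Sec U" "e = gm x U s" "e' = gm x U t"
      using rep2[OF e(1,2)] by metis
    obtain V u where V: "V \<in> B" "V \<subseteq> U" "x \<in> V" "u \<in> Sec V" "e'' = gm x V u"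
      using germ_rep_subset[of e'' U] U e(3) by (auto simp: germ_stalk_carrier)
    show ?thesis
      using U V germ_res[OF U(1) V(1,2,3)]
      by (intro exI[of _ V] exI[of _ "res U V s"] exI[of _ "res U V t"] exI[of _ u]) (simp add:
          res_closed)
  qed
  have grp: "abelian_group (ps_sect F U)" if "U \<in> B" for U
    using sect_module[OF that] by (simp add: left_module_def)
  note group = abelian_groupE[OF grp]
  note module = left_module.smult_closed[OF sect_module]
    left_module.smult_l_distr[OF sect_module]
    left_module.smult_r_distr[OF sect_module] left_module.smult_assoc[OF sect_module]
    left_module.smult_one[OF sect_module]
  interpret R: ring R by (fact R_ring)
  show ?thesis
  proof (rule left_moduleI[OF R_ring])
    obtain U where U: "U \<in> B" "x \<in> U"
      using basis_nbhd[OF openin_topspace x] by metis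
    then show "\<zero>\<^bsub>GS x\<^esub> \<in> carrier (GS x)"
      by (simp add: germ_zero[OF U] closed sect_zero)
  next
    fix e assume "e \<in> carrier (GS x)"
    then obtain U s where U: "U \<in> B" "x \<in> U" "s \<in> Sec U" and e: "e = gm x U s"
      using rep by metis
    show "\<zero>\<^bsub>GS x\<^esub> \<oplus>\<^bsub>GS x\<^esub> e = e"
      using U by (simp add: e germ_zero[OF U(1,2)] germ_add sect_zero group(5))
    show "\<one>\<^bsub>R\<^esub> \<odot>\<^bsub>GS x\<^esub> e = e"
      using U by (simp add: e germ_smult module(5))
    obtain t where t: "t \<in> Sec U" "t \<oplus>\<^bsub>ps_sect F U\<^esub> s = \<zero>\<^bsub>ps_sect F U\<^esub>"
      using group(6)[OF U(1,3)] by blast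
    then show "\<exists>e'\<in>carrier (GS x). e' \<oplus>\<^bsub>GS x\<^esub> e = \<zero>\<^bsub>GS x\<^esub>"
      using U by (intro bexI[of _ "gm x U t"]) (simp_all add: e germ_add germ_zero[OF U(1,2)] closed)
    fix a assume a: "a \<in> carrier R"
    show "a \<odot>\<^bsub>GS x\<^esub> e \<in> carrier (GS x)"
      using U a by (simp add: e germ_smult closed module(1))
    fix b assume b: "b \<in> carrier R"
    show "(a \<oplus>\<^bsub>R\<^esub> b) \<odot>\<^bsub>GS x\<^esub> e = a \<odot>\<^bsub>GS x\<^esub> e \<oplus>\<^bsub>GS x\<^esub> b \<odot>\<^bsub>GS x\<^esub> e"
      using U a b by (simp add: e germ_smult germ_add module(1,2))
    show "(a \<otimes>\<^bsub>R\<^esub> b) \<odot>\<^bsub>GS x\<^esub> e = a \<odot>\<^bsub>GS x\<^esub> (b \<odot>\<^bsub>GS x\<^esub> e)"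
      using U a b by (simp add: e germ_smult module(1,4))
  next
    fix e e' assume "e \<in> carrier (GS x)" "e' \<in> carrier (GS x)"
    then obtain U s t where U: "U \<in> B" "x \<in> U" "s \<in> Sec U" "t \<in> Sec U" and e: "e = gm x U s" "e' =
        gm x U t"
      using rep2 by metis
    show "e \<oplus>\<^bsub>GS x\<^esub> e' \<in> carrier (GS x)"
      using U by (simp add: e germ_add closed group(1))
    show "e \<oplus>\<^bsub>GS x\<^esub> e' = e' \<oplus>\<^bsub>GS x\<^esub> e"
      using U group(4)[OF U(1,3,4)] by (simp add: e germ_add)
    fix a assume a: "a \<in> carrier R"
    show "a \<odot>\<^bsub>GS x\<^esub> (e \<oplus>\<^bsub>GS x\<^esub> e') = a \<odot>\<^bsub>GS x\<^esub> e \<oplus>\<^bsub>GS x\<^esub> a \<odot>\<^bsub>GS x\<^esub> e'"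
      using U a by (simp add: e germ_smult germ_add module(1,3) group(1))
  next
    fix e e' e'' assume "e \<in> carrier (GS x)" "e' \<in> carrier (GS x)" "e'' \<in> carrier (GS x)"
    then obtain U s t u where U: "U \<in> B" "x \<in> U" "s \<in> Sec U" "t \<in> Sec U" "u \<in> Sec U"
        and e: "e = gm x U s" "e' = gm x U t" "e'' = gm x U u"
      using rep3 by metis
    show "e \<oplus>\<^bsub>GS x\<^esub> e' \<oplus>\<^bsub>GS x\<^esub> e'' = e \<oplus>\<^bsub>GS x\<^esub> (e' \<oplus>\<^bsub>GS x\<^esub> e'')"
      using U by (simp add: e germ_add group(1,3))
  qed
qed

lemma germ_linear:
  assumes "U \<in> B" "x \<in> U"
  shows "linear_hom R (ps_sect F U) (GS x) (gm x U)"
  using assms by (auto simp: linear_hom_def germ_add germ_smult germ_stalk_carrier)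

section \<open>The topology on the space of germs\<close>

lemma germ_open_nbhd:
  assumes "openin GT Z" and U: "U \<in> B" "x \<in> U" "s \<in> Sec U" and "gm x U s \<in> Z"
  obtains W where "W \<in> B" "x \<in> W" "W \<subseteq> U" "\<And>y. y \<in> W \<Longrightarrow> gm y U s \<in> Z"
proof -
  have "generate_topology_on {(\<lambda>x. gm x U s) ` U |U s. U \<in> B \<and> s \<in> Sec U} Z"
    using assms(1) by (simp add: germ_topology_def openin_topology_generated_by_iff)
  \<comment> \<open>The topology is known only through its generators, hence an induction on how
    \<open>Z\<close> is generated. Intersections shrink to a common basis set; for a generator,
    equality of two germs at one point persists at all points of the witness
    \<open>W\<close>.\<close>
  then have "gm x U s \<in> Z \<longrightarrow> (\<exists>W\<in>B. x \<in> W \<and> W \<subseteq> U \<and> (\<forall>y\<in>W. gm y U s \<in> Z))"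
  proof induction
    case (Int Y Z)
    show ?case
    proof
      assume "gm x U s \<in> Y \<inter> Z"
      then obtain W W' where W: "W \<in> B" "x \<in> W" "W \<subseteq> U" "\<forall>y\<in>W. gm y U s \<in> Y"
          "W' \<in> B" "x \<in> W'" "\<forall>y\<in>W'. gm y U s \<in> Z"
        using Int.IH by blast
      show "\<exists>W\<in>B. x \<in> W \<and> W \<subseteq> U \<and> (\<forall>y\<in>W. gm y U s \<in> Y \<inter> Z)"
      proof -
        obtain A where "A \<in> B" "x \<in> A" "A \<subseteq> W" "A \<subseteq> W'"
          using basis_nbhd2 W by metis
        then show ?thesis
          using W by (intro bexI[of _ A]) auto
      qed
    qed
  next
    case (Basis Z)
    then obtain V t where V: "V \<in> B" "t \<in> Sec V" and Z: "Z = (\<lambda>x. gm x V t) ` V"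
      by blast
    show ?case
    proof
      assume "gm x U s \<in> Z"
      then obtain y where y: "y \<in> V" "gm x U s = gm y V t"
        using Z by blast
      obtain W where W: "W \<in> B" "x \<in> W" "W \<subseteq> U" "W \<subseteq> V" "res U W s = res V W t"
        using y(2) germ_eq_iff[OF U V(1) y(1) V(2)] by blast
      have "gm z U s = gm z V t" if "z \<in> W" for z
        using W that germ_eq_iff[OF U(1) _ U(3) V(1) _ V(2)] by blast
      then show "\<exists>W\<in>B. x \<in> W \<and> W \<subseteq> U \<and> (\<forall>y\<in>W. gm y U s \<in> Z)"
        using W Z by (intro bexI[of _ W]) auto
    qed
  next
    case (UN K)
    show ?case
    proof
      assume "gm x U s \<in> \<Union>K"
      then obtain Z where Z: "Z \<in> K" "gm x U s \<in> Z"
        by blast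
      then obtain W where "W \<in> B" "x \<in> W" "W \<subseteq> U" "\<forall>y\<in>W. gm y U s \<in> Z"
        using UN.IH by blast
      then show "\<exists>W\<in>B. x \<in> W \<and> W \<subseteq> U \<and> (\<forall>y\<in>W. gm y U s \<in> \<Union>K)"
        using Z(1) by blast
    qed
  qed simp
  then show thesis
    using assms(5) that by blast
qed

text \<open>The generators are germ sections over whole basis sets. A smaller open \<open>C\<close>
  is covered by basis sets, and restricting to these does not change germs.\<close>

lemma openin_germ_section:
  assumes U: "U \<in> B" "s \<in> Sec U" and C: "openin X C" "C \<subseteq> U"
  shows "openin GT ((\<lambda>x. gm x U s) ` C)"
proof (subst openin_subopen, rule ballI)
  fix e assume "e \<in> (\<lambda>x. gm x U s) ` C"
  then obtain x where "x \<in> C" and e: "e = gm x U s"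
    by blast
  then obtain W where W: "W \<in> B" "x \<in> W" "W \<subseteq> C"
    using C basis_nbhd by blast
  have eq: "(\<lambda>x. gm x W (res U W s)) ` W = (\<lambda>x. gm x U s) ` W"
    using W C U by (intro image_cong) (auto intro!: germ_res)
  have "openin GT ((\<lambda>x. gm x W (res U W s)) ` W)"
    unfolding germ_topology_def
    using W C U by (intro topology_generated_by_Basis) (auto intro!: res_closed)
  then show "\<exists>Z. openin GT Z \<and> e \<in> Z \<and> Z \<subseteq> (\<lambda>x. gm x U s) ` C"
    unfolding eq e using W by (intro exI[of _ "(\<lambda>x. gm x U s) ` W"]) auto
qed

lemma continuous_germ_section:
  assumes U: "U \<in> B" "s \<in> Sec U"
  shows "continuous_map (subtopology X U) GT (\<lambda>x. gm x U s)"
proof (rule continuous_map_pointwiseI)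
  fix x assume "x \<in> topspace (subtopology X U)"
  then have x: "x \<in> U" by simp
  then show "gm x U s \<in> topspace GT"
    using U by blast
  fix Z assume "openin GT Z" "gm x U s \<in> Z"
  then obtain W where "W \<in> B" "x \<in> W" "W \<subseteq> U" "\<And>y. y \<in> W \<Longrightarrow> gm y U s \<in> Z"
    using germ_open_nbhd U x by metis
  then show "\<exists>W. openin (subtopology X U) W \<and> x \<in> W \<and> (\<forall>y\<in>W. gm y U s \<in> Z)"
    using basis_openin U by (intro exI[of _ W]) (auto simp: openin_open_subtopology)
qed

text \<open>Germ sections over open sets are open and cover the space, so continuity may be tested
  along them, as in \<open>continuous_map_from_sections\<close>.\<close>

lemma continuous_map_from_germs:
  assumes "\<And>U s. U \<in> B \<Longrightarrow> s \<in> Sec U \<Longrightarrow> continuous_map (subtopology X U) Y (\<lambda>x. f (gm x U s))"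
  shows "continuous_map GT Y f"
proof (rule continuous_map_pointwiseI)
  fix e assume "e \<in> topspace GT"
  then obtain U s where U: "U \<in> B" "fst e \<in> U" "s \<in> Sec U" and e: "e = gm (fst e) U s"
    using germ_rep by metis
  have x: "fst e \<in> topspace (subtopology X U)"
    using U by auto
  show "f e \<in> topspace Y"
    using continuous_map_image_subset_topspace[OF assms[OF U(1,3)]] x e by force
  fix V assume "openin Y V" "f e \<in> V"
  then obtain A where "openin (subtopology X U) A" "fst e \<in> A" "\<forall>y\<in>A. f (gm y U s) \<in> V"
    using continuous_map_pointwiseD[OF assms[OF U(1,3)] x, of V] e by auto
  then show "\<exists>Z. openin GT Z \<and> e \<in> Z \<and> (\<forall>e\<in>Z. f e \<in> V)"
    using U e openin_germ_section[OF U(1,3), of A] basis_openin[OF U(1)]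
    by (intro exI[of _ "(\<lambda>x. gm x U s) ` A"]) (auto simp: openin_open_subtopology)
qed

section \<open>The group action on germs\<close>

lemma act_nbhd:
  assumes "g \<in> carrier G" "U \<in> B" "x \<in> U"
  obtains V where "V \<in> B" "act g x \<in> V" "V \<subseteq> act g ` U"
  using basis_nbhd[OF openin_act_image[OF basis_openin[OF assms(2)] assms(1)], of "act g x"]
      assms(3) by blast

lemma act_inv_image: "\<lbrakk>g \<in> carrier G; U \<in> B; V \<in> B; V \<subseteq> act g ` U\<rbrakk> \<Longrightarrow> act (inv g) ` V \<subseteq> U"
  using act_image_subset_iff[OF _ basis_subset basis_subset] by blast

text \<open>Well-definedness of the \<open>THE\<close> in \<open>germ_act\<close>. If
  \<open>W\<close> witnesses equality of two representatives, then on a basis set inside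
  \<open>V\<close>, \<open>V'\<close> and the translate of \<open>W\<close> both results are the
  translate of their common restriction to \<open>W\<close>.\<close>

lemma germ_act_germ:
  assumes g: "g \<in> carrier G" and U: "U \<in> B" "x \<in> U" "s \<in> Sec U"
    and V: "V \<in> B" "act g x \<in> V" "V \<subseteq> act g ` U"
  shows "germ_act G act B F g (gm x U s) = gm (act g x) V (ps_map F V U (inv g) s)"
proof -
  note inv = act_inv_image[OF g]
  have "e = gm (act g x) V (ps_map F V U (inv g) s)"
    if U': "U' \<in> B" "s' \<in> Sec U'" "x' \<in> U'" and V': "V' \<in> B" "act g x' \<in> V'" "V' \<subseteq> act g ` U'"
      and eq: "gm x U s = gm x' U' s'" and e: "e = gm (act g x') V' (ps_map F V' U' (inv g) s')"
    for e U' s' x' V'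
  proof -
    obtain W where W: "W \<in> B" "x \<in> W" "W \<subseteq> U" "W \<subseteq> U'" "res U W s = res U' W s'" and x': "x' = x"
      using eq germ_eq_iff[OF U U'(1,3,2)] by blast
    have "openin X (V \<inter> V' \<inter> act g ` W)"
      using V V' W g by (intro openin_Int basis_openin openin_act_image)
    moreover have "act g x \<in> V \<inter> V' \<inter> act g ` W"
      using V V' W x' by auto
    ultimately obtain A where A: "A \<in> B" "act g x \<in> A" "A \<subseteq> V \<inter> V' \<inter> act g ` W"
      using basis_nbhd by blast
    have "res V A (ps_map F V U (inv g) s) = ps_map F A U (inv g) s"
      using res_map[OF U(1) V(1) A(1) _ _ inv[OF U(1) V(1,3)] U(3)] A g by simp
    also have "\<dots> = ps_map F A W (inv g) (res U W s)"
      using map_res[OF U(1) A(1) W(1,3) _ inv[OF W(1) A(1)] U(3)] A g by simp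
    also have "\<dots> = ps_map F A W (inv g) (res U' W s')"
      using W by simp
    also have "\<dots> = ps_map F A U' (inv g) s'"
      using map_res[OF U'(1) A(1) W(1,4) _ inv[OF W(1) A(1)] U'(2)] A g by simp
    also have "\<dots> = res V' A (ps_map F V' U' (inv g) s')"
      using res_map[OF U'(1) V'(1) A(1) _ _ inv[OF U'(1) V'(1,3)] U'(2)] A g by simp
    finally have "gm (act g x) V (ps_map F V U (inv g) s) = gm (act g x) V' (ps_map F V' U' (inv g) s')"
      using A V V' U U' g x' inv by (subst germ_eq_iff) (auto intro!: map_closed)
    then show ?thesis
      using e x' by simp
  qed
  then have "(THE e'. \<exists>U'\<in>B. \<exists>s'\<in>Sec U'. \<exists>x'\<in>U'. \<exists>V'\<in>B. gm x U s = gm x' U' s' \<and> act g x' \<in> V' \<and>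
      V' \<subseteq> act g ` U' \<and> e' = gm (act g x') V' (ps_map F V' U' (inv g) s')) =
      gm (act g x) V (ps_map F V U (inv g) s)"
    using U V by (intro the_equality) blast+
  then show ?thesis
    using germ_in_topspace[OF U] by (simp add: germ_act_def)
qed

lemma germ_act_rep:
  assumes "e \<in> topspace GT" "g \<in> carrier G"
  obtains U s V where "U \<in> B" "fst e \<in> U" "s \<in> Sec U" "e = gm (fst e) U s"
    "V \<in> B" "act g (fst e) \<in> V" "V \<subseteq> act g ` U" "ps_map F V U (inv g) s \<in> Sec V"
    "germ_act G act B F g e = gm (act g (fst e)) V (ps_map F V U (inv g) s)"
proof -
  obtain U s where U: "U \<in> B" "fst e \<in> U" "s \<in> Sec U" "e = gm (fst e) U s"
    using germ_rep[OF assms(1)] .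
  obtain V where V: "V \<in> B" "act g (fst e) \<in> V" "V \<subseteq> act g ` U"
    using act_nbhd[OF assms(2) U(1,2)] .
  show thesis
    using that[OF U V] germ_act_germ[OF assms(2) U(1-3) V] U(4) map_closed[OF V(1) U(1) _
        act_inv_image U(3)]
      assms(2) U V by simp
qed

text \<open>Translates of basis sets need not lie in \<open>B\<close>, so acting by \<open>h\<close>
  and then by \<open>g\<close> shrinks the domain twice. The final \<open>W\<close> is also
  admissible for \<open>g \<otimes> h\<close> in one step, which lets functoriality compare the two
  results.\<close>

lemma group_action_germs: "group_action G (topspace GT) (germ_act G act B F)"
proof (rule group_actionI[OF group_axioms])
  fix e g assume g: "g \<in> carrier G" and e: "e \<in> topspace GT"
  show "germ_act G act B F g e \<in> topspace GT"
    by (rule germ_act_rep[OF e g]) auto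
  fix h assume h: "h \<in> carrier G"
  obtain U s V where U: "U \<in> B" "fst e \<in> U" "s \<in> Sec U" "e = gm (fst e) U s"
    and V: "V \<in> B" "act h (fst e) \<in> V" "V \<subseteq> act h ` U" "ps_map F V U (inv h) s \<in> Sec V"
    and eq: "germ_act G act B F h e = gm (act h (fst e)) V (ps_map F V U (inv h) s)"
    using germ_act_rep[OF e h] .
  obtain W where W: "W \<in> B" "act g (act h (fst e)) \<in> W" "W \<subseteq> act g ` V"
    using act_nbhd[OF g V(1,2)] .
  have gh: "act (g \<otimes> h) (fst e) = act g (act h (fst e))" "act (g \<otimes> h) ` U = act g ` act h ` U"
    using g h U by (auto simp: act_mult image_image intro!: image_cong)
  have "W \<subseteq> act (g \<otimes> h) ` U"
    using order_trans[OF W(3) image_mono[OF V(3)]] gh(2) by simp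
  then have "germ_act G act B F (g \<otimes> h) e = gm (act g (act h (fst e))) W (ps_map F W U (inv (g \<otimes> h)) s)"
    using germ_act_germ[OF _ U(1-3), of "g \<otimes> h" W] W(1,2) g h U(4) gh by simp
  also have "ps_map F W U (inv (g \<otimes> h)) s = ps_map F W V (inv g) (ps_map F V U (inv h) s)"
    using map_comp[OF W(1) V(1) U(1), of "inv g" "inv h" s] act_inv_image U V W g h by (simp add:
        inv_mult_group)
  also have "gm (act g (act h (fst e))) W \<dots> = germ_act G act B F g (germ_act G act B F h e)"
    using germ_act_germ[OF g V(1,2,4) W] eq by simp
  finally show "germ_act G act B F (g \<otimes> h) e = germ_act G act B F g (germ_act G act B F h e)" .
next
  fix e assume "e \<in> topspace GT"
  then obtain U s where U: "U \<in> B" "fst e \<in> U" "s \<in> Sec U" "e = gm (fst e) U s"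
    using germ_rep by metis
  have x: "fst e \<in> topspace X"
    using U by blast
  show "germ_act G act B F \<one> e = e"
    using germ_act_germ[OF one_closed U(1-3) U(1)] U x by (simp add: act_one_image map_id)
qed (simp add: germ_act_def)

text \<open>Let \<open>?t\<close> be the translate of \<open>s\<close> by \<open>g\<close>. An open
  neighbourhood \<open>N\<close> of the identity fixes \<open>?t\<close>, so every
  \<open>k = n \<otimes> g\<close> with \<open>n\<close> in \<open>N\<close> translates
  \<open>s\<close> to the same \<open>?t\<close>, and the result depends on \<open>k\<close> only
  through the base point.\<close>

lemma continuous_germ_act:
  "continuous_map (prod_topology T GT) GT (\<lambda>(g, e). germ_act G act B F g e)"
proof (rule continuous_map_pointwiseI)
  fix z assume "z \<in> topspace (prod_topology T GT)"
  then obtain g e where z: "z = (g, e)" and g: "g \<in> carrier G" and e: "e \<in> topspace GT"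
    by (cases z) auto
  obtain U s V where U: "U \<in> B" "fst e \<in> U" "s \<in> Sec U" "e = gm (fst e) U s"
    and V: "V \<in> B" "act g (fst e) \<in> V" "V \<subseteq> act g ` U" "ps_map F V U (inv g) s \<in> Sec V"
    and eq: "germ_act G act B F g e = gm (act g (fst e)) V (ps_map F V U (inv g) s)"
    using germ_act_rep[OF e g] .
  then show "(\<lambda>(g, e). germ_act G act B F g e) z \<in> topspace GT"
    by (auto simp: z)
  fix Z assume Z: "openin GT Z" "(\<lambda>(g, e). germ_act G act B F g e) z \<in> Z"
  have "gm (act g (fst e)) V (ps_map F V U (inv g) s) \<in> Z"
    using Z(2) eq by (simp add: z)
  then obtain V' where V': "V' \<in> B" "act g (fst e) \<in> V'" "V' \<subseteq> V"
    "\<And>y. y \<in> V' \<Longrightarrow> gm y V (ps_map F V U (inv g) s) \<in> Z"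
    using germ_open_nbhd[OF Z(1) V(1,2,4)] by metis
  let ?t = "ps_map F V' U (inv g) s"
  have V'U: "V' \<subseteq> act g ` U"
    using V'(3) V(3) by simp
  have t: "?t \<in> Sec V'"
    using map_closed[OF V'(1) U(1) _ act_inv_image[OF g U(1) V'(1) V'U] U(3)] g by simp
  have "res V V' (ps_map F V U (inv g) s) = ?t"
    using res_map[OF U(1) V(1) V'(1,3) _ act_inv_image[OF g U(1) V(1,3)] U(3)] g by simp
  then have inZ: "gm y V' ?t \<in> Z" if "y \<in> V'" for y
    using germ_res[OF V(1) V'(1,3) that V(4)] V'(4) that by simp
  obtain N where N: "openin T N" "\<one> \<in> N" "N \<subseteq> set_stabilizer G act V'"
    "\<And>h. h \<in> N \<Longrightarrow> ps_map F V' V' (inv h) ?t = ?t"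
    using stabilizer_nbhd[OF V'(1) t] by metis
  \<comment> \<open>\<open>?A\<close> is the right translate of \<open>N\<close> by
    \<open>g\<close>, and \<open>?C\<close> is the part of \<open>U\<close> that \<open>g\<close>
    carries into \<open>V'\<close>.\<close>
  let ?A = "{k \<in> carrier G. k \<otimes> inv g \<in> N}" and ?C = "U \<inter> act (inv g) ` V'"
  have C: "openin X ?C" "?C \<subseteq> U"
    using U V' g by (auto intro!: openin_Int basis_openin[OF U(1)] openin_act_image[OF
        basis_openin[OF V'(1)]])
  have "openin (prod_topology T GT) (?A \<times> (\<lambda>y. gm y U s) ` ?C)"
    using N(1) g openin_germ_section[OF U(1,3) C] by (auto simp: openin_prod_Times_iff
        openin_right_translate)
  moreover have "z \<in> ?A \<times> (\<lambda>y. gm y U s) ` ?C"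
  proof -
    have "fst e \<in> topspace X"
      using U by blast
    then have "fst e = act (inv g) (act g (fst e))"
      using g by simp
    then have "fst e \<in> ?C"
      using U(2) V'(2) by blast
    moreover have "g \<in> ?A"
      using g N(2) by simp
    ultimately show ?thesis
      using U(4) z by blast
  qed
  moreover have "\<forall>w\<in>?A \<times> (\<lambda>y. gm y U s) ` ?C. (\<lambda>(g, e). germ_act G act B F g e) w \<in> Z"
  proof
    fix w assume "w \<in> ?A \<times> (\<lambda>y. gm y U s) ` ?C"
    then obtain k y where w: "w = (k, gm y U s)" and k: "k \<in> carrier G" "k \<otimes> inv g \<in> N"
      and y: "y \<in> U" "y \<in> act (inv g) ` V'"
      by blast
    let ?n = "k \<otimes> inv g"
    have n: "?n \<in> carrier G" "inv ?n \<in> carrier G" "act ?n ` V' = V'" "act (inv ?n) ` V' = V'"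
      using N(3) k(2) set_stabilizer_mem[OF V'(1), of ?n] set_stabilizer_mem(1)[OF V'(1), of "inv
          ?n"] by auto
    have kn: "k = ?n \<otimes> g" "inv k = inv g \<otimes> inv ?n"
      using k g by (simp_all add: m_assoc inv_mult_group) (simp add: m_assoc[symmetric])
    have "act g y \<in> V'"
      using y(2) g V'(1) by auto
    then have "act ?n (act g y) \<in> V'"
      using n(3) by blast
    moreover have yX: "y \<in> topspace X"
      using y(1) U(1) by blast
    ultimately have ky: "act k y \<in> V'"
      using act_mult[OF n(1) g yX] kn(1) by simp
    have "act k ` U = act ?n ` act g ` U"
    proof -
      have "act k u = act ?n (act g u)" if "u \<in> U" for u
        using act_mult[OF n(1) g, of u] that U(1) kn(1) by auto
      then show ?thesis
        by (simp add: image_image)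
    qed
    then have kU: "V' \<subseteq> act k ` U"
      using V'U n(3) by (metis image_mono)
    have "ps_map F V' U (inv k) s = ps_map F V' V' (inv ?n) ?t"
      using map_comp[OF V'(1,1) U(1) n(2), of "inv g" s] n(4) act_inv_image[OF g U(1) V'(1) V'U] g U(3)
      unfolding kn(2)[symmetric] by simp
    also have "\<dots> = ?t"
      using N(4)[OF k(2)] .
    finally have "germ_act G act B F k (gm y U s) = gm (act k y) V' ?t"
      using germ_act_germ[OF k(1) U(1) y(1) U(3) V'(1) ky kU] by simp
    then show "(\<lambda>(g, e). germ_act G act B F g e) w \<in> Z"
      using inZ[OF ky] w by simp
  qed
  ultimately show "\<exists>W. openin (prod_topology T GT) W \<and> z \<in> W \<and> (\<forall>w\<in>W. (\<lambda>(g, e). germ_act G act B F g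
      e) w \<in> Z)"
    by blast
qed

section \<open>The sheaf axioms for the sheafification\<close>

lemma local_homeomorphism_germs: "local_homeomorphism GT X fst"
  unfolding local_homeomorphism_def
proof
  show fst: "continuous_map GT X fst"
    by (rule continuous_map_from_germs) (simp add: continuous_map_from_subtopology)
  show "\<forall>e\<in>topspace GT. \<exists>W V. openin GT W \<and> e \<in> W \<and> openin X V \<and>
      homeomorphic_map (subtopology GT W) (subtopology X V) fst"
  proof
    fix e assume "e \<in> topspace GT"
    then obtain U s where U: "U \<in> B" "fst e \<in> U" "s \<in> Sec U" "e = gm (fst e) U s"
      using germ_rep by metis
    let ?W = "(\<lambda>x. gm x U s) ` U"
    have W: "openin GT ?W" "openin X U"
      using openin_germ_section[OF U(1,3)] basis_openin[OF U(1)] by auto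
    have "homeomorphic_maps (subtopology GT ?W) (subtopology X U) fst (\<lambda>x. gm x U s)"
      using fst continuous_germ_section[OF U(1,3)]
      by (auto simp: homeomorphic_maps_def continuous_map_in_subtopology
          continuous_map_from_subtopology)
    then show "\<exists>W V. openin GT W \<and> e \<in> W \<and> openin X V \<and>
        homeomorphic_map (subtopology GT W) (subtopology X V) fst"
      using W U homeomorphic_map_maps by blast
  qed
qed

lemma continuous_germ_minus:
  "continuous_map (subtopology (prod_topology GT GT) {(a, b). fst a = fst b}) GT (\<lambda>(a, b). a \<ominus>\<^bsub>GS
      (fst a)\<^esub> b)"
proof (rule continuous_map_pointwiseI)
  fix z assume "z \<in> topspace (subtopology (prod_topology GT GT) {(a, b). fst a = fst b})"
  then obtain a b where z: "z = (a, b)" and ab: "a \<in> topspace GT" "b \<in> topspace GT" "fst a = fst b"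
    by (cases z) auto
  obtain U s t where U: "U \<in> B" "fst a \<in> U" "s \<in> Sec U" "t \<in> Sec U" "a = gm (fst a) U s" "b = gm
      (fst a) U t"
    using germ_rep2[of a b "fst a"] ab by metis
  let ?d = "s \<ominus>\<^bsub>ps_sect F U\<^esub> t"
  have d: "?d \<in> Sec U"
    using sect_module[OF U(1)] U(3,4) by (auto simp: left_module_def intro: abelian_group.minus_closed)
  have minus: "gm x U s \<ominus>\<^bsub>GS x\<^esub> gm x U t = gm x U ?d" if "x \<in> U" for x
    using linear_hom_minus[OF germ_linear[OF U(1) that] sect_module[OF U(1)] left_module_germ_stalk
        U(3,4)] that U(1) by auto
  have zd: "(\<lambda>(a, b). a \<ominus>\<^bsub>GS (fst a)\<^esub> b) z = gm (fst a) U ?d"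
    using minus[OF U(2)] U(5,6) z by simp
  then show "(\<lambda>(a, b). a \<ominus>\<^bsub>GS (fst a)\<^esub> b) z \<in> topspace GT"
    using U d by auto
  fix Z assume "openin GT Z" "(\<lambda>(a, b). a \<ominus>\<^bsub>GS (fst a)\<^esub> b) z \<in> Z"
  then obtain W where W: "W \<in> B" "fst a \<in> W" "W \<subseteq> U" "\<And>y. y \<in> W \<Longrightarrow> gm y U ?d \<in> Z"
    using germ_open_nbhd[of Z U "fst a" ?d] U d zd by auto
  \<comment> \<open>On the fibre product a pair from these two sheets consists of the germs of
    \<open>s\<close> and \<open>t\<close> at the same point of \<open>W\<close>, since
    \<open>fst\<close> reads off the base point. Its difference is thus the germ of
    \<open>?d\<close> there.\<close>
  let ?P = "((\<lambda>x. gm x U s) ` W) \<times> ((\<lambda>x. gm x U t) ` W)"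
  have "openin (prod_topology GT GT) ?P"
    using openin_germ_section[OF U(1) _ basis_openin[OF W(1)] W(3)] U by (simp add:
        openin_prod_Times_iff)
  then have "openin (subtopology (prod_topology GT GT) {(a, b). fst a = fst b}) (?P \<inter> {(a, b). fst a
      = fst b})"
    by (auto simp: openin_subtopology)
  moreover have "z \<in> ?P \<inter> {(a, b). fst a = fst b}"
    using z ab(3) U(5,6) W(2) by blast
  moreover have "\<forall>w\<in>?P \<inter> {(a, b). fst a = fst b}. (\<lambda>(a, b). a \<ominus>\<^bsub>GS (fst a)\<^esub> b) w \<in> Z"
    using W(3,4) minus by auto
  ultimately show "\<exists>Q. openin (subtopology (prod_topology GT GT) {(a, b). fst a = fst b}) Q \<and> z \<in> Q \<and>
      (\<forall>w\<in>Q. (\<lambda>(a, b). a \<ominus>\<^bsub>GS (fst a)\<^esub> b) w \<in> Z)"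
    by blast
qed

lemma continuous_germ_smult:
  assumes "a \<in> carrier R"
  shows "continuous_map GT GT (\<lambda>e. a \<odot>\<^bsub>GS (fst e)\<^esub> e)"
proof (rule continuous_map_from_germs)
  fix U s assume U: "U \<in> B" "s \<in> Sec U"
  have "a \<odot>\<^bsub>ps_sect F U\<^esub> s \<in> Sec U"
    using left_module.smult_closed[OF sect_module[OF U(1)] assms U(2)] .
  then have "continuous_map (subtopology X U) GT (\<lambda>x. gm x U (a \<odot>\<^bsub>ps_sect F U\<^esub> s))"
    by (rule continuous_germ_section[OF U(1)])
  then show "continuous_map (subtopology X U) GT (\<lambda>x. a \<odot>\<^bsub>GS (fst (gm x U s))\<^esub> gm x U s)"
    by (rule continuous_map_eq) (use U assms in \<open>simp add: germ_smult\<close>)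
qed

lemma germ_act_linear:
  assumes g: "g \<in> carrier G" and x: "x \<in> topspace X"
  shows "linear_hom R (GS x) (GS (act g x)) (germ_act G act B F g)"
  unfolding linear_hom_def
proof (intro conjI ballI funcsetI)
  fix e assume e: "e \<in> carrier (GS x)"
  then have e': "e \<in> topspace GT" "fst e = x"
    by (auto simp: germ_stalk_carrier)
  show "germ_act G act B F g e \<in> carrier (GS (act g x))"
    by (rule germ_act_rep[OF e'(1) g]) (use e'(2) in \<open>auto simp: germ_stalk_carrier\<close>)
  have lin: "linear_hom R (ps_sect F U) (ps_sect F V) (ps_map F V U (inv g))"
    if "U \<in> B" "V \<in> B" "V \<subseteq> act g ` U" for U V
    using that g by (intro map_linear act_inv_image) auto
  have mod: "left_module R (ps_sect F U)" "abelian_group (ps_sect F U)" if "U \<in> B" for U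
    using sect_module[OF that] by (auto simp: left_module_def)
  show "germ_act G act B F g (a \<odot>\<^bsub>GS x\<^esub> e) = a \<odot>\<^bsub>GS (act g x)\<^esub> germ_act G act B F g e"
    if a: "a \<in> carrier R" for a
  proof -
    obtain U s where U: "U \<in> B" "x \<in> U" "s \<in> Sec U" "e = gm x U s"
      using germ_rep[OF e'(1)] e'(2) by metis
    obtain V where V: "V \<in> B" "act g x \<in> V" "V \<subseteq> act g ` U"
      using act_nbhd[OF g U(1,2)] .
    show ?thesis
      using U V a germ_act_germ[OF g U(1,2) _ V] linear_hom_smult[OF lin[OF U(1) V(1,3)] a U(3)]
        linear_hom_closed[OF lin[OF U(1) V(1,3)]]
      by (simp add: germ_smult left_module.smult_closed[OF mod(1)])
  qed
  fix f assume f: "f \<in> carrier (GS x)"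
  obtain U s t where U: "U \<in> B" "x \<in> U" "s \<in> Sec U" "t \<in> Sec U" "e = gm x U s" "f = gm x U t"
    using germ_rep2[of e f x] e f by (auto simp: germ_stalk_carrier)
  obtain V where V: "V \<in> B" "act g x \<in> V" "V \<subseteq> act g ` U"
    using act_nbhd[OF g U(1,2)] .
  show "germ_act G act B F g (e \<oplus>\<^bsub>GS x\<^esub> f) =
      germ_act G act B F g e \<oplus>\<^bsub>GS (act g x)\<^esub> germ_act G act B F g f"
    using U V germ_act_germ[OF g U(1,2) _ V] linear_hom_add[OF lin[OF U(1) V(1,3)] U(3,4)]
      linear_hom_closed[OF lin[OF U(1) V(1,3)]]
    by (simp add: germ_add abelian_groupE(1)[OF mod(2)])
qed

lemma sheafify_simps:
  "sh_space (sheafify G act B F) = GT" "sh_proj (sheafify G act B F) = fst"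
  "sh_act (sheafify G act B F) = germ_act G act B F" "sh_stalk (sheafify G act B F) = GS"
  by (simp_all add: sheafify_def)

lemma is_gsheaf_sheafify: "is_gsheaf G T R X act (sheafify G act B F)"
  unfolding is_gsheaf_def sheafify_simps continuous_action_def
proof (intro conjI ballI)
  show "fst (germ_act G act B F g e) = act g (fst e)" if "g \<in> carrier G" "e \<in> topspace GT" for g e
    by (rule germ_act_rep[OF that(2,1)]) simp
qed (simp_all add: group_action_germs continuous_germ_act local_homeomorphism_germs
    left_module_germ_stalk
    germ_stalk_carrier continuous_germ_minus continuous_germ_smult germ_act_linear)

end

section \<open>Morphisms of sheafifications\<close>

lemma linear_hom_compose:
  "linear_hom R M N f \<Longrightarrow> linear_hom R N P k \<Longrightarrow> linear_hom R M P (k \<circ> f)"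
  by (auto simp: linear_hom_def Pi_iff)

lemma linear_hom_cong:
  assumes M: "left_module R M" and f: "linear_hom R M N f" and eq: "\<And>x. x \<in> carrier M \<Longrightarrow> f x = k x"
  shows "linear_hom R M N k"
proof -
  have "abelian_group M"
    using M by (simp add: left_module_def)
  note closed = abelian_groupE(1)[OF this] left_module.smult_closed[OF M]
  show ?thesis
    using linear_hom_closed[OF f] linear_hom_add[OF f] linear_hom_smult[OF f] closed
    by (auto simp: linear_hom_def simp flip: eq)
qed

lemma gsheaf_morphism_compose:
  assumes f: "gsheaf_morphism G R X D E f" and k: "gsheaf_morphism G R X E E' k"
  shows "gsheaf_morphism G R X D E' (k \<circ> f)"
proof -
  have "f d \<in> topspace (sh_space E)" if "d \<in> topspace (sh_space D)" for d
    using f that by (auto simp: gsheaf_morphism_def continuous_map_def)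
  then show ?thesis
    using assms by (auto simp: gsheaf_morphism_def intro: continuous_map_compose linear_hom_compose)
qed

text \<open>Functions are total, so a morphism matters only through its values on the sheaf space.
  This permits passing to the extensional representative in the universal property.\<close>

lemma gsheaf_morphism_cong:
  assumes D: "is_gsheaf G T R X act D"
    and f: "gsheaf_morphism G R X D E f" and eq: "\<And>d. d \<in> topspace (sh_space D) \<Longrightarrow> f d = k d"
  shows "gsheaf_morphism G R X D E k"
proof -
  have act: "sh_act D g d \<in> topspace (sh_space D)" if "g \<in> carrier G" "d \<in> topspace (sh_space D)"
      for g d
    using D that group_action.element_image[of G "topspace (sh_space D)" "sh_act D"]
    by (auto simp: is_gsheaf_def continuous_action_def)
  have lin: "linear_hom R (sh_stalk D x) (sh_stalk E x) k" if x: "x \<in> topspace X" for x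
  proof -
    have m: "left_module R (sh_stalk D x)" and c: "carrier (sh_stalk D x) \<subseteq> topspace (sh_space D)"
      using D x by (auto simp: is_gsheaf_def)
    have "linear_hom R (sh_stalk D x) (sh_stalk E x) f"
      using f x by (simp add: gsheaf_morphism_def)
    then show ?thesis
      by (rule linear_hom_cong[OF m]) (use c eq in auto)
  qed
  show ?thesis
    using f eq act lin continuous_map_eq[of "sh_space D" "sh_space E" f k] by (simp add:
        gsheaf_morphism_def)
qed

context clopen_gspace
begin

text \<open>Naturality at the arrows given by the identity element, that is, compatibility with
  restriction, makes the value independent of the representative.\<close>

lemma sheafify_map_germ:
  assumes "is_gpresheaf G T R act B F" "is_gpresheaf G T R act B F'"
    and linear: "\<And>U. U \<in> B \<Longrightarrow> linear_hom R (ps_sect F U) (ps_sect F' U) (\<alpha> U)"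
    and natural: "\<And>U V g s. \<lbrakk>U \<in> B; V \<in> B; g \<in> carrier G; act g ` U \<subseteq> V; s \<in> carrier (ps_sect F V)\<rbrakk> \<Longrightarrow>
      \<alpha> U (ps_map F U V g s) = ps_map F' U V g (\<alpha> V s)"
    and U: "U \<in> B" "x \<in> U" "s \<in> carrier (ps_sect F U)"
  shows "sheafify_map G B F F' \<alpha> (germ G B F x U s) = germ G B F' x U (\<alpha> U s)"
proof -
  interpret F: equivariant_presheaf G T R X act B F
    by unfold_locales (fact assms)
  interpret F': equivariant_presheaf G T R X act B F'
    by unfold_locales (fact assms)
  note closed = linear_hom_closed[OF linear]
  have "germ G B F' x' V (\<alpha> V t) = germ G B F' x U (\<alpha> U s)"
    if V: "V \<in> B" "x' \<in> V" "t \<in> F.Sec V" and eq: "germ G B F x U s = germ G B F x' V t" for x' V t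
  proof -
    obtain W where W: "W \<in> B" "x \<in> W" "W \<subseteq> U" "W \<subseteq> V" "F.res U W s = F.res V W t" and x: "x = x'"
      using eq F.germ_eq_iff[OF U V] by blast
    have "F'.res U W (\<alpha> U s) = \<alpha> W (F.res U W s)"
      using natural[OF W(1) U(1) one_closed _ U(3)] W by (simp add: F.act_one_image)
    also have "\<dots> = F'.res V W (\<alpha> V t)"
      using natural[OF W(1) V(1) one_closed _ V(3)] W by (simp add: F.act_one_image)
    finally show ?thesis
      using F'.germ_eq_iff[OF U(1,2) closed[OF U(1,3)] V(1,2) closed[OF V(1,3)]] W x by auto
  qed
  then show ?thesis
    unfolding sheafify_map_def using U by (intro the_equality) blast+
qed

lemma sheafify_map_morphism:
  assumes F: "is_gpresheaf G T R act B F" and F': "is_gpresheaf G T R act B F'"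
    and linear: "\<And>U. U \<in> B \<Longrightarrow> linear_hom R (ps_sect F U) (ps_sect F' U) (\<alpha> U)"
    and natural: "\<And>U V g s. \<lbrakk>U \<in> B; V \<in> B; g \<in> carrier G; act g ` U \<subseteq> V; s \<in> carrier (ps_sect F V)\<rbrakk> \<Longrightarrow>
      \<alpha> U (ps_map F U V g s) = ps_map F' U V g (\<alpha> V s)"
  shows "gsheaf_morphism G R X (sheafify G act B F) (sheafify G act B F') (sheafify_map G B F F' \<alpha>)"
proof -
  interpret F: equivariant_presheaf G T R X act B F
    by unfold_locales (fact assms)
  interpret F': equivariant_presheaf G T R X act B F'
    by unfold_locales (fact assms)
  let ?f = "sheafify_map G B F F' \<alpha>"
  note closed = linear_hom_closed[OF linear]
  have map: "?f (F.gm x U s) = F'.gm x U (\<alpha> U s)" if "U \<in> B" "x \<in> U" "s \<in> F.Sec U" for x U s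
    by (rule sheafify_map_germ[OF F F' linear natural that])
  show ?thesis
    unfolding gsheaf_morphism_def F.sheafify_simps F'.sheafify_simps
  proof (intro conjI ballI)
    show "continuous_map F.GT F'.GT ?f"
    proof (rule F.continuous_map_from_germs)
      fix U s assume U: "U \<in> B" "s \<in> F.Sec U"
      have "continuous_map (subtopology X U) F'.GT (\<lambda>x. F'.gm x U (\<alpha> U s))"
        by (rule F'.continuous_germ_section[OF U(1) closed[OF U]])
      then show "continuous_map (subtopology X U) F'.GT (\<lambda>x. ?f (F.gm x U s))"
        by (rule continuous_map_eq) (use U map in auto)
    qed
    fix e assume e: "e \<in> topspace F.GT"
    obtain U s where "U \<in> B" "fst e \<in> U" "s \<in> F.Sec U" "e = F.gm (fst e) U s"
      using F.germ_rep[OF e] .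
    then show "fst (?f e) = fst e"
      using map F'.fst_germ by metis
    fix g assume g: "g \<in> carrier G"
    obtain U s V where U: "U \<in> B" "fst e \<in> U" "s \<in> F.Sec U" "e = F.gm (fst e) U s"
      and V: "V \<in> B" "act g (fst e) \<in> V" "V \<subseteq> act g ` U" "ps_map F V U (inv g) s \<in> F.Sec V"
      and eq: "germ_act G act B F g e = F.gm (act g (fst e)) V (ps_map F V U (inv g) s)"
      using F.germ_act_rep[OF e g] .
    have "?f (germ_act G act B F g e) = F'.gm (act g (fst e)) V (\<alpha> V (ps_map F V U (inv g) s))"
      using map[OF V(1,2,4)] eq by simp
    \<comment> \<open>Naturality at the arrow \<open>inv g\<close> from \<open>V\<close> to
      \<open>U\<close> is what yields equivariance.\<close>
    also have "\<alpha> V (ps_map F V U (inv g) s) = ps_map F' V U (inv g) (\<alpha> U s)"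
      using natural[OF V(1) U(1) inv_closed[OF g] F.act_inv_image[OF g U(1) V(1,3)] U(3)] .
    also have "F'.gm (act g (fst e)) V \<dots> = germ_act G act B F' g (F'.gm (fst e) U (\<alpha> U s))"
      using F'.germ_act_germ[OF g U(1,2) closed[OF U(1,3)] V(1-3)] by simp
    also have "F'.gm (fst e) U (\<alpha> U s) = ?f e"
      using map[OF U(1-3)] U(4) by simp
    finally show "?f (germ_act G act B F g e) = germ_act G act B F' g (?f e)" .
  next
    fix x assume x: "x \<in> topspace X"
    show "linear_hom R (F.GS x) (F'.GS x) ?f"
      unfolding linear_hom_def
    proof (intro conjI ballI funcsetI)
      fix e assume e: "e \<in> carrier (F.GS x)"
      then obtain U s where U: "U \<in> B" "x \<in> U" "s \<in> F.Sec U" "e = F.gm x U s"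
        using F.germ_rep[of e] unfolding F.germ_stalk_carrier by (metis (mono_tags, lifting)
            mem_Collect_eq)
      show "?f e \<in> carrier (F'.GS x)"
        using U closed by (auto simp: map F'.germ_stalk_carrier)
      show "?f (a \<odot>\<^bsub>F.GS x\<^esub> e) = a \<odot>\<^bsub>F'.GS x\<^esub> ?f e" if a: "a \<in> carrier R" for a
        using U a left_module.smult_closed[OF F.sect_module[OF U(1)] a U(3)]
        by (simp add: map F.germ_smult F'.germ_smult closed linear_hom_smult[OF linear])
      fix e' assume e': "e' \<in> carrier (F.GS x)"
      obtain U s t where U: "U \<in> B" "x \<in> U" "s \<in> F.Sec U" "t \<in> F.Sec U" "e = F.gm x U s" "e' = F.gm
          x U t"
        using F.germ_rep2[of e e' x] e e' unfolding F.germ_stalk_carrier by (metis (mono_tags,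
            lifting) mem_Collect_eq)
      have "s \<oplus>\<^bsub>ps_sect F U\<^esub> t \<in> F.Sec U"
        using F.sect_module[OF U(1)] U(3,4) by (auto simp: left_module_def intro: abelian_groupE(1))
      then show "?f (e \<oplus>\<^bsub>F.GS x\<^esub> e') = ?f e \<oplus>\<^bsub>F'.GS x\<^esub> ?f e'"
        using U by (simp add: map F.germ_add F'.germ_add closed linear_hom_add[OF linear])
    qed
  qed
qed

end

section \<open>Evaluation of germs of sections\<close>

context equivariant_sheaf
begin

abbreviation P :: "('g, 'x, 'r, 'x \<Rightarrow> 'e) gpresheaf" where "P \<equiv> underlying_presheaf G X act E"

lemma germ_eval_germ:
  assumes U: "U \<in> B" "x \<in> U" "s \<in> sec U"
  shows "germ_eval G X act B E (germ G B P x U s) = s x"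
proof -
  have "s' x' = s x" if V: "V \<in> B" "x' \<in> V" "s' \<in> sec V" and eq: "germ G B P x U s = germ G B P x' V
      s'" for V s' x'
  proof -
    have sP: "s \<in> underlying.Sec U" "s' \<in> underlying.Sec V"
      using U(3) V(3) by (simp_all add: underlying_presheaf_simps)
    obtain W where W: "x \<in> W" "W \<subseteq> U" "W \<subseteq> V" "ps_map P W U \<one> s = ps_map P W V \<one> s'" and x: "x = x'"
      using eq underlying.germ_eq_iff[OF U(1,2) sP(1) V(1,2) sP(2)] by metis
    have "ps_map P W U \<one> s x = ps_map P W V \<one> s' x"
      using W(4) by simp
    then show ?thesis
      using U V W(1) x by (simp add: underlying_presheaf_simps sec_mem)
  qed
  then show ?thesis
    unfolding germ_eval_def using U by (intro the_equality) blast+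
qed

lemma germ_eval_morphism:
  "gsheaf_morphism G R X (sheafify G act B P) E (germ_eval G X act B E)"
proof -
  let ?f = "germ_eval G X act B E"
  have rep: "\<exists>U s. U \<in> B \<and> fst e \<in> U \<and> s \<in> sec U \<and> e = germ G B P (fst e) U s" if "e \<in> topspace
      underlying.GT" for e
    using underlying.germ_rep[OF that] unfolding underlying_presheaf_simps(1) by metis
  show ?thesis
    unfolding gsheaf_morphism_def underlying.sheafify_simps
  proof (intro conjI ballI)
    show "continuous_map underlying.GT S ?f"
    proof (rule underlying.continuous_map_from_germs)
      fix U s assume U: "U \<in> B" "s \<in> underlying.Sec U"
      then have s: "s \<in> sec U"
        by (simp add: underlying_presheaf_simps)
      show "continuous_map (subtopology X U) S (\<lambda>x. ?f (germ G B P x U s))"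
        by (rule continuous_map_eq[OF sec_continuous[OF s]]) (use U s germ_eval_germ in auto)
    qed
    fix e assume e: "e \<in> topspace underlying.GT"
    then show "p (?f e) = fst e"
      using rep germ_eval_germ sec_proj by metis
    fix g assume g: "g \<in> carrier G"
    obtain U s V where U: "U \<in> B" "fst e \<in> U" "s \<in> sec U" "e = germ G B P (fst e) U s"
      and V: "V \<in> B" "act g (fst e) \<in> V" "V \<subseteq> act g ` U" "ps_map P V U (inv g) s \<in> sec V"
      and eq: "germ_act G act B P g e = germ G B P (act g (fst e)) V (ps_map P V U (inv g) s)"
      using underlying.germ_act_rep[OF e g] unfolding underlying_presheaf_simps(1) .
    have "?f (germ_act G act B P g e) = ps_map P V U (inv g) s (act g (fst e))"
      using eq germ_eval_germ[OF V(1,2,4)] by simp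
    also have "\<dots> = sh_act E g (s (fst e))"
      using V(2) g U(1,2) by (simp add: underlying_presheaf_simps)
    also have "s (fst e) = ?f e"
      using germ_eval_germ[OF U(1-3)] U(4) by simp
    finally show "?f (germ_act G act B P g e) = sh_act E g (?f e)" .
  next
    fix x assume x: "x \<in> topspace X"
    show "linear_hom R (underlying.GS x) (M x) ?f"
      unfolding linear_hom_def
    proof (intro conjI ballI funcsetI)
      fix e assume e: "e \<in> carrier (underlying.GS x)"
      then obtain U s where U: "U \<in> B" "x \<in> U" "s \<in> sec U" "e = germ G B P x U s"
        using rep unfolding underlying.germ_stalk_carrier by blast
      show "?f e \<in> carrier (M x)"
        using U x by (simp add: germ_eval_germ sec_stalk)
      show "?f (a \<odot>\<^bsub>underlying.GS x\<^esub> e) = a \<odot>\<^bsub>M x\<^esub> ?f e" if a: "a \<in> carrier R" for a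
        using U a underlying.germ_smult[of U x s a] sec_smult[OF basis_subset[OF U(1)] U(3) a]
        by (simp add: underlying_presheaf_simps sections_simps germ_eval_germ)
      fix e' assume e': "e' \<in> carrier (underlying.GS x)"
      obtain U s t where U: "U \<in> B" "x \<in> U" "s \<in> sec U" "t \<in> sec U" "e = germ G B P x U s" "e' =
          germ G B P x U t"
        using underlying.germ_rep2[of e e' x] e e' unfolding underlying.germ_stalk_carrier
            underlying_presheaf_simps(1)
        by (metis (mono_tags, lifting) mem_Collect_eq)
      then show "?f (e \<oplus>\<^bsub>underlying.GS x\<^esub> e') = ?f e \<oplus>\<^bsub>M x\<^esub> ?f e'"
        using underlying.germ_add[of U x s t] sec_add[OF basis_openin[OF U(1)] U(3,4)]
        by (simp add: underlying_presheaf_simps sections_simps germ_eval_germ)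
    qed
  qed
qed

end

section \<open>The universal property of the sheafified product\<close>

lemma gsheaf_morphism_id: "gsheaf_morphism G R X D D (\<lambda>d. d)"
  by (auto simp: gsheaf_morphism_def linear_hom_def)

section \<open>From points of a sheaf to germs of sections\<close>

context equivariant_sheaf
begin

text \<open>The inverse of \<open>germ_eval\<close>. The choice is harmless: two local sections
  through \<open>e\<close> agree near \<open>p e\<close> by \<open>sections_agree\<close>, hence
  have the same germ.\<close>

definition germ_of :: "'e \<Rightarrow> ('x, 'x \<Rightarrow> 'e) germ" where
  "germ_of e = (SOME z. \<exists>U\<in>B. \<exists>s\<in>sec U. p e \<in> U \<and> s (p e) = e \<and> z = germ G B P (p e) U s)"

lemma germ_of_section:
  assumes U: "U \<in> B" "x \<in> U" "s \<in> sec U"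
  shows "germ_of (s x) = germ G B P x U s"
proof -
  let ?R = "\<lambda>z. \<exists>U\<in>B. \<exists>t\<in>sec U. p (s x) \<in> U \<and> t (p (s x)) = s x \<and> z = germ G B P (p (s x)) U t"
  have px: "p (s x) = x"
    using U by simp
  then have "?R (germ G B P x U s)"
    using U by auto
  then have "?R (germ_of (s x))"
    unfolding germ_of_def by (rule someI)
  then obtain V t where V: "V \<in> B" "t \<in> sec V" "x \<in> V" "t x = s x" and eq: "germ_of (s x) = germ G B
      P x V t"
    unfolding px by blast
  obtain W where W: "W \<in> B" "x \<in> W" "W \<subseteq> V" "W \<subseteq> U" "\<And>y. y \<in> W \<Longrightarrow> t y = s y"
    using sections_agree[OF basis_openin[OF V(1)] basis_openin[OF U(1)] V(2) U(3) V(3) U(2) V(4)] by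
        metis
  have "ps_map P W V \<one> t = ps_map P W U \<one> s"
    unfolding underlying_presheaf_simps using W by (intro restrict_ext) auto
  moreover have "t \<in> underlying.Sec V" "s \<in> underlying.Sec U"
    using V(2) U(3) by (simp_all add: underlying_presheaf_simps)
  ultimately have "germ G B P x V t = germ G B P x U s"
    using underlying.germ_eq_iff[OF V(1,3) _ U(1,2)] W by metis
  then show ?thesis
    using eq by simp
qed

text \<open>With a common domain, a sum in the stalk becomes the value of a sum of sections.\<close>

lemma section_through2:
  assumes "e \<in> carrier (M x)" "e' \<in> carrier (M x)" and x: "x \<in> topspace X"
  obtains U s t where "U \<in> B" "x \<in> U" "s \<in> sec U" "t \<in> sec U" "s x = e" "t x = e'"
proof -
  have e: "e \<in> topspace S" "p e = x" "e' \<in> topspace S" "p e' = x"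
    using assms by (auto simp: stalk_carrier)
  obtain U s where U: "U \<in> B" "s \<in> sec U" "x \<in> U" "s x = e"
    using section_through[OF e(1) openin_topspace] e(2) x by metis
  obtain V t where V: "V \<in> B" "V \<subseteq> U" "t \<in> sec V" "x \<in> V" "t x = e'"
    using section_through[OF e(3) basis_openin[OF U(1)]] e(4) U(3) by metis
  show thesis
    using that[of V "restrict s V" t] U V sec_restrict[OF U(2) V(2)] by simp
qed

lemma germ_of_morphism: "gsheaf_morphism G R X E (sheafify G act B P) germ_of"
  unfolding gsheaf_morphism_def underlying.sheafify_simps
proof (intro conjI ballI)
  show "continuous_map S underlying.GT germ_of"
  proof (rule continuous_map_from_sections)
    fix U s assume U: "U \<in> B" "s \<in> sec U"
    then have "continuous_map (subtopology X U) underlying.GT (\<lambda>x. germ G B P x U s)"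
      by (intro underlying.continuous_germ_section) (simp_all add: underlying_presheaf_simps)
    then show "continuous_map (subtopology X U) underlying.GT (\<lambda>x. germ_of (s x))"
      by (rule continuous_map_eq) (use U in \<open>simp add: germ_of_section\<close>)
  qed
  fix e assume e: "e \<in> topspace S"
  obtain U s where U: "U \<in> B" "s \<in> sec U" "p e \<in> U" "s (p e) = e"
    using section_through[OF e openin_topspace proj_closed[OF e]] by metis
  have ge: "germ_of e = germ G B P (p e) U s"
    using germ_of_section[OF U(1,3,2)] U(4) by simp
  then show "fst (germ_of e) = p e"
    by simp
  fix g assume g: "g \<in> carrier G"
  obtain V where V: "V \<in> B" "act g (p e) \<in> V" "V \<subseteq> act g ` U"
    using underlying.act_nbhd[OF g U(1,3)] .
  let ?t = "ps_map P V U (inv g) s"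
  have "?t \<in> sec V"
    using underlying.map_closed[OF V(1) U(1) _ underlying.act_inv_image[OF g U(1) V(1,3)]] U(2) g
    unfolding underlying_presheaf_simps(1) by simp
  \<comment> \<open>The translated section \<open>?t\<close> passes through
    \<open>sh_act E g e\<close>, so it may be used to compute \<open>germ_of\<close> there.\<close>
  then have "germ_of (?t (act g (p e))) = germ G B P (act g (p e)) V ?t"
    using germ_of_section V by blast
  also have "?t (act g (p e)) = sh_act E g e"
    using V(2) g U e by (simp add: underlying_presheaf_simps)
  also have "germ G B P (act g (p e)) V ?t = germ_act G act B P g (germ_of e)"
    using underlying.germ_act_germ[OF g U(1,3) _ V] U(2) ge unfolding underlying_presheaf_simps(1)
        by simp
  finally show "germ_of (sh_act E g e) = germ_act G act B P g (germ_of e)" .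
next
  fix x assume x: "x \<in> topspace X"
  show "linear_hom R (M x) (underlying.GS x) germ_of"
    unfolding linear_hom_def
  proof (intro conjI ballI funcsetI)
    fix e assume e: "e \<in> carrier (M x)"
    obtain U s where U: "U \<in> B" "x \<in> U" "s \<in> sec U" "s x = e"
      using section_through2[OF e e x] by metis
    have s: "s \<in> underlying.Sec U"
      using U(3) by (simp add: underlying_presheaf_simps)
    show "germ_of e \<in> carrier (underlying.GS x)"
      using germ_of_section[OF U(1-3)] U(1,2,4) s by (auto simp: underlying.germ_stalk_carrier)
    show "germ_of (a \<odot>\<^bsub>M x\<^esub> e) = a \<odot>\<^bsub>underlying.GS x\<^esub> germ_of e" if a: "a \<in> carrier R" for a
      using germ_of_section[OF U(1-3)] germ_of_section[OF U(1,2) sec_smult[OF basis_subset[OF U(1)]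
          U(3) a]] U(2,4)
        underlying.germ_smult[OF U(1,2) s a]
      by (simp add: underlying_presheaf_simps sections_simps)
    fix e' assume e': "e' \<in> carrier (M x)"
    obtain U s t where U: "U \<in> B" "x \<in> U" "s \<in> sec U" "t \<in> sec U" "s x = e" "t x = e'"
      using section_through2[OF e e' x] .
    have st: "s \<in> underlying.Sec U" "t \<in> underlying.Sec U"
      using U(3,4) by (simp_all add: underlying_presheaf_simps)
    show "germ_of (e \<oplus>\<^bsub>M x\<^esub> e') = germ_of e \<oplus>\<^bsub>underlying.GS x\<^esub> germ_of e'"
      using germ_of_section[OF U(1-3)] germ_of_section[OF U(1,2,4)]
        germ_of_section[OF U(1,2) sec_add[OF basis_openin[OF U(1)] U(3,4)]] U(2,5,6)
        underlying.germ_add[OF U(1,2) st]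
      by (simp add: underlying_presheaf_simps sections_simps)
  qed
qed

end

section \<open>Composition of sections with a morphism\<close>

context clopen_gspace
begin

text \<open>Passes from sheaf morphisms to morphisms of the underlying presheaves, in the form that
  the sheafification and pairing lemmas take as premises.\<close>

lemma section_map:
  assumes D: "is_gsheaf G T R X act D" and E: "is_gsheaf G T R X act E" and f: "gsheaf_morphism G R
      X D E f"
  shows section_map_linear: "U \<in> B \<Longrightarrow>
      linear_hom R (ps_sect (underlying_presheaf G X act D) U) (ps_sect (underlying_presheaf G X act
          E) U) (\<lambda>s. \<lambda>x\<in>U. f (s x))"
    and section_map_natural: "\<lbrakk>U \<in> B; V \<in> B; g \<in> carrier G; act g ` U \<subseteq> V; s \<in> carrier (sections X D
        V)\<rbrakk> \<Longrightarrow>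
      (\<lambda>x\<in>U. f (ps_map (underlying_presheaf G X act D) U V g s x)) =
      ps_map (underlying_presheaf G X act E) U V g (\<lambda>x\<in>V. f (s x))"
proof -
  interpret D: equivariant_sheaf G T R X act B D
    by unfold_locales (fact D)
  interpret E: equivariant_sheaf G T R X act B E
    by unfold_locales (fact E)
  have cont: "continuous_map D.S E.S f"
    and proj: "\<And>d. d \<in> topspace D.S \<Longrightarrow> E.p (f d) = D.p d"
    and equiv: "\<And>g d. g \<in> carrier G \<Longrightarrow> d \<in> topspace D.S \<Longrightarrow> f (sh_act D g d) = sh_act E g (f d)"
    and lin: "\<And>x. x \<in> topspace X \<Longrightarrow> linear_hom R (D.M x) (E.M x) f"
    using f by (auto simp: gsheaf_morphism_def)
  show "linear_hom R (ps_sect (underlying_presheaf G X act D) U) (ps_sect (underlying_presheaf G X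
      act E) U) (\<lambda>s. \<lambda>x\<in>U. f (s x))"
    if U: "U \<in> B"
    unfolding linear_hom_def D.underlying_presheaf_simps E.underlying_presheaf_simps
  proof (intro conjI ballI funcsetI)
    fix s assume s: "s \<in> D.sec U"
    show "(\<lambda>x\<in>U. f (s x)) \<in> E.sec U"
    proof (rule E.secI)
      show "continuous_map (subtopology X U) E.S (\<lambda>x. f (s x))"
        using continuous_map_compose[OF D.sec_continuous[OF s] cont] by (simp add: o_def)
    qed (use s U proj D.sec_mem in auto)
    show "(\<lambda>x\<in>U. f ((a \<odot>\<^bsub>sections X D U\<^esub> s) x)) = a \<odot>\<^bsub>sections X E U\<^esub> (\<lambda>x\<in>U. f (s x))"
      if a: "a \<in> carrier R" for a
      unfolding D.sections_simps E.sections_simps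
      using U s a by (intro restrict_ext) (simp add: linear_hom_smult[OF lin] D.sec_stalk)
    fix t assume t: "t \<in> D.sec U"
    show "(\<lambda>x\<in>U. f ((s \<oplus>\<^bsub>sections X D U\<^esub> t) x)) = (\<lambda>x\<in>U. f (s x)) \<oplus>\<^bsub>sections X E U\<^esub> (\<lambda>x\<in>U. f (t x))"
      unfolding D.sections_simps E.sections_simps
      using U s t by (intro restrict_ext) (simp add: linear_hom_add[OF lin] D.sec_stalk)
  qed
  show "(\<lambda>x\<in>U. f (ps_map (underlying_presheaf G X act D) U V g s x)) =
      ps_map (underlying_presheaf G X act E) U V g (\<lambda>x\<in>V. f (s x))"
    if U: "U \<in> B" and V: "V \<in> B" and g: "g \<in> carrier G" "act g ` U \<subseteq> V" and s: "s \<in> D.sec V"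
    unfolding D.underlying_presheaf_simps E.underlying_presheaf_simps
  proof (rule restrict_ext)
    fix x assume x: "x \<in> U"
    then have gx: "act g x \<in> V"
      using g by blast
    then have "s (act g x) \<in> topspace D.S"
      using D.sec_mem[OF s] V by blast
    then show "f ((\<lambda>x\<in>U. sh_act D (inv g) (s (act g x))) x) = sh_act E (inv g) ((\<lambda>x\<in>V. f (s x)) (act
        g x))"
      using x gx g equiv by simp
  qed
qed

end

section \<open>The universal property of the discrete product of presheaves\<close>

context presheaf_family
begin

lemma product_sect_iff:
  assumes "U \<in> B" "s \<in> carrier (ps_sect Q U)"
  shows "s \<in> extensional I" "i \<in> I \<Longrightarrow> s i \<in> carrier (ps_sect (F i) U)"
  using assms by (auto simp: product_carrier module_product_simps PiE_def)

lemma component_linear: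
  assumes "i \<in> I" "U \<in> B"
  shows "linear_hom R (ps_sect Q U) (ps_sect (F i) U) (\<lambda>s. s i)"
  using assms product_sect_iff by (auto simp: linear_hom_def product_simps module_product_simps)

context
  fixes H :: "('g, 'x, 'r, 'n) gpresheaf" and \<beta> :: "'i \<Rightarrow> 'x set \<Rightarrow> 'n \<Rightarrow> 'm"
  assumes H: "is_gpresheaf G T R act B H"
    and linear: "\<And>i U. \<lbrakk>i \<in> I; U \<in> B\<rbrakk> \<Longrightarrow> linear_hom R (ps_sect H U) (ps_sect (F i) U) (\<beta> i U)"
    and natural: "\<And>i U V g s. \<lbrakk>i \<in> I; U \<in> B; V \<in> B; g \<in> carrier G; act g ` U \<subseteq> V; s \<in> carrier
        (ps_sect H V)\<rbrakk> \<Longrightarrow>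
      \<beta> i U (ps_map H U V g s) = ps_map (F i) U V g (\<beta> i V s)"
begin

interpretation H: equivariant_presheaf G T R X act B H
  by unfold_locales (fact H)

lemma pairing_natural:
  assumes "U \<in> B" "V \<in> B" "g \<in> carrier G" "act g ` U \<subseteq> V" "s \<in> carrier (ps_sect H V)"
  shows "(\<lambda>i\<in>I. \<beta> i U (ps_map H U V g s)) = ps_map Q U V g (\<lambda>i\<in>I. \<beta> i V s)"
  unfolding product_simps using assms natural by (intro restrict_ext) simp

text \<open>The point is that the pairing lands in the discrete part: by naturality an element that
  fixes \<open>s\<close> fixes every \<open>\<beta> i U s\<close>, so the neighbourhood
  \<open>N\<close> belonging to \<open>s\<close> serves all indices. It is applied with
  \<open>H\<close> an underlying presheaf, to lift morphisms, and with \<open>H\<close> another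
  discrete product, for functoriality.\<close>

lemma pairing_linear:
  assumes U: "U \<in> B"
  shows "linear_hom R (ps_sect H U) (ps_sect Q U) (\<lambda>s. \<lambda>i\<in>I. \<beta> i U s)"
  unfolding linear_hom_def
proof (intro conjI ballI funcsetI)
  fix s assume s: "s \<in> carrier (ps_sect H U)"
  obtain N where N: "openin T N" "\<one> \<in> N" "N \<subseteq> set_stabilizer G act U"
      "\<And>h. h \<in> N \<Longrightarrow> ps_map H U U (inv h) s = s"
    using H.stabilizer_nbhd[OF U s] by metis
  have "prod_map U U (inv h) (\<lambda>i\<in>I. \<beta> i U s) = (\<lambda>i\<in>I. \<beta> i U s)" if h: "h \<in> N" for h
  proof -
    have h': "inv h \<in> carrier G" "act (inv h) ` U \<subseteq> U"
      using set_stabilizer_mem[OF U, of h] N(3) h by auto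
    show ?thesis
      using pairing_natural[OF U U h' s] unfolding product_simps N(4)[OF h] by (rule sym)
  qed
  moreover have "(\<lambda>i\<in>I. \<beta> i U s) \<in> carrier (prod_sect U)"
    using linear_hom_closed[OF linear[OF _ U] s] by (simp add: module_product_simps)
  ultimately show "(\<lambda>i\<in>I. \<beta> i U s) \<in> carrier (ps_sect Q U)"
    unfolding product_carrier[OF U] using N(1-3) by blast
  show "(\<lambda>i\<in>I. \<beta> i U (a \<odot>\<^bsub>ps_sect H U\<^esub> s)) = a \<odot>\<^bsub>ps_sect Q U\<^esub> (\<lambda>i\<in>I. \<beta> i U s)" if "a \<in> carrier R" for a
    unfolding product_simps module_product_simps
    using linear_hom_smult[OF linear[OF _ U] that s] by (intro restrict_ext) simp
  fix t assume t: "t \<in> carrier (ps_sect H U)"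
  show "(\<lambda>i\<in>I. \<beta> i U (s \<oplus>\<^bsub>ps_sect H U\<^esub> t)) = (\<lambda>i\<in>I. \<beta> i U s) \<oplus>\<^bsub>ps_sect Q U\<^esub> (\<lambda>i\<in>I. \<beta> i U t)"
    unfolding product_simps module_product_simps
    using linear_hom_add[OF linear[OF _ U] s t] by (intro restrict_ext) simp
qed

end

end

section \<open>The sheafified product of a family of sheaves and its projections\<close>

locale sheaf_family = clopen_gspace G T R X act B
  for G :: "('g, 'z) monoid_scheme" (structure) and T :: "'g topology"
    and R :: "('r, 'w) ring_scheme"
    and X :: "'x topology" and act :: "'g \<Rightarrow> 'x \<Rightarrow> 'x" and B :: "'x set set" +
  fixes I :: "'i set" and F :: "'i \<Rightarrow> ('g, 'x, 'r, 'e) gsheaf"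
  assumes sheaves: "i \<in> I \<Longrightarrow> is_gsheaf G T R X act (F i)"
begin

lemma sheaf_factor: "i \<in> I \<Longrightarrow> equivariant_sheaf G T R X act B (F i)"
  by (simp add: equivariant_sheaf_def equivariant_sheaf_axioms_def sheaves clopen_gspace_axioms)

sublocale fam: presheaf_family G T R X act B I "\<lambda>i. underlying_presheaf G X act (F i)"
  by unfold_locales (simp add: equivariant_sheaf.is_gpresheaf_underlying sheaf_factor)

abbreviation PF :: "'i \<Rightarrow> ('g, 'x, 'r, 'x \<Rightarrow> 'e) gpresheaf" where
  "PF i \<equiv> underlying_presheaf G X act (F i)"
abbreviation L :: "('g, 'x, 'r, ('x, 'i \<Rightarrow> 'x \<Rightarrow> 'e) germ) gsheaf" where
  "L \<equiv> sheafified_product G T X act B I F"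
abbreviation pr :: "'i \<Rightarrow> ('x, 'i \<Rightarrow> 'x \<Rightarrow> 'e) germ \<Rightarrow> 'e" where
  "pr \<equiv> product_projection G T X act B I F"

lemma L_eq: "L = sheafify G act B fam.Q"
  by (simp add: sheafified_product_def underlying_product_def)

lemma is_gpresheaf_underlying_product: "is_gpresheaf G T R act B (underlying_product G T X act I F)"
  unfolding underlying_product_def by (rule fam.is_gpresheaf_product)

lemma is_gsheaf_L: "is_gsheaf G T R X act L"
  unfolding L_eq by (rule fam.product.is_gsheaf_sheafify)

lemma sect_mem: "\<lbrakk>U \<in> B; s \<in> fam.product.Sec U; i \<in> I\<rbrakk> \<Longrightarrow> s i \<in> carrier (sections X (F i) U)"
  using fam.product_sect_iff(2)[of U s i] by (simp add: underlying_presheaf_def)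

lemma component_natural:
  "i \<in> I \<Longrightarrow> ps_map fam.Q U V g s i = ps_map (PF i) U V g (s i)"
  by (simp add: fam.product_simps)

lemma projection_germ:
  assumes i: "i \<in> I" and U: "U \<in> B" "x \<in> U" "s \<in> fam.product.Sec U"
  shows "pr i (fam.product.gm x U s) = s i x"
proof -
  interpret E: equivariant_sheaf G T R X act B "F i"
    by (rule sheaf_factor[OF i])
  have "sheafify_map G B fam.Q (PF i) (\<lambda>U s. s i) (fam.product.gm x U s) = germ G B (PF i) x U (s i)"
    by (rule sheafify_map_germ[where \<alpha> = "\<lambda>U s. s i", OF fam.is_gpresheaf_product
        E.is_gpresheaf_underlying fam.component_linear[OF i] component_natural[OF i] U])
  then show ?thesis
    using E.germ_eval_germ[OF U(1,2) sect_mem[OF U(1,3) i]]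
    by (simp add: product_projection_def underlying_product_def)
qed

lemma projection_morphism:
  assumes i: "i \<in> I"
  shows "gsheaf_morphism G R X L (F i) (pr i)"
proof -
  interpret E: equivariant_sheaf G T R X act B "F i"
    by (rule sheaf_factor[OF i])
  show ?thesis
    unfolding product_projection_def underlying_product_def L_eq
    by (rule gsheaf_morphism_compose[OF sheafify_map_morphism[where \<alpha> = "\<lambda>U s. s i", OF
        fam.is_gpresheaf_product E.is_gpresheaf_underlying
            fam.component_linear[OF i] component_natural[OF i]] E.germ_eval_morphism])
qed

text \<open>Since projecting to all factors is not injective on germs, a morphism into the product is
  pinned down along local sections of its domain instead of stalk by stalk.\<close>

lemma morphism_to_L_section:
  assumes D: "is_gsheaf G T R X act D" and h: "gsheaf_morphism G R X D L h"
    and U: "U \<in> B" "x \<in> U" "s \<in> carrier (sections X D U)"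
    and t: "t \<in> fam.product.Sec U"
    and eq: "\<And>i y. i \<in> I \<Longrightarrow> y \<in> U \<Longrightarrow> pr i (h (s y)) = t i y"
  shows "h (s x) = fam.product.gm x U t"
proof -
  interpret D: equivariant_sheaf G T R X act B D
    by unfold_locales (fact D)
  interpret L: equivariant_sheaf G T R X act B L
    by unfold_locales (fact is_gsheaf_L)
  have space: "L.S = fam.product.GT" and proj: "L.p = fst"
    by (simp_all add: L_eq fam.product.sheafify_simps)
  have hs: "(\<lambda>y\<in>U. h (s y)) \<in> L.sec U"
    using linear_hom_closed[OF section_map_linear[OF D is_gsheaf_L h U(1)], of s] U(3)
    by (simp add: underlying_presheaf_def)
  have "h (s x) \<in> topspace fam.product.GT" "fst (h (s x)) = x"
    using L.sec_mem[OF hs _ U(2)] L.sec_proj[OF hs U(2)] U(1,2) space proj by auto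
  then obtain V u where V: "V \<in> B" "x \<in> V" "u \<in> fam.product.Sec V" "h (s x) = fam.product.gm x V u"
    using fam.product.germ_rep by metis
  \<comment> \<open>The germs of \<open>u\<close> form a section of \<open>L\<close> through
    \<open>h (s x)\<close>, as \<open>h\<close> composed with \<open>s\<close> does. The two
    sections therefore agree on one neighbourhood \<open>W\<close> of \<open>x\<close>, chosen
    before any index.\<close>
  have us: "(\<lambda>y\<in>V. fam.product.gm y V u) \<in> L.sec V"
    using fam.product.continuous_germ_section[OF V(1,3)] by (intro L.secI) (simp_all add: space proj)
  have eqx: "(\<lambda>y\<in>U. h (s y)) x = (\<lambda>y\<in>V. fam.product.gm y V u) x"
    using U(2) V(2,4) by simp
  obtain W where W: "W \<in> B" "x \<in> W" "W \<subseteq> U" "W \<subseteq> V"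
      and WE: "\<And>y. y \<in> W \<Longrightarrow> (\<lambda>y\<in>U. h (s y)) y = (\<lambda>y\<in>V. fam.product.gm y V u) y"
    using L.sections_agree[OF basis_openin[OF U(1)] basis_openin[OF V(1)] hs us U(2) V(2) eqx] by metis
  have eqW: "u i y = t i y" if "i \<in> I" "y \<in> W" for i y
  proof -
    have "h (s y) = fam.product.gm y V u"
      using WE[OF that(2)] that(2) W(3,4) by (simp add: subset_iff)
    moreover have "y \<in> U" "y \<in> V"
      using that(2) W(3,4) by auto
    ultimately show ?thesis
      using projection_germ[OF that(1) V(1) _ V(3), of y] eq[OF that(1), of y] by simp
  qed
  \<comment> \<open>Equal values at all points of \<open>W\<close> give equal components over
    \<open>W\<close>. The terms \<open>act \<one> y\<close> appear because restriction is the
    presheaf map at the identity.\<close>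
  have "fam.product.res V W u = fam.product.res U W t"
    unfolding fam.product_simps
  proof (rule restrict_ext)
    fix i assume i: "i \<in> I"
    have "u i (act \<one> y) = t i (act \<one> y)" if "y \<in> W" for y
      using eqW[OF i that] W(1) that by simp
    then show "ps_map (PF i) W V \<one> (u i) = ps_map (PF i) W U \<one> (t i)"
      by (auto simp: underlying_presheaf_def)
  qed
  then show ?thesis
    using V(4) fam.product.germ_eq_iff[OF V(1-3) U(1,2) t] W by auto
qed

lemma lift_section:
  assumes D: "is_gsheaf G T R X act D" and f: "\<And>i. i \<in> I \<Longrightarrow> gsheaf_morphism G R X D (F i) (f i)"
  shows lift_section_linear: "U \<in> B \<Longrightarrow>
      linear_hom R (ps_sect (underlying_presheaf G X act D) U) (ps_sect fam.Q U) (\<lambda>s. \<lambda>i\<in>I. \<lambda>x\<in>U. f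
          i (s x))"
    and lift_section_natural:
      "\<lbrakk>U \<in> B; V \<in> B; g \<in> carrier G; act g ` U \<subseteq> V; s \<in> carrier (ps_sect (underlying_presheaf G X
          act D) V)\<rbrakk> \<Longrightarrow>
      (\<lambda>i\<in>I. \<lambda>x\<in>U. f i (ps_map (underlying_presheaf G X act D) U V g s x)) =
      ps_map fam.Q U V g (\<lambda>i\<in>I. \<lambda>x\<in>V. f i (s x))"
proof -
  interpret D: equivariant_sheaf G T R X act B D
    by unfold_locales (fact D)
  note linear = section_map_linear[OF D sheaves f]
  have natural: "(\<lambda>x\<in>U. f i (ps_map D.P U V g s x)) = ps_map (PF i) U V g (\<lambda>x\<in>V. f i (s x))"
    if "i \<in> I" "U \<in> B" "V \<in> B" "g \<in> carrier G" "act g ` U \<subseteq> V" "s \<in> carrier (ps_sect D.P V)" for i U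
        V g s
    using section_map_natural[OF D sheaves[OF that(1)] f[OF that(1)] that(2-5)] that(6)
    by (simp add: D.underlying_presheaf_simps(1))
  show "U \<in> B \<Longrightarrow> linear_hom R (ps_sect D.P U) (ps_sect fam.Q U) (\<lambda>s. \<lambda>i\<in>I. \<lambda>x\<in>U. f i (s x))"
    by (rule fam.pairing_linear[OF D.is_gpresheaf_underlying, where \<beta> = "\<lambda>i U s. \<lambda>x\<in>U. f i (s x)"])
      (simp_all add: linear natural)
  show "\<lbrakk>U \<in> B; V \<in> B; g \<in> carrier G; act g ` U \<subseteq> V; s \<in> carrier (ps_sect D.P V)\<rbrakk> \<Longrightarrow>
      (\<lambda>i\<in>I. \<lambda>x\<in>U. f i (ps_map D.P U V g s x)) = ps_map fam.Q U V g (\<lambda>i\<in>I. \<lambda>x\<in>V. f i (s x))"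
    by (rule fam.pairing_natural[OF D.is_gpresheaf_underlying, where \<beta> = "\<lambda>i U s. \<lambda>x\<in>U. f i (s x)"])
      (simp_all add: linear natural)
qed

text \<open>Through \<open>germ_of\<close>, \<open>D\<close> maps to the sheafification of its own
  underlying presheaf. From there the sheafified pairing leads to \<open>L\<close>, so the lift is
  assembled from maps already known to be morphisms.\<close>

lemma lift_exists:
  assumes D: "is_gsheaf G T R X act D" and f: "\<And>i. i \<in> I \<Longrightarrow> gsheaf_morphism G R X D (F i) (f i)"
  obtains h where "gsheaf_morphism G R X D L h"
    "\<And>i d. i \<in> I \<Longrightarrow> d \<in> topspace (sh_space D) \<Longrightarrow> pr i (h d) = f i d"
proof -
  interpret D: equivariant_sheaf G T R X act B D
    by unfold_locales (fact D)
  let ?\<alpha> = "\<lambda>U s. \<lambda>i\<in>I. \<lambda>x\<in>U. f i (s x)"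
  let ?h = "sheafify_map G B D.P fam.Q ?\<alpha> \<circ> D.germ_of"
  have linear: "linear_hom R (ps_sect D.P U) (ps_sect fam.Q U) (?\<alpha> U)" if "U \<in> B" for U
    by (rule lift_section_linear[OF D f that])
  have natural: "?\<alpha> U (ps_map D.P U V g s) = ps_map fam.Q U V g (?\<alpha> V s)"
    if "U \<in> B" "V \<in> B" "g \<in> carrier G" "act g ` U \<subseteq> V" "s \<in> carrier (ps_sect D.P V)" for U V g s
    by (rule lift_section_natural[OF D f that])
  have "gsheaf_morphism G R X D L ?h"
    unfolding L_eq
    by (rule gsheaf_morphism_compose[OF D.germ_of_morphism
          sheafify_map_morphism[where \<alpha> = ?\<alpha>, OF D.is_gpresheaf_underlying fam.is_gpresheaf_product
              linear natural]])
  moreover have "pr i (?h d) = f i d" if i: "i \<in> I" and d: "d \<in> topspace (sh_space D)" for i d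
  proof -
    obtain U s where U: "U \<in> B" "s \<in> D.sec U" "D.p d \<in> U" "s (D.p d) = d"
      using D.section_through[OF d openin_topspace D.proj_closed[OF d]] by metis
    have s: "s \<in> carrier (ps_sect D.P U)"
      using U(2) by (simp add: D.underlying_presheaf_simps(1))
    have "D.germ_of d = germ G B D.P (D.p d) U s"
      using D.germ_of_section[OF U(1,3,2)] U(4) by simp
    then have "?h d = fam.product.gm (D.p d) U (?\<alpha> U s)"
      using sheafify_map_germ[where \<alpha> = ?\<alpha>, OF D.is_gpresheaf_underlying fam.is_gpresheaf_product
          linear natural U(1,3) s] by simp
    then show ?thesis
      using projection_germ[OF i U(1,3) linear_hom_closed[OF linear[OF U(1)] s]] i U(3,4) by simp
  qed
  ultimately show thesis
    using that by blast
qed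

lemma lift_unique:
  assumes D: "is_gsheaf G T R X act D"
    and h: "gsheaf_morphism G R X D L h" and h': "gsheaf_morphism G R X D L h'"
    and eq: "\<And>i d. i \<in> I \<Longrightarrow> d \<in> topspace (sh_space D) \<Longrightarrow> pr i (h d) = pr i (h' d)"
    and d: "d \<in> topspace (sh_space D)"
  shows "h d = h' d"
proof -
  interpret D: equivariant_sheaf G T R X act B D
    by unfold_locales (fact D)
  obtain U s where U: "U \<in> B" "s \<in> D.sec U" "D.p d \<in> U" "s (D.p d) = d"
    using D.section_through[OF d openin_topspace D.proj_closed[OF d]] by metis
  \<comment> \<open>The family that pins down both morphisms consists of the projections of
    \<open>h\<close> itself along \<open>s\<close>. It lies in the discrete part because these
    projections are again morphisms out of \<open>D\<close>.\<close>
  let ?f = "\<lambda>i. pr i \<circ> h"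
  have f: "gsheaf_morphism G R X D (F i) (?f i)" if "i \<in> I" for i
    by (rule gsheaf_morphism_compose[OF h projection_morphism[OF that]])
  have t: "(\<lambda>i\<in>I. \<lambda>x\<in>U. ?f i (s x)) \<in> fam.product.Sec U" (is "?t \<in> _")
    by (rule linear_hom_closed[OF lift_section_linear[OF D f U(1)]])
      (simp_all add: D.underlying_presheaf_simps(1) U(2))
  have sU: "s y \<in> topspace D.S" if "y \<in> U" for y
    using D.sec_mem[OF U(2) _ that] U(1) that by blast
  have "h (s (D.p d)) = fam.product.gm (D.p d) U ?t"
    by (rule morphism_to_L_section[OF D h U(1,3,2) t]) simp
  moreover have "h' (s (D.p d)) = fam.product.gm (D.p d) U ?t"
    by (rule morphism_to_L_section[OF D h' U(1,3,2) t]) (simp add: eq sU)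
  ultimately show ?thesis
    using U(4) by simp
qed

lemma universal_property:
  assumes D: "is_gsheaf G T R X act D" and f: "\<And>i. i \<in> I \<Longrightarrow> gsheaf_morphism G R X D (F i) (f i)"
  shows "\<exists>!h. h \<in> extensional (topspace (sh_space D)) \<and> gsheaf_morphism G R X D L h \<and>
    (\<forall>i\<in>I. \<forall>d\<in>topspace (sh_space D). pr i (h d) = f i d)"
proof -
  obtain h where h: "gsheaf_morphism G R X D L h"
      "\<And>i d. i \<in> I \<Longrightarrow> d \<in> topspace (sh_space D) \<Longrightarrow> pr i (h d) = f i d"
    using lift_exists[OF D f] by metis
  \<comment> \<open>Uniqueness is asserted for total functions, so the lift is normalised outside
    the sheaf space.\<close>
  let ?h = "restrict h (topspace (sh_space D))"
  have "gsheaf_morphism G R X D L ?h"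
    by (rule gsheaf_morphism_cong[OF D h(1)]) simp
  then show ?thesis
    using h(2)
  proof (intro ex1I[of _ ?h])
    fix k assume k: "k \<in> extensional (topspace (sh_space D)) \<and> gsheaf_morphism G R X D L k \<and>
      (\<forall>i\<in>I. \<forall>d\<in>topspace (sh_space D). pr i (k d) = f i d)"
    show "k = ?h"
    proof (rule extensionalityI[of _ "topspace (sh_space D)"])
      fix d assume "d \<in> topspace (sh_space D)"
      then show "k d = ?h d"
        using lift_unique[OF D _ h(1), of k d] k h(2) by simp
    qed (use k in simp_all)
  qed simp
qed

end

section \<open>Functoriality and independence of the basis\<close>

lemma sheafified_product_map:
  assumes F: "sheaf_family G T R X act B I F" and F': "sheaf_family G T R X act B I F'"
    and a: "\<And>i. i \<in> I \<Longrightarrow> gsheaf_morphism G R X (F i) (F' i) (a i)"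
  shows sheafified_product_map_morphism:
      "gsheaf_morphism G R X (sheafified_product G T X act B I F) (sheafified_product G T X act B I F')
        (sheafified_product_map G T X act B I F F' a)"
    and sheafified_product_map_projection:
      "\<lbrakk>i \<in> I; e \<in> topspace (sh_space (sheafified_product G T X act B I F))\<rbrakk> \<Longrightarrow>
        product_projection G T X act B I F' i (sheafified_product_map G T X act B I F F' a e) =
        a i (product_projection G T X act B I F i e)"
proof -
  interpret F: sheaf_family G T R X act B I F by (fact F)
  interpret F': sheaf_family G T R X act B I F' by (fact F')
  \<comment> \<open>Component \<open>i\<close> of the induced map is the presheaf projection
    followed by composition with \<open>a i\<close>. The pairing lemmas then apply with the first
    discrete product as domain.\<close>
  let ?\<beta> = "\<lambda>i U s. \<lambda>x\<in>U. a i (s i x)"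
  let ?\<alpha> = "\<lambda>U s. \<lambda>i\<in>I. ?\<beta> i U s"
  have linear: "linear_hom R (ps_sect F.fam.Q U) (ps_sect (F'.PF i) U) (?\<beta> i U)" if "i \<in> I" "U \<in> B"
      for i U
    using linear_hom_compose[OF F.fam.component_linear[OF that]
        F.section_map_linear[OF F.sheaves[OF that(1)] F'.sheaves[OF that(1)] a[OF that(1)] that(2)]]
    by (simp add: o_def)
  have natural: "?\<beta> i U (ps_map F.fam.Q U V g s) = ps_map (F'.PF i) U V g (?\<beta> i V s)"
    if "i \<in> I" "U \<in> B" "V \<in> B" "g \<in> carrier G" "act g ` U \<subseteq> V" "s \<in> carrier (ps_sect F.fam.Q V)" for
        i U V g s
    using F.section_map_natural[OF F.sheaves[OF that(1)] F'.sheaves[OF that(1)] a[OF that(1)]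
        that(2-5) F.sect_mem[OF that(3,6,1)]]
    by (simp add: F.component_natural[OF that(1)])
  have linear': "linear_hom R (ps_sect F.fam.Q U) (ps_sect F'.fam.Q U) (?\<alpha> U)" if "U \<in> B" for U
    by (rule F'.fam.pairing_linear[where \<beta> = ?\<beta>, OF F.fam.is_gpresheaf_product linear natural that])
  have natural': "?\<alpha> U (ps_map F.fam.Q U V g s) = ps_map F'.fam.Q U V g (?\<alpha> V s)"
    if "U \<in> B" "V \<in> B" "g \<in> carrier G" "act g ` U \<subseteq> V" "s \<in> carrier (ps_sect F.fam.Q V)" for U V g s
    by (rule F'.fam.pairing_natural[where \<beta> = ?\<beta>, OF F.fam.is_gpresheaf_product linear natural that])
  have map_eq: "sheafified_product_map G T X act B I F F' a = sheafify_map G B F.fam.Q F'.fam.Q ?\<alpha>"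
    by (simp add: sheafified_product_map_def underlying_product_def)
  show "gsheaf_morphism G R X F.L F'.L (sheafified_product_map G T X act B I F F' a)"
    unfolding map_eq F.L_eq F'.L_eq
    by (rule F.sheafify_map_morphism[where \<alpha> = ?\<alpha>, OF F.fam.is_gpresheaf_product
        F'.fam.is_gpresheaf_product linear' natural'])
  show "F'.pr i (sheafified_product_map G T X act B I F F' a e) = a i (F.pr i e)"
    if i: "i \<in> I" and e: "e \<in> topspace (sh_space F.L)" for i e
  proof -
    have "e \<in> topspace F.fam.product.GT"
      using e by (simp add: F.L_eq F.fam.product.sheafify_simps)
    then obtain U s where U: "U \<in> B" "fst e \<in> U" "s \<in> F.fam.product.Sec U" and es: "e =
        F.fam.product.gm (fst e) U s"
      using F.fam.product.germ_rep by metis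
    have "sheafify_map G B F.fam.Q F'.fam.Q ?\<alpha> e = F'.fam.product.gm (fst e) U (?\<alpha> U s)"
      using F.sheafify_map_germ[where \<alpha> = ?\<alpha>, OF F.fam.is_gpresheaf_product
          F'.fam.is_gpresheaf_product linear' natural' U] es by simp
    moreover have "?\<alpha> U s \<in> F'.fam.product.Sec U"
      by (rule linear_hom_closed[OF linear'[OF U(1)] U(3)])
    ultimately have "F'.pr i (sheafify_map G B F.fam.Q F'.fam.Q ?\<alpha> e) = a i (s i (fst e))"
      using F'.projection_germ[OF i U(1,2)] i U(2) by simp
    then show ?thesis
      using F.projection_germ[OF i U] es by (simp add: map_eq)
  qed
qed

theorem proposition6p7:
  fixes G :: "('g, 'z) monoid_scheme" and T :: "'g topology"
    and R :: "('r, 'w) ring_scheme"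
    and X :: "'x topology" and act :: "'g \<Rightarrow> 'x \<Rightarrow> 'x"
    and B B' :: "'x set set" and I :: "'i set"
  assumes "profinite_group G T"
    and "ring R"
    and "profinite_space X" and "continuous_action G T X act"
    and "clopen_basis X B" and "clopen_basis X B'"
  shows
    "(\<forall>F :: 'i \<Rightarrow> ('g, 'x, 'r, 'e) gsheaf. (\<forall>i\<in>I. is_gsheaf G T R X act (F i)) \<longrightarrow>
       is_gpresheaf G T R act B (underlying_product G T X act I F) \<and>
       is_gsheaf G T R X act (sheafified_product G T X act B I F) \<and>
       (\<forall>i\<in>I. gsheaf_morphism G R X (sheafified_product G T X act B I F) (F i)
                 (product_projection G T X act B I F i)) \<and>
       (\<forall>(D :: ('g, 'x, 'r, 'd) gsheaf) f.
          is_gsheaf G T R X act D \<and> (\<forall>i\<in>I. gsheaf_morphism G R X D (F i) (f i)) \<longrightarrow>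
          (\<exists>!h. h \<in> extensional (topspace (sh_space D)) \<and>
                gsheaf_morphism G R X D (sheafified_product G T X act B I F) h \<and>
                (\<forall>i\<in>I. \<forall>d\<in>topspace (sh_space D).
                   product_projection G T X act B I F i (h d) = f i d)))) \<and>
     (\<exists>\<theta>. (\<forall>F :: 'i \<Rightarrow> ('g, 'x, 'r, 'e) gsheaf.
              (\<forall>i\<in>I. is_gsheaf G T R X act (F i)) \<longrightarrow>
              gsheaf_isomorphism G R X (sheafified_product G T X act B I F)
                (sheafified_product G T X act B' I F) (\<theta> F) \<and>
              (\<forall>i\<in>I. \<forall>e\<in>topspace (sh_space (sheafified_product G T X act B I F)).
                 product_projection G T X act B' I F i (\<theta> F e) =
                 product_projection G T X act B I F i e)) \<and>
          (\<forall>(F :: 'i \<Rightarrow> ('g, 'x, 'r, 'e) gsheaf) F' a.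
              (\<forall>i\<in>I. is_gsheaf G T R X act (F i) \<and> is_gsheaf G T R X act (F' i) \<and>
                      gsheaf_morphism G R X (F i) (F' i) (a i)) \<longrightarrow>
              (\<forall>e\<in>topspace (sh_space (sheafified_product G T X act B I F)).
                 \<theta> F' (sheafified_product_map G T X act B I F F' a e) =
                 sheafified_product_map G T X act B' I F F' a (\<theta> F e))))"
proof -
  have loc: "clopen_gspace G T R X act B" "clopen_gspace G T R X act B'"
    using assms by (auto simp: clopen_gspace_def profinite_group_def profinite_space_def)
  let ?ok = "\<lambda>F :: 'i \<Rightarrow> ('g, 'x, 'r, 'e) gsheaf. \<forall>i\<in>I. is_gsheaf G T R X act (F i)"
  let ?L = "\<lambda>B. sheafified_product G T X act B I" and ?pr = "\<lambda>B. product_projection G T X act B I"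
  let ?S = "\<lambda>B F. topspace (sh_space (?L B F))"
  have fam: "sheaf_family G T R X act B I F" "sheaf_family G T R X act B' I F" if "?ok F" for F
    using loc that by (simp_all add: sheaf_family_def sheaf_family_axioms_def)
  let ?P = "\<lambda>F t. gsheaf_morphism G R X (?L B F) (?L B' F) t \<and>
    (\<forall>i\<in>I. \<forall>e\<in>?S B F. ?pr B' F i (t e) = ?pr B F i e)"
  \<comment> \<open>The statement wants one \<open>\<theta>\<close> for all families, so a lift of
    the projections is chosen for each \<open>F\<close>. Where \<open>F\<close> is not a family of
    sheaves its value is arbitrary.\<close>
  define \<theta> where "\<theta> F = (SOME t. ?P F t)" for F :: "'i \<Rightarrow> ('g, 'x, 'r, 'e) gsheaf"
  have \<theta>: "?P F (\<theta> F)" if F: "?ok F" for F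
  proof -
    interpret B: sheaf_family G T R X act B I F by (rule fam(1)[OF F])
    interpret B': sheaf_family G T R X act B' I F by (rule fam(2)[OF F])
    obtain t where "gsheaf_morphism G R X B.L B'.L t"
        "\<And>i e. i \<in> I \<Longrightarrow> e \<in> ?S B F \<Longrightarrow> B'.pr i (t e) = B.pr i e"
      using B'.lift_exists[OF B.is_gsheaf_L B.projection_morphism] by metis
    then have "?P F t"
      by blast
    then show ?thesis
      unfolding \<theta>_def by (rule someI[where P = "?P F"])
  qed
  have closed: "f d \<in> topspace (sh_space E)"
    if "gsheaf_morphism G R X D E f" "d \<in> topspace (sh_space D)" for D E f d
    using that by (auto simp: gsheaf_morphism_def continuous_map_def)
  have iso: "gsheaf_isomorphism G R X (?L B F) (?L B' F) (\<theta> F)" if F: "?ok F" for F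
  proof -
    interpret B: sheaf_family G T R X act B I F by (rule fam(1)[OF F])
    interpret B': sheaf_family G T R X act B' I F by (rule fam(2)[OF F])
    obtain k where k: "gsheaf_morphism G R X B'.L B.L k"
        "\<And>i e. i \<in> I \<Longrightarrow> e \<in> ?S B' F \<Longrightarrow> B.pr i (k e) = B'.pr i e"
      using B.lift_exists[OF B'.is_gsheaf_L B'.projection_morphism] by metis
    have t: "gsheaf_morphism G R X B.L B'.L (\<theta> F)"
        "\<And>i e. i \<in> I \<Longrightarrow> e \<in> ?S B F \<Longrightarrow> B'.pr i (\<theta> F e) = B.pr i e"
      using \<theta>[OF F] by blast+
    \<comment> \<open>The composite and the identity are both endomorphisms over the same
      projections, so uniqueness of lifts identifies them; likewise for the other composite.\<close>
    have "(k \<circ> \<theta> F) d = d" if d: "d \<in> ?S B F" for d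
      by (rule B.lift_unique[OF B.is_gsheaf_L gsheaf_morphism_compose[OF t(1) k(1)]
          gsheaf_morphism_id _ d])
        (simp add: k(2) t(2) closed[OF t(1)])
    moreover have "(\<theta> F \<circ> k) d = d" if d: "d \<in> ?S B' F" for d
      by (rule B'.lift_unique[OF B'.is_gsheaf_L gsheaf_morphism_compose[OF k(1) t(1)]
          gsheaf_morphism_id _ d])
        (simp add: k(2) t(2) closed[OF k(1)])
    ultimately show ?thesis
      unfolding gsheaf_isomorphism_def using t(1) k(1) by auto
  qed
  have natural: "\<theta> F' (sheafified_product_map G T X act B I F F' a e) =
      sheafified_product_map G T X act B' I F F' a (\<theta> F e)"
    if F: "\<forall>i\<in>I. is_gsheaf G T R X act (F i) \<and> is_gsheaf G T R X act (F' i) \<and>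
        gsheaf_morphism G R X (F i) (F' i) (a i)" and e: "e \<in> ?S B F"
    for F F' :: "'i \<Rightarrow> ('g, 'x, 'r, 'e) gsheaf" and a e
  proof -
    have ok: "?ok F" "?ok F'" and a: "\<And>i. i \<in> I \<Longrightarrow> gsheaf_morphism G R X (F i) (F' i) (a i)"
      using F by blast+
    interpret B: sheaf_family G T R X act B I F by (rule fam(1)[OF ok(1)])
    interpret C: sheaf_family G T R X act B' I F' by (rule fam(2)[OF ok(2)])
    note m = sheafified_product_map_morphism[OF fam(1)[OF ok(1)] fam(1)[OF ok(2)] a]
      and m' = sheafified_product_map_morphism[OF fam(2)[OF ok(1)] fam(2)[OF ok(2)] a]
      and p = sheafified_product_map_projection[OF fam(1)[OF ok(1)] fam(1)[OF ok(2)] a]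
      and p' = sheafified_product_map_projection[OF fam(2)[OF ok(1)] fam(2)[OF ok(2)] a]
    let ?m = "sheafified_product_map G T X act B I F F' a" and ?m' = "sheafified_product_map G T X
        act B' I F F' a"
    have mm: "gsheaf_morphism G R X (?L B F) (?L B F') ?m" "gsheaf_morphism G R X (?L B' F) (?L B'
        F') ?m'"
      by (rule m m'; simp)+
    have t: "gsheaf_morphism G R X (?L B F) (?L B' F) (\<theta> F)" "gsheaf_morphism G R X (?L B F') (?L B'
        F') (\<theta> F')"
      using \<theta>[OF ok(1)] \<theta>[OF ok(2)] by blast+
    \<comment> \<open>Both ways around the naturality square are morphisms into the product of the
      \<open>F' i\<close> formed over \<open>B'\<close>. Uniqueness of lifts there reduces
      commutativity to a comparison of projections.\<close>
    have "(\<theta> F' \<circ> ?m) e = (?m' \<circ> \<theta> F) e"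
    proof (rule C.lift_unique[OF B.is_gsheaf_L gsheaf_morphism_compose[OF mm(1) t(2)]
        gsheaf_morphism_compose[OF t(1) mm(2)] _ e])
      fix i d assume i: "i \<in> I" and d: "d \<in> ?S B F"
      have "?pr B' F' i (\<theta> F' (?m d)) = ?pr B F' i (?m d)"
        using \<theta>[OF ok(2)] i closed[OF mm(1) d] by blast
      also have "\<dots> = a i (?pr B F i d)"
        using p i d by blast
      also have "\<dots> = a i (?pr B' F i (\<theta> F d))"
        using \<theta>[OF ok(1)] i d by simp
      also have "\<dots> = ?pr B' F' i (?m' (\<theta> F d))"
        using p' i closed[OF t(1) d] by simp
      finally show "?pr B' F' i ((\<theta> F' \<circ> ?m) d) = ?pr B' F' i ((?m' \<circ> \<theta> F) d)"
        by simp
    qed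
    then show ?thesis
      by simp
  qed
  show ?thesis
  proof (intro conjI allI impI exI[of _ \<theta>])
    fix F assume F: "?ok F"
    interpret B: sheaf_family G T R X act B I F by (rule fam(1)[OF F])
    show "is_gpresheaf G T R act B (underlying_product G T X act I F)"
      by (rule B.is_gpresheaf_underlying_product)
    show "is_gsheaf G T R X act B.L"
      by (rule B.is_gsheaf_L)
    show "\<forall>i\<in>I. gsheaf_morphism G R X B.L (F i) (B.pr i)"
      using B.projection_morphism by blast
    show "\<exists>!h. h \<in> extensional (topspace (sh_space D)) \<and> gsheaf_morphism G R X D B.L h \<and>
        (\<forall>i\<in>I. \<forall>d\<in>topspace (sh_space D). B.pr i (h d) = f i d)"
      if "is_gsheaf G T R X act D \<and> (\<forall>i\<in>I. gsheaf_morphism G R X D (F i) (f i))"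
      for D :: "('g, 'x, 'r, 'd) gsheaf" and f
      by (rule B.universal_property) (use that in auto)
    show "gsheaf_isomorphism G R X (?L B F) (?L B' F) (\<theta> F)"
      by (rule iso[OF F])
    show "\<forall>i\<in>I. \<forall>e\<in>?S B F. ?pr B' F i (\<theta> F e) = ?pr B F i e"
      using \<theta>[OF F] by blast
  qed (use natural in blast)
qed

end
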